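(* Let $K$ be a unital commutative ring and let $A$ be an associative unital $K$-superalgebra which is free as a $K$-module with a $K$-basis containing the identity. The universal central extension of $\mathfrak{sl}(2,1,A)$ (via the canonical epimorphism $\varphi\colon\mathfrak{st}(2,1,A)\to\mathfrak{sl}(2,1,A)$, $F_{ij}(a)\mapsto E_{ij}(a)$) and of $\mathfrak{st}(2,1,A)$ (via the identity) is $\mathfrak{st}(2,1,A)$. Moreover, $\mathrm{H}_2\big(\mathfrak{st}(2,1,A)\big)=0$.
   Context: $K$ is regarded as concentrated in even degree; $A=A_{\bar 0}\oplus A_{\bar 1}$ is $\mathbb{Z}/2$-graded and $|a|$ denotes the degree of a homogeneous element. Lie superalgebras: a Lie superalgebra over $K$ is a $\mathbb{Z}/2$-graded $K$-module $L$ with an even $K$-bilinear bracket such that $[x,y]=-(-1)^{|x||y|}[y,x]$, $[x_{\bar 0},x_{\bar 0}]=0$ for $x_{\bar 0}\in L_{\bar 0}$, and $(-1)^{|x||z|}[[x,y],z]+(-1)^{|x||y|}[[y,z],x]+(-1)^{|y||z|}[[z,x],y]=0$ for homogeneous $x,y,z$. A central extension of $L$ is a surjective (even) Lie superalgebra homomorphism $M\to L$ whose kernel lies in the centre of $M$. It is universal if for every central extension $\tau\colon M'\to L$ there is a unique Lie superalgebra homomorphism $\rho\colon M\to M'$ whose composite with $\tau$ is the given map $M\to L$. For a perfect Lie superalgebra $L$, the second homology $\mathrm{H}_2(L)$ is the kernel of the universal central extension of $L$. Indices $1,2$ are even ($|1|=|2|=\bar 0$) and $3$ is odd ($|3|=\bar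 1$). $\mathfrak{gl}(2,1,A)$ is the associative superalgebra of $3\times 3$ matrices over $A$ with the usual matrix product, graded so that the matrix $E_{ij}(a)$ with $a$ (homogeneous) in position $(i,j)$ and zeros elsewhere has degree $|i|+|j|+|a|$; it is a Lie superalgebra under $[x,y]=xy-(-1)^{|x||y|}yx$, and $\mathfrak{sl}(2,1,A)=[\mathfrak{gl}(2,1,A),\mathfrak{gl}(2,1,A)]$. $\mathfrak{st}(2,1,A)$ is the Lie superalgebra over $K$ generated by homogeneous elements $F_{ij}(a)$, $1\le i\ne j\le 3$, $a\in A$ homogeneous, of degree $|F_{ij}(a)|=|i|+|j|+|a|$, subject to: $a\mapsto F_{ij}(a)$ is $K$-linear; $[F_{ij}(a),F_{jk}(b)]=F_{ik}(ab)$ for distinct $i,j,k$; $[F_{ij}(a),F_{kl}(b)]=0$ for $j\ne k$, $i\ne l$. Both Lie superalgebras are perfect. *)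

theory Defs
  imports "HOL-Algebra.Module" "HOL-Algebra.AbelCoset" "HOL-Library.Z2"
begin

text \<open>
  Superalgebras, associative or Lie, are carrier-based structures over the module record of
  HOL-Algebra, together with the family of homogeneous components indexed by Z/2 (type
  \<^typ>\<open>bit\<close>). The field \<^const>\<open>mult\<close> holds the product of the superalgebra. For a Lie
  superalgebra this is the bracket, and the field \<^const>\<open>one\<close> carries no meaning.
\<close>

record ('k, 'v) superalgebra = "('k, 'v) module" +
  homog :: "bit \<Rightarrow> 'v set"

abbreviation bracket :: "('k, 'v) superalgebra \<Rightarrow> 'v \<Rightarrow> 'v \<Rightarrow> 'v" where
  "bracket L x y \<equiv> x \<otimes>\<^bsub>L\<^esub> y"

text \<open>The element $(-1)^d x$ for $d$ in Z/2.\<close>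

definition signed :: "('k, 'v) superalgebra \<Rightarrow> bit \<Rightarrow> 'v \<Rightarrow> 'v" where
  "signed V d x = (if d = 0 then x else \<ominus>\<^bsub>V\<^esub> x)"

locale graded_module = module K V
  for K :: "'k ring" and V :: "('k, 'v) superalgebra" +
  assumes homog_submodule: "submodule (homog V d) K V"
    and homog_inter: "homog V 0 \<inter> homog V 1 = {\<zero>\<^bsub>V\<^esub>}"
    and homog_sum: "x \<in> carrier V \<Longrightarrow> \<exists>y\<in>homog V 0. \<exists>z\<in>homog V 1. x = y \<oplus>\<^bsub>V\<^esub> z"

text \<open>The scalars are even, so no signs occur in the compatibility of product and scalars.\<close>

locale assoc_superalgebra = graded_module K A + A: ring A
  for K :: "'k ring" and A :: "('k, 'a) superalgebra" +
  assumes smult_mult_left: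
      "\<lbrakk>k \<in> carrier K; x \<in> carrier A; y \<in> carrier A\<rbrakk>
        \<Longrightarrow> (k \<odot>\<^bsub>A\<^esub> x) \<otimes>\<^bsub>A\<^esub> y = k \<odot>\<^bsub>A\<^esub> (x \<otimes>\<^bsub>A\<^esub> y)"
    and smult_mult_right:
      "\<lbrakk>k \<in> carrier K; x \<in> carrier A; y \<in> carrier A\<rbrakk>
        \<Longrightarrow> x \<otimes>\<^bsub>A\<^esub> (k \<odot>\<^bsub>A\<^esub> y) = k \<odot>\<^bsub>A\<^esub> (x \<otimes>\<^bsub>A\<^esub> y)"
    and homog_one: "\<one>\<^bsub>A\<^esub> \<in> homog A 0"
    and homog_mult: "\<lbrakk>x \<in> homog A p; y \<in> homog A q\<rbrakk> \<Longrightarrow> x \<otimes>\<^bsub>A\<^esub> y \<in> homog A (p + q)"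

locale lie_superalgebra = graded_module K L
  for K :: "'k ring" and L :: "('k, 'v) superalgebra" +
  assumes bracket_closed:
      "\<lbrakk>x \<in> carrier L; y \<in> carrier L\<rbrakk> \<Longrightarrow> bracket L x y \<in> carrier L"
    and bracket_add_left: "\<lbrakk>x \<in> carrier L; y \<in> carrier L; z \<in> carrier L\<rbrakk>
        \<Longrightarrow> bracket L (x \<oplus>\<^bsub>L\<^esub> y) z = bracket L x z \<oplus>\<^bsub>L\<^esub> bracket L y z"
    and bracket_add_right: "\<lbrakk>x \<in> carrier L; y \<in> carrier L; z \<in> carrier L\<rbrakk>
        \<Longrightarrow> bracket L x (y \<oplus>\<^bsub>L\<^esub> z) = bracket L x y \<oplus>\<^bsub>L\<^esub> bracket L x z"
    and bracket_smult_left: "\<lbrakk>k \<in> carrier K; x \<in> carrier L; y \<in> carrier L\<rbrakk>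
        \<Longrightarrow> bracket L (k \<odot>\<^bsub>L\<^esub> x) y = k \<odot>\<^bsub>L\<^esub> bracket L x y"
    and bracket_smult_right: "\<lbrakk>k \<in> carrier K; x \<in> carrier L; y \<in> carrier L\<rbrakk>
        \<Longrightarrow> bracket L x (k \<odot>\<^bsub>L\<^esub> y) = k \<odot>\<^bsub>L\<^esub> bracket L x y"
    and bracket_homog:
      "\<lbrakk>x \<in> homog L p; y \<in> homog L q\<rbrakk> \<Longrightarrow> bracket L x y \<in> homog L (p + q)"
    and bracket_antisym: "\<lbrakk>x \<in> homog L p; y \<in> homog L q\<rbrakk>
        \<Longrightarrow> bracket L x y = \<ominus>\<^bsub>L\<^esub> signed L (p * q) (bracket L y x)"
    and bracket_even_self: "x \<in> homog L 0 \<Longrightarrow> bracket L x x = \<zero>\<^bsub>L\<^esub>"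
    and bracket_jacobi: "\<lbrakk>x \<in> homog L p; y \<in> homog L q; z \<in> homog L r\<rbrakk>
        \<Longrightarrow> signed L (p * r) (bracket L (bracket L x y) z)
          \<oplus>\<^bsub>L\<^esub> signed L (p * q) (bracket L (bracket L y z) x)
          \<oplus>\<^bsub>L\<^esub> signed L (q * r) (bracket L (bracket L z x) y) = \<zero>\<^bsub>L\<^esub>"

definition lie_hom ::
  "'k ring \<Rightarrow> ('k, 'v) superalgebra \<Rightarrow> ('k, 'w) superalgebra \<Rightarrow> ('v \<Rightarrow> 'w) set" where
  "lie_hom K L M = {f \<in> carrier L \<rightarrow> carrier M.
     (\<forall>x\<in>carrier L. \<forall>y\<in>carrier L. f (x \<oplus>\<^bsub>L\<^esub> y) = f x \<oplus>\<^bsub>M\<^esub> f y) \<and>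
     (\<forall>k\<in>carrier K. \<forall>x\<in>carrier L. f (k \<odot>\<^bsub>L\<^esub> x) = k \<odot>\<^bsub>M\<^esub> f x) \<and>
     (\<forall>x\<in>carrier L. \<forall>y\<in>carrier L. f (bracket L x y) = bracket M (f x) (f y)) \<and>
     (\<forall>d. \<forall>x\<in>homog L d. f x \<in> homog M d)}"

definition lie_centre :: "('k, 'v) superalgebra \<Rightarrow> 'v set" where
  "lie_centre L = {z \<in> carrier L. \<forall>x\<in>carrier L. bracket L z x = \<zero>\<^bsub>L\<^esub>}"

definition central_extension ::
  "'k ring \<Rightarrow> ('k, 'm) superalgebra \<Rightarrow> ('k, 'v) superalgebra \<Rightarrow> ('m \<Rightarrow> 'v) \<Rightarrow> bool" where
  "central_extension K M L \<pi> \<longleftrightarrow>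
     lie_superalgebra K M \<and> lie_superalgebra K L \<and> \<pi> \<in> lie_hom K M L \<and>
     \<pi> ` carrier M = carrier L \<and> a_kernel M L \<pi> \<subseteq> lie_centre M"

text \<open>
  HOL cannot quantify over types inside a formula, so the definition of universality is indexed
  by the type \<^typ>\<open>'t\<close> of the elements of the competing central extensions. Homomorphisms are
  compared on carriers only.
\<close>

definition universal_central_extension ::
  "'t itself \<Rightarrow> 'k ring \<Rightarrow> ('k, 'm) superalgebra \<Rightarrow> ('k, 'v) superalgebra \<Rightarrow> ('m \<Rightarrow> 'v) \<Rightarrow> bool" where
  "universal_central_extension (T :: 't itself) K M L \<pi> \<longleftrightarrow>
     central_extension K M L \<pi> \<and>
     (\<forall>(M' :: ('k, 't) superalgebra) \<tau>. central_extension K M' L \<tau> \<longrightarrow>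
       (\<exists>\<rho>\<in>lie_hom K M M'. (\<forall>x\<in>carrier M. \<tau> (\<rho> x) = \<pi> x) \<and>
         (\<forall>\<rho>'\<in>lie_hom K M M'. (\<forall>x\<in>carrier M. \<tau> (\<rho>' x) = \<pi> x) \<longrightarrow>
           (\<forall>x\<in>carrier M. \<rho>' x = \<rho> x))))"

definition derived_submodule :: "'k ring \<Rightarrow> ('k, 'v) superalgebra \<Rightarrow> 'v set" where
  "derived_submodule K L = \<Inter>{H. submodule H K L \<and>
     (\<forall>x\<in>carrier L. \<forall>y\<in>carrier L. bracket L x y \<in> H)}"

definition perfect :: "'k ring \<Rightarrow> ('k, 'v) superalgebra \<Rightarrow> bool" where
  "perfect K L \<longleftrightarrow> derived_submodule K L = carrier L"

definition graded_sub :: "('k, 'v) superalgebra \<Rightarrow> 'v set \<Rightarrow> ('k, 'v) superalgebra" where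
  "graded_sub L H = L\<lparr>carrier := H, homog := \<lambda>d. homog L d \<inter> H\<rparr>"

text \<open>
  The second homology is determined only up to isomorphism, hence a predicate; the type
  \<^typ>\<open>'t\<close> is again that of the competing extensions in the definition of universality.
\<close>

definition is_second_homology ::
  "'t itself \<Rightarrow> 'k ring \<Rightarrow> ('k, 'v) superalgebra \<Rightarrow> ('k, 'm) superalgebra \<Rightarrow> bool" where
  "is_second_homology T K L H \<longleftrightarrow> perfect K L \<and>
     (\<exists>(M :: ('k, 'm) superalgebra) \<pi>. universal_central_extension T K M L \<pi> \<and>
       H = graded_sub M (a_kernel M L \<pi>))"

definition module_basis :: "'k ring \<Rightarrow> ('k, 'v) superalgebra \<Rightarrow> 'v set \<Rightarrow> bool" where
  "module_basis K V B \<longleftrightarrow> B \<subseteq> carrier V \<and>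
     (\<forall>x\<in>carrier V. \<exists>!c. (\<forall>b\<in>B. c b \<in> carrier K) \<and> (\<forall>b. b \<notin> B \<longrightarrow> c b = \<zero>\<^bsub>K\<^esub>) \<and>
        finite {b. c b \<noteq> \<zero>\<^bsub>K\<^esub>} \<and>
        x = (\<Oplus>\<^bsub>V\<^esub>b\<in>{b. c b \<noteq> \<zero>\<^bsub>K\<^esub>}. c b \<odot>\<^bsub>V\<^esub> b))"


section \<open>The Lie superalgebras gl(2,1,A) and sl(2,1,A)\<close>

definition homog_part :: "('k, 'v) superalgebra \<Rightarrow> bit \<Rightarrow> 'v \<Rightarrow> 'v" where
  "homog_part V d x = (THE y. y \<in> homog V d \<and> x \<ominus>\<^bsub>V\<^esub> y \<in> homog V (d + 1))"

text \<open>The bilinear extension of $[x,y] = xy - (-1)^{|x||y|} yx$ from homogeneous elements.\<close>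

definition supercommutator :: "('k, 'v) superalgebra \<Rightarrow> 'v \<Rightarrow> 'v \<Rightarrow> 'v" where
  "supercommutator S x y = (\<Oplus>\<^bsub>S\<^esub>p\<in>{0,1}. \<Oplus>\<^bsub>S\<^esub>q\<in>{0,1}.
     (homog_part S p x \<otimes>\<^bsub>S\<^esub> homog_part S q y)
       \<ominus>\<^bsub>S\<^esub> signed S (p * q) (homog_part S q y \<otimes>\<^bsub>S\<^esub> homog_part S p x))"

definition lie_of :: "('k, 'v) superalgebra \<Rightarrow> ('k, 'v) superalgebra" where
  "lie_of S = S\<lparr>mult := supercommutator S\<rparr>"

datatype idx = I1 | I2 | I3

fun idx_parity :: "idx \<Rightarrow> bit" where
  "idx_parity I1 = 0"
| "idx_parity I2 = 0"
| "idx_parity I3 = 1"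

type_synonym 'a mat = "idx \<Rightarrow> idx \<Rightarrow> 'a"

definition mat_superalgebra :: "('k, 'a) superalgebra \<Rightarrow> ('k, 'a mat) superalgebra" where
  "mat_superalgebra A = \<lparr>
     carrier = {x. \<forall>i j. x i j \<in> carrier A},
     mult = (\<lambda>x y i j. x i I1 \<otimes>\<^bsub>A\<^esub> y I1 j \<oplus>\<^bsub>A\<^esub> x i I2 \<otimes>\<^bsub>A\<^esub> y I2 j \<oplus>\<^bsub>A\<^esub> x i I3 \<otimes>\<^bsub>A\<^esub> y I3 j),
     one = (\<lambda>i j. if i = j then \<one>\<^bsub>A\<^esub> else \<zero>\<^bsub>A\<^esub>),
     zero = (\<lambda>i j. \<zero>\<^bsub>A\<^esub>),
     add = (\<lambda>x y i j. x i j \<oplus>\<^bsub>A\<^esub> y i j),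
     smult = (\<lambda>k x i j. k \<odot>\<^bsub>A\<^esub> x i j),
     homog = (\<lambda>d. {x. \<forall>i j. x i j \<in> homog A (d + idx_parity i + idx_parity j)})\<rparr>"

definition gl21 :: "('k, 'a) superalgebra \<Rightarrow> ('k, 'a mat) superalgebra" where
  "gl21 A = lie_of (mat_superalgebra A)"

definition sl21 :: "'k ring \<Rightarrow> ('k, 'a) superalgebra \<Rightarrow> ('k, 'a mat) superalgebra" where
  "sl21 K A = graded_sub (gl21 A) (derived_submodule K (gl21 A))"

definition E :: "('k, 'a) superalgebra \<Rightarrow> idx \<Rightarrow> idx \<Rightarrow> 'a \<Rightarrow> 'a mat" where
  "E A i j a = (\<lambda>k l. if k = i \<and> l = j then a else \<zero>\<^bsub>A\<^esub>)"


section \<open>Presentations of Lie superalgebras\<close>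

text \<open>
  The Lie superalgebra over \<^term>\<open>K\<close> generated by elements \<^term>\<open>g \<in> G\<close>, homogeneous of
  degree \<^term>\<open>deg g\<close>, subject to the relations \<^term>\<open>t = u\<close> for \<^term>\<open>(t, u) \<in> R\<close>, is the
  set of formal expressions in the generators modulo the least congruence \<open>lie_eq\<close> containing
  \<^term>\<open>R\<close> and enforcing the axioms of Lie superalgebras. For the quotient to be graded, the
  two sides of each relation must have a common degree.
\<close>

datatype ('k, 'g) lie_term =
    Zero
  | Gen 'g
  | Add "('k, 'g) lie_term" "('k, 'g) lie_term"
  | Neg "('k, 'g) lie_term"
  | Smult 'k "('k, 'g) lie_term"
  | Br "('k, 'g) lie_term" "('k, 'g) lie_term"

inductive_set lie_terms :: "'k ring \<Rightarrow> 'g set \<Rightarrow> ('k, 'g) lie_term set"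
  for K :: "'k ring" and G :: "'g set" where
  "Zero \<in> lie_terms K G"
| "g \<in> G \<Longrightarrow> Gen g \<in> lie_terms K G"
| "\<lbrakk>t \<in> lie_terms K G; u \<in> lie_terms K G\<rbrakk> \<Longrightarrow> Add t u \<in> lie_terms K G"
| "t \<in> lie_terms K G \<Longrightarrow> Neg t \<in> lie_terms K G"
| "\<lbrakk>k \<in> carrier K; t \<in> lie_terms K G\<rbrakk> \<Longrightarrow> Smult k t \<in> lie_terms K G"
| "\<lbrakk>t \<in> lie_terms K G; u \<in> lie_terms K G\<rbrakk> \<Longrightarrow> Br t u \<in> lie_terms K G"

inductive term_degree ::
  "'k ring \<Rightarrow> 'g set \<Rightarrow> ('g \<Rightarrow> bit) \<Rightarrow> ('k, 'g) lie_term \<Rightarrow> bit \<Rightarrow> bool"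
  for K :: "'k ring" and G :: "'g set" and deg :: "'g \<Rightarrow> bit" where
  "term_degree K G deg Zero p"
| "g \<in> G \<Longrightarrow> term_degree K G deg (Gen g) (deg g)"
| "\<lbrakk>term_degree K G deg t p; term_degree K G deg u p\<rbrakk> \<Longrightarrow> term_degree K G deg (Add t u) p"
| "term_degree K G deg t p \<Longrightarrow> term_degree K G deg (Neg t) p"
| "\<lbrakk>k \<in> carrier K; term_degree K G deg t p\<rbrakk> \<Longrightarrow> term_degree K G deg (Smult k t) p"
| "\<lbrakk>term_degree K G deg t p; term_degree K G deg u q\<rbrakk>
    \<Longrightarrow> term_degree K G deg (Br t u) (p + q)"

definition signed_term :: "bit \<Rightarrow> ('k, 'g) lie_term \<Rightarrow> ('k, 'g) lie_term" where
  "signed_term d t = (if d = 0 then t else Neg t)"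

inductive lie_eq ::
  "'k ring \<Rightarrow> 'g set \<Rightarrow> ('g \<Rightarrow> bit) \<Rightarrow> (('k, 'g) lie_term \<times> ('k, 'g) lie_term) set
    \<Rightarrow> ('k, 'g) lie_term \<Rightarrow> ('k, 'g) lie_term \<Rightarrow> bool"
  for K :: "'k ring" and G :: "'g set" and deg :: "'g \<Rightarrow> bit"
    and R :: "(('k, 'g) lie_term \<times> ('k, 'g) lie_term) set" where
  eq_rel: "\<lbrakk>(t, u) \<in> R; t \<in> lie_terms K G; u \<in> lie_terms K G\<rbrakk> \<Longrightarrow> lie_eq K G deg R t u"
| eq_refl: "t \<in> lie_terms K G \<Longrightarrow> lie_eq K G deg R t t"
| eq_sym: "lie_eq K G deg R t u \<Longrightarrow> lie_eq K G deg R u t"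
| eq_trans: "\<lbrakk>lie_eq K G deg R t u; lie_eq K G deg R u v\<rbrakk> \<Longrightarrow> lie_eq K G deg R t v"
| cong_Add: "\<lbrakk>lie_eq K G deg R t t'; lie_eq K G deg R u u'\<rbrakk>
    \<Longrightarrow> lie_eq K G deg R (Add t u) (Add t' u')"
| cong_Neg: "lie_eq K G deg R t t' \<Longrightarrow> lie_eq K G deg R (Neg t) (Neg t')"
| cong_Smult: "\<lbrakk>k \<in> carrier K; lie_eq K G deg R t t'\<rbrakk>
    \<Longrightarrow> lie_eq K G deg R (Smult k t) (Smult k t')"
| cong_Br: "\<lbrakk>lie_eq K G deg R t t'; lie_eq K G deg R u u'\<rbrakk>
    \<Longrightarrow> lie_eq K G deg R (Br t u) (Br t' u')"
| add_assoc: "\<lbrakk>t \<in> lie_terms K G; u \<in> lie_terms K G; v \<in> lie_terms K G\<rbrakk>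
    \<Longrightarrow> lie_eq K G deg R (Add (Add t u) v) (Add t (Add u v))"
| add_comm: "\<lbrakk>t \<in> lie_terms K G; u \<in> lie_terms K G\<rbrakk> \<Longrightarrow> lie_eq K G deg R (Add t u) (Add u t)"
| add_zero: "t \<in> lie_terms K G \<Longrightarrow> lie_eq K G deg R (Add Zero t) t"
| add_neg: "t \<in> lie_terms K G \<Longrightarrow> lie_eq K G deg R (Add (Neg t) t) Zero"
| smult_left: "\<lbrakk>k \<in> carrier K; l \<in> carrier K; t \<in> lie_terms K G\<rbrakk>
    \<Longrightarrow> lie_eq K G deg R (Smult (k \<oplus>\<^bsub>K\<^esub> l) t) (Add (Smult k t) (Smult l t))"
| smult_right: "\<lbrakk>k \<in> carrier K; t \<in> lie_terms K G; u \<in> lie_terms K G\<rbrakk>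
    \<Longrightarrow> lie_eq K G deg R (Smult k (Add t u)) (Add (Smult k t) (Smult k u))"
| smult_mult: "\<lbrakk>k \<in> carrier K; l \<in> carrier K; t \<in> lie_terms K G\<rbrakk>
    \<Longrightarrow> lie_eq K G deg R (Smult (k \<otimes>\<^bsub>K\<^esub> l) t) (Smult k (Smult l t))"
| smult_unit: "t \<in> lie_terms K G \<Longrightarrow> lie_eq K G deg R (Smult \<one>\<^bsub>K\<^esub> t) t"
| br_add_left: "\<lbrakk>t \<in> lie_terms K G; u \<in> lie_terms K G; v \<in> lie_terms K G\<rbrakk>
    \<Longrightarrow> lie_eq K G deg R (Br (Add t u) v) (Add (Br t v) (Br u v))"
| br_add_right: "\<lbrakk>t \<in> lie_terms K G; u \<in> lie_terms K G; v \<in> lie_terms K G\<rbrakk>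
    \<Longrightarrow> lie_eq K G deg R (Br t (Add u v)) (Add (Br t u) (Br t v))"
| br_smult_left: "\<lbrakk>k \<in> carrier K; t \<in> lie_terms K G; u \<in> lie_terms K G\<rbrakk>
    \<Longrightarrow> lie_eq K G deg R (Br (Smult k t) u) (Smult k (Br t u))"
| br_smult_right: "\<lbrakk>k \<in> carrier K; t \<in> lie_terms K G; u \<in> lie_terms K G\<rbrakk>
    \<Longrightarrow> lie_eq K G deg R (Br t (Smult k u)) (Smult k (Br t u))"
| br_antisym: "\<lbrakk>term_degree K G deg t p; term_degree K G deg u q\<rbrakk>
    \<Longrightarrow> lie_eq K G deg R (Br t u) (Neg (signed_term (p * q) (Br u t)))"
| br_even_self: "term_degree K G deg t 0 \<Longrightarrow> lie_eq K G deg R (Br t t) Zero"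
| br_jacobi: "\<lbrakk>term_degree K G deg t p; term_degree K G deg u q; term_degree K G deg v r\<rbrakk>
    \<Longrightarrow> lie_eq K G deg R
      (Add (Add (signed_term (p * r) (Br (Br t u) v)) (signed_term (p * q) (Br (Br u v) t)))
        (signed_term (q * r) (Br (Br v t) u))) Zero"

definition lie_class ::
  "'k ring \<Rightarrow> 'g set \<Rightarrow> ('g \<Rightarrow> bit) \<Rightarrow> (('k, 'g) lie_term \<times> ('k, 'g) lie_term) set
    \<Rightarrow> ('k, 'g) lie_term \<Rightarrow> ('k, 'g) lie_term set" where
  "lie_class K G deg R t = {u. lie_eq K G deg R t u}"

text \<open>The unions below are taken over representatives of the classes.\<close>

definition presented_lie ::
  "'k ring \<Rightarrow> 'g set \<Rightarrow> ('g \<Rightarrow> bit) \<Rightarrow> (('k, 'g) lie_term \<times> ('k, 'g) lie_term) set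
    \<Rightarrow> ('k, ('k, 'g) lie_term set) superalgebra" where
  "presented_lie K G deg R = \<lparr>
     carrier = lie_class K G deg R ` lie_terms K G,
     mult = (\<lambda>X Y. \<Union>t\<in>X. \<Union>u\<in>Y. lie_class K G deg R (Br t u)),
     one = undefined,
     zero = lie_class K G deg R Zero,
     add = (\<lambda>X Y. \<Union>t\<in>X. \<Union>u\<in>Y. lie_class K G deg R (Add t u)),
     smult = (\<lambda>k X. \<Union>t\<in>X. lie_class K G deg R (Smult k t)),
     homog = (\<lambda>d. lie_class K G deg R ` {t. term_degree K G deg t d})\<rparr>"


section \<open>The Steinberg Lie superalgebra st(2,1,A)\<close>

text \<open>
  The generator $F_{ij}(a)$, for $a$ homogeneous of degree $p$, is \<^term>\<open>(i, j, p, a)\<close>. The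
  degree is recorded since $a = 0$ is homogeneous of both degrees. The two generators
  arising this way are both zero by linearity.
\<close>

type_synonym 'a st_gen = "idx \<times> idx \<times> bit \<times> 'a"

definition st_gens :: "('k, 'a) superalgebra \<Rightarrow> 'a st_gen set" where
  "st_gens A = {(i, j, p, a). i \<noteq> j \<and> a \<in> homog A p}"

definition st_degree :: "'a st_gen \<Rightarrow> bit" where
  "st_degree = (\<lambda>(i, j, p, a). idx_parity i + idx_parity j + p)"

inductive_set st_relations ::
  "'k ring \<Rightarrow> ('k, 'a) superalgebra
    \<Rightarrow> (('k, 'a st_gen) lie_term \<times> ('k, 'a st_gen) lie_term) set"
  for K :: "'k ring" and A :: "('k, 'a) superalgebra" where
  st_add: "\<lbrakk>i \<noteq> j; a \<in> homog A p; b \<in> homog A p\<rbrakk> \<Longrightarrow>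
    (Gen (i, j, p, a \<oplus>\<^bsub>A\<^esub> b), Add (Gen (i, j, p, a)) (Gen (i, j, p, b))) \<in> st_relations K A"
| st_smult: "\<lbrakk>i \<noteq> j; k \<in> carrier K; a \<in> homog A p\<rbrakk> \<Longrightarrow>
    (Gen (i, j, p, k \<odot>\<^bsub>A\<^esub> a), Smult k (Gen (i, j, p, a))) \<in> st_relations K A"
| st_bracket: "\<lbrakk>i \<noteq> j; j \<noteq> k; i \<noteq> k; a \<in> homog A p; b \<in> homog A q\<rbrakk> \<Longrightarrow>
    (Br (Gen (i, j, p, a)) (Gen (j, k, q, b)), Gen (i, k, p + q, a \<otimes>\<^bsub>A\<^esub> b)) \<in> st_relations K A"
| st_zero: "\<lbrakk>i \<noteq> j; k \<noteq> l; j \<noteq> k; i \<noteq> l; a \<in> homog A p; b \<in> homog A q\<rbrakk> \<Longrightarrow>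
    (Br (Gen (i, j, p, a)) (Gen (k, l, q, b)), Zero) \<in> st_relations K A"

definition st21 ::
  "'k ring \<Rightarrow> ('k, 'a) superalgebra \<Rightarrow> ('k, ('k, 'a st_gen) lie_term set) superalgebra" where
  "st21 K A = presented_lie K (st_gens A) st_degree (st_relations K A)"

definition F ::
  "'k ring \<Rightarrow> ('k, 'a) superalgebra \<Rightarrow> idx \<Rightarrow> idx \<Rightarrow> bit \<Rightarrow> 'a
    \<Rightarrow> ('k, 'a st_gen) lie_term set" where
  "F K A i j p a = lie_class K (st_gens A) st_degree (st_relations K A) (Gen (i, j, p, a))"

text \<open>The canonical epimorphism is determined, on the carrier, by its values on generators.\<close>

definition is_canonical_hom ::
  "'k ring \<Rightarrow> ('k, 'a) superalgebra \<Rightarrow> (('k, 'a st_gen) lie_term set \<Rightarrow> 'a mat) \<Rightarrow> bool" where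
  "is_canonical_hom K A \<phi> \<longleftrightarrow> \<phi> \<in> lie_hom K (st21 K A) (sl21 K A) \<and>
     (\<forall>i j p a. i \<noteq> j \<and> a \<in> homog A p \<longrightarrow> \<phi> (F K A i j p a) = E A i j a)"

end

theory Submission
  imports Defs
begin

text \<open>
  Write $e_{ij}(a)$ for elements of a Lie superalgebra $L$ that satisfy the defining relations of
  $\mathfrak{st}(2,1,A)$ (a Steinberg system, the same thing as a homomorphism
  $\mathfrak{st}(2,1,A) \to L$). The heart of the matter is that every Steinberg system lifts along
  every central extension $\tau : M \to L$ (\<open>steinberg_system_lift\<close>).

  Since the kernel of $\tau$ is central, a bracket in $M$ depends only on the images of its two
  arguments in $L$. Hence $f_{ij}(a) = [x, y]$, with $x$ and $y$ any lifts of $e_{ik}(a)$ and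
  $e_{kj}(1)$, is well defined, lifts $e_{ij}(a)$ and is linear in $a$; the point is to show that the
  $f_{ij}(a)$ satisfy the relations as well, and not only up to the kernel. For this, let the torus
  elements $h_{ij} = [e_{ij}(1), e_{ji}(1)]$ act. On brackets of lifts, their lifts act by the same
  weights as in $L$, and they annihilate every element of the kernel.

    \<^item> A bracket of lifts of $e_{ij}(a)$ and $e_{jk}(b)$ is fixed by any lift of $h_{ij}$, because
    its weight is $1$. On the other hand this action depends only on the image $e_{ik}(ab)$. So the
    bracket is determined by $ab$ and may be computed from $ab$ and $1$.

    \<^item> If $e_{ij}(a)$ and $e_{kl}(b)$ commute by one of the relations, then a bracket of their lifts
    lies in the kernel. For $(i,j) = (k,l)$ it vanishes after rewriting $e_{ij}(a)$ as
    $[e_{ik}(a), e_{kj}(1)]$. Otherwise the two have a common row or a common column, say the row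
    $i$. Among the two other indices there is one, $q$, whose parity is opposite to that of $i$. The
    weights of $h_{iq}$ on $e_{iq}$ and on the other element are $1 + (-1)^{|i|+|q|} = 0$ and $1$, so
    the bracket has weight $1$ and is also annihilated, hence is zero. This is where the shape
    $2|1$ enters: the weight is a unit of \<^emph>\<open>every\<close> ring $K$.

  Because $\mathfrak{st}(2,1,A)$ is perfect, lifts of homomorphisms out of it are unique. So it is the
  universal central extension of each of its central quotients (\<open>universal_st21\<close>), in particular of
  itself. For $\mathfrak{sl}(2,1,A)$ it remains to see that the canonical map is a central extension.
  It is onto since brackets of matrix units are combinations of brackets of off-diagonal ones.
  Every element of $\mathfrak{st}(2,1,A)$ is a sum $d + \sum F_{ij}(a_{ij})$, where $d$ is mapped to a
  diagonal matrix and $[d, F_{kl}(c)]$ is always some $F_{kl}(c')$. For an element of the kernel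
  all $a_{ij}$ vanish, and then all $c'$ do, which makes it central.

  Finally, let $\pi : M \to \mathfrak{st}(2,1,A)$ be any universal central extension. The universality of
  $\mathfrak{st}(2,1,A)$ over itself yields a section of $\pi$, and that of $M$ shows that the section
  is inverse to $\pi$. So $\pi$ has trivial kernel.
\<close>

section \<open>Graded modules\<close>

text \<open>
  The default rules rewrite sums and products of degrees to bit operations. They are switched off to
  keep degree computations inside the field Z/2.
\<close>

declare add_bit_eq_xor [simp del] mult_bit_eq_and [simp del]

lemma bit_add_self [simp]: "(p::bit) + p = 0"
  by (cases p) simp_all

lemma bit_add_self_left [simp]: "(p::bit) + (p + q) = q"
  by (cases p; cases q) simp_all

lemma bit_mult_self [simp]: "(p::bit) * p = p"
  by (cases p) simp_all

context graded_module
begin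

lemma homog_closed [simp]: "x \<in> homog V d \<Longrightarrow> x \<in> carrier V"
  using submoduleE(1)[OF homog_submodule] by blast

lemma homog_add [intro]: "x \<in> homog V d \<Longrightarrow> y \<in> homog V d \<Longrightarrow> x \<oplus>\<^bsub>V\<^esub> y \<in> homog V d"
  by (rule submoduleE(5)[OF homog_submodule])

lemma homog_neg [intro]: "x \<in> homog V d \<Longrightarrow> \<ominus>\<^bsub>V\<^esub> x \<in> homog V d"
  by (rule submoduleE(3)[OF homog_submodule])

lemma homog_smult [intro]: "k \<in> carrier K \<Longrightarrow> x \<in> homog V d \<Longrightarrow> k \<odot>\<^bsub>V\<^esub> x \<in> homog V d"
  by (rule submoduleE(4)[OF homog_submodule])

lemma homog_zero [simp, intro]: "\<zero>\<^bsub>V\<^esub> \<in> homog V d"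
  using homog_inter by (cases d) auto

lemma homog_minus [intro]: "x \<in> homog V d \<Longrightarrow> y \<in> homog V d \<Longrightarrow> x \<ominus>\<^bsub>V\<^esub> y \<in> homog V d"
  unfolding a_minus_def by auto

lemma homog_disjoint: "x \<in> homog V p \<Longrightarrow> x \<in> homog V q \<Longrightarrow> p \<noteq> q \<Longrightarrow> x = \<zero>\<^bsub>V\<^esub>"
  using homog_inter by (cases p; cases q) auto

lemma minus_zero_V [simp]: "\<ominus>\<^bsub>V\<^esub> \<zero>\<^bsub>V\<^esub> = \<zero>\<^bsub>V\<^esub>"
  by (rule M.minus_equality) simp_all

lemma signed_closed [simp, intro]: "x \<in> carrier V \<Longrightarrow> signed V d x \<in> carrier V"
  by (simp add: signed_def)

lemma signed_homog [intro]: "x \<in> homog V p \<Longrightarrow> signed V d x \<in> homog V p"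
  by (auto simp: signed_def)

lemma signed_signed [simp]: "x \<in> carrier V \<Longrightarrow> signed V p (signed V q x) = signed V (p + q) x"
  by (cases p; cases q) (simp_all add: signed_def)

lemma signed_0 [simp]: "signed V 0 x = x"
  by (simp add: signed_def)

lemma signed_1: "signed V 1 x = \<ominus>\<^bsub>V\<^esub> x"
  by (simp add: signed_def)

lemma signed_zero [simp]: "signed V p \<zero>\<^bsub>V\<^esub> = \<zero>\<^bsub>V\<^esub>"
  by (simp add: signed_def)

lemma signed_add: "x \<in> carrier V \<Longrightarrow> y \<in> carrier V \<Longrightarrow>
    signed V p (x \<oplus>\<^bsub>V\<^esub> y) = signed V p x \<oplus>\<^bsub>V\<^esub> signed V p y"
  by (simp add: signed_def M.minus_add)

lemma signed_neg: "x \<in> carrier V \<Longrightarrow> signed V p (\<ominus>\<^bsub>V\<^esub> x) = \<ominus>\<^bsub>V\<^esub> signed V p x"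
  by (simp add: signed_def)

lemma signed_smult: "k \<in> carrier K \<Longrightarrow> x \<in> carrier V \<Longrightarrow>
    signed V p (k \<odot>\<^bsub>V\<^esub> x) = k \<odot>\<^bsub>V\<^esub> signed V p x"
  by (simp add: signed_def smult_r_minus)

lemma homog_part_unique:
  assumes "y \<in> homog V d" "x \<ominus>\<^bsub>V\<^esub> y \<in> homog V (d + 1)" "x \<in> carrier V"
  shows "homog_part V d x = y"
  unfolding homog_part_def
proof (rule the_equality)
  show "y \<in> homog V d \<and> x \<ominus>\<^bsub>V\<^esub> y \<in> homog V (d + 1)" using assms by simp
next
  fix z assume z: "z \<in> homog V d \<and> x \<ominus>\<^bsub>V\<^esub> z \<in> homog V (d + 1)"
  have "(x \<ominus>\<^bsub>V\<^esub> y) \<ominus>\<^bsub>V\<^esub> (x \<ominus>\<^bsub>V\<^esub> z) = z \<ominus>\<^bsub>V\<^esub> y"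
    using z assms homog_closed[of y d] homog_closed[of z d]
    by (simp add: M.minus_eq M.minus_add M.a_ac M.r_neg2 M.r_neg1)
  moreover have "z \<ominus>\<^bsub>V\<^esub> y \<in> homog V d" using z assms by blast
  moreover have "(x \<ominus>\<^bsub>V\<^esub> y) \<ominus>\<^bsub>V\<^esub> (x \<ominus>\<^bsub>V\<^esub> z) \<in> homog V (d + 1)" using z assms by blast
  ultimately have "z \<ominus>\<^bsub>V\<^esub> y = \<zero>\<^bsub>V\<^esub>" using homog_disjoint[of _ d "d + 1"] by simp
  then show "z = y" using z assms
    by (metis M.minus_eq M.add.inv_solve_right M.l_zero M.zero_closed homog_closed)
qed

lemma homog_part_add_unique:
  assumes "y \<in> homog V d" "z \<in> homog V (d + 1)"
  shows "homog_part V d (y \<oplus>\<^bsub>V\<^esub> z) = y"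
proof (rule homog_part_unique)
  have "(y \<oplus>\<^bsub>V\<^esub> z) \<ominus>\<^bsub>V\<^esub> y = z"
    using homog_closed[OF assms(1)] homog_closed[OF assms(2)]
    by (simp add: M.a_comm[of y z] M.minus_eq M.a_assoc M.r_neg)
  then show "(y \<oplus>\<^bsub>V\<^esub> z) \<ominus>\<^bsub>V\<^esub> y \<in> homog V (d + 1)" using assms by simp
qed (use assms in auto)

lemma homog_part_homog:
  assumes "x \<in> homog V p" shows "homog_part V d x = (if d = p then x else \<zero>\<^bsub>V\<^esub>)"
proof (cases "d = p")
  case True
  then show ?thesis using homog_part_add_unique[of x d "\<zero>\<^bsub>V\<^esub>"] assms by simp
next
  case False
  then have "p = d + 1" by (cases p; cases d) simp_all
  then show ?thesis using homog_part_add_unique[of "\<zero>\<^bsub>V\<^esub>" d x] assms by simp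
qed

lemma decomposition_exists:
  assumes "x \<in> carrier V"
  obtains y z where "y \<in> homog V d" "z \<in> homog V (d + 1)" "x = y \<oplus>\<^bsub>V\<^esub> z"
proof -
  obtain y z where "y \<in> homog V 0" "z \<in> homog V 1" "x = y \<oplus>\<^bsub>V\<^esub> z"
    using homog_sum[OF assms] by auto
  then show ?thesis
    by (cases d) (use that[of y z] that[of z y] M.a_comm[of y z] homog_closed in auto)
qed

lemma homog_part_in [simp, intro]:
  assumes "x \<in> carrier V" shows "homog_part V d x \<in> homog V d"
  using decomposition_exists[OF assms, of d] homog_part_add_unique[of _ d] by metis

lemma homog_part_closed [simp, intro]: "x \<in> carrier V \<Longrightarrow> homog_part V d x \<in> carrier V"
  by (rule homog_closed[OF homog_part_in])

lemma homog_part_sum: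
  assumes "x \<in> carrier V" shows "x = homog_part V 0 x \<oplus>\<^bsub>V\<^esub> homog_part V 1 x"
proof -
  obtain y z where *: "y \<in> homog V 0" "z \<in> homog V (0 + 1)" "x = y \<oplus>\<^bsub>V\<^esub> z"
    using decomposition_exists[OF assms, of 0] by blast
  then have "homog_part V 0 x = y" by (simp only: homog_part_add_unique)
  moreover have "x = z \<oplus>\<^bsub>V\<^esub> y" using * M.a_comm[of y z] homog_closed by blast
  then have "homog_part V 1 x = z" using * homog_part_add_unique[of z 1 y] by simp
  ultimately show ?thesis using * by simp
qed

lemma homog_part_add:
  assumes "x \<in> carrier V" "y \<in> carrier V"
  shows "homog_part V d (x \<oplus>\<^bsub>V\<^esub> y) = homog_part V d x \<oplus>\<^bsub>V\<^esub> homog_part V d y"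
proof -
  obtain x0 x1 where x: "x0 \<in> homog V d" "x1 \<in> homog V (d + 1)" "x = x0 \<oplus>\<^bsub>V\<^esub> x1"
    using decomposition_exists[OF assms(1)] by blast
  obtain y0 y1 where y: "y0 \<in> homog V d" "y1 \<in> homog V (d + 1)" "y = y0 \<oplus>\<^bsub>V\<^esub> y1"
    using decomposition_exists[OF assms(2)] by blast
  have "x \<oplus>\<^bsub>V\<^esub> y = (x0 \<oplus>\<^bsub>V\<^esub> y0) \<oplus>\<^bsub>V\<^esub> (x1 \<oplus>\<^bsub>V\<^esub> y1)"
    using x y homog_closed by (auto simp: M.a_ac)
  then show ?thesis
    using x y homog_part_add_unique by (simp add: homog_add)
qed

lemma homog_part_smult:
  assumes "k \<in> carrier K" "x \<in> carrier V"
  shows "homog_part V d (k \<odot>\<^bsub>V\<^esub> x) = k \<odot>\<^bsub>V\<^esub> homog_part V d x"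
proof -
  obtain x0 x1 where x: "x0 \<in> homog V d" "x1 \<in> homog V (d + 1)" "x = x0 \<oplus>\<^bsub>V\<^esub> x1"
    using decomposition_exists[OF assms(2)] by blast
  then have "k \<odot>\<^bsub>V\<^esub> x = (k \<odot>\<^bsub>V\<^esub> x0) \<oplus>\<^bsub>V\<^esub> (k \<odot>\<^bsub>V\<^esub> x1)"
    using assms homog_closed by (auto simp: smult_r_distr)
  then show ?thesis
    using x assms homog_part_add_unique by (simp add: homog_smult)
qed

lemma homog_induct [consumes 1, case_names homog add]:
  assumes "x \<in> carrier V"
    and "\<And>p y. y \<in> homog V p \<Longrightarrow> P y"
    and "\<And>y z. y \<in> carrier V \<Longrightarrow> z \<in> carrier V \<Longrightarrow> P y \<Longrightarrow> P z \<Longrightarrow> P (y \<oplus>\<^bsub>V\<^esub> z)"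
  shows "P x"
  using homog_sum[OF assms(1)] assms(2,3) homog_closed by blast

end



section \<open>Lie superalgebras and supercommutators\<close>

lemma lie_of_simps [simp]:
  "carrier (lie_of S) = carrier S" "zero (lie_of S) = zero S" "add (lie_of S) = add S"
  "smult (lie_of S) = smult S" "homog (lie_of S) = homog S" "mult (lie_of S) = supercommutator S"
  "a_inv (lie_of S) = a_inv S" "signed (lie_of S) = signed S"
  by (simp_all add: lie_of_def a_inv_def signed_def fun_eq_iff)

lemma submodule_lie_of: "submodule H K (lie_of S) \<longleftrightarrow> submodule H K S"
  by (simp add: submodule_def submodule_axioms_def lie_of_def)

text \<open>
  The bracket does not occur in the axioms of a graded module.
\<close>

lemma graded_module_lie_of: "graded_module K S \<Longrightarrow> graded_module K (lie_of S)"
  by (simp add: graded_module_def graded_module_axioms_def submodule_lie_of module_def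
      module_axioms_def abelian_group_def abelian_monoid_def abelian_group_axioms_def)

context assoc_superalgebra
begin

text \<open>
  A single contribution to the supercommutator. The degrees are parameters instead of being read off
  from the arguments, which makes the expression bilinear on the whole carrier.
\<close>

definition graded_commutator :: "bit \<Rightarrow> bit \<Rightarrow> 'a \<Rightarrow> 'a \<Rightarrow> 'a" where
  "graded_commutator p q x y = x \<otimes>\<^bsub>A\<^esub> y \<ominus>\<^bsub>A\<^esub> signed A (p * q) (y \<otimes>\<^bsub>A\<^esub> x)"

lemma graded_commutator_closed [simp]: "x \<in> carrier A \<Longrightarrow> y \<in> carrier A \<Longrightarrow> graded_commutator p q x y \<in> carrier A"
  by (simp add: graded_commutator_def)

lemma graded_commutator_zero [simp]: "x \<in> carrier A \<Longrightarrow> graded_commutator p q x \<zero>\<^bsub>A\<^esub> = \<zero>\<^bsub>A\<^esub>" "x \<in> carrier A \<Longrightarrow> graded_commutator p q \<zero>\<^bsub>A\<^esub> x = \<zero>\<^bsub>A\<^esub>"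
  by (simp_all add: graded_commutator_def M.minus_eq)

lemma graded_commutator_add:
  assumes "x \<in> carrier A" "y \<in> carrier A" "z \<in> carrier A"
  shows "graded_commutator p q (x \<oplus>\<^bsub>A\<^esub> y) z = graded_commutator p q x z \<oplus>\<^bsub>A\<^esub> graded_commutator p q y z"
    and "graded_commutator p q z (x \<oplus>\<^bsub>A\<^esub> y) = graded_commutator p q z x \<oplus>\<^bsub>A\<^esub> graded_commutator p q z y"
  using assms by (simp_all add: graded_commutator_def M.minus_eq A.l_distr A.r_distr signed_add M.minus_add M.a_ac)

lemma graded_commutator_smult:
  assumes "k \<in> carrier K" "x \<in> carrier A" "y \<in> carrier A"
  shows "graded_commutator p q (k \<odot>\<^bsub>A\<^esub> x) y = k \<odot>\<^bsub>A\<^esub> graded_commutator p q x y"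
    and "graded_commutator p q x (k \<odot>\<^bsub>A\<^esub> y) = k \<odot>\<^bsub>A\<^esub> graded_commutator p q x y"
  using assms by (simp_all add: graded_commutator_def M.minus_eq smult_mult_left smult_mult_right signed_smult
      smult_r_distr smult_r_minus)

text \<open>
  The supercommutator is the sum of its four homogeneous contributions. Bilinearity follows because
  taking homogeneous components is linear.
\<close>

lemma supercommutator_expand:
  assumes "x \<in> carrier A" "y \<in> carrier A"
  shows "supercommutator A x y =
    (graded_commutator 0 0 (homog_part A 0 x) (homog_part A 0 y) \<oplus>\<^bsub>A\<^esub> graded_commutator 0 1 (homog_part A 0 x) (homog_part A 1 y)) \<oplus>\<^bsub>A\<^esub>
    (graded_commutator 1 0 (homog_part A 1 x) (homog_part A 0 y) \<oplus>\<^bsub>A\<^esub> graded_commutator 1 1 (homog_part A 1 x) (homog_part A 1 y))"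
  unfolding supercommutator_def graded_commutator_def[symmetric] using assms by (simp add: M.a_ac)

lemma supercommutator_homog:
  assumes "x \<in> homog A p" "y \<in> homog A q"
  shows "supercommutator A x y = graded_commutator p q x y"
  using assms by (cases p; cases q) (simp_all add: supercommutator_expand homog_part_homog)

lemma supercommutator_closed: "x \<in> carrier A \<Longrightarrow> y \<in> carrier A \<Longrightarrow> supercommutator A x y \<in> carrier A"
  by (simp add: supercommutator_expand)

lemma supercommutator_add:
  assumes "x \<in> carrier A" "y \<in> carrier A" "z \<in> carrier A"
  shows "supercommutator A (x \<oplus>\<^bsub>A\<^esub> y) z = supercommutator A x z \<oplus>\<^bsub>A\<^esub> supercommutator A y z"
    and "supercommutator A z (x \<oplus>\<^bsub>A\<^esub> y) = supercommutator A z x \<oplus>\<^bsub>A\<^esub> supercommutator A z y"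
  using assms by (simp_all add: supercommutator_expand homog_part_add graded_commutator_add M.a_ac)

lemma supercommutator_smult:
  assumes "k \<in> carrier K" "x \<in> carrier A" "y \<in> carrier A"
  shows "supercommutator A (k \<odot>\<^bsub>A\<^esub> x) y = k \<odot>\<^bsub>A\<^esub> supercommutator A x y"
    and "supercommutator A x (k \<odot>\<^bsub>A\<^esub> y) = k \<odot>\<^bsub>A\<^esub> supercommutator A x y"
  using assms by (simp_all add: supercommutator_expand homog_part_smult graded_commutator_smult smult_r_distr)

lemma graded_commutator_in_homog:
  assumes "x \<in> homog A p" "y \<in> homog A q"
  shows "graded_commutator p q x y \<in> homog A (p + q)"
  unfolding graded_commutator_def using homog_mult[OF assms] homog_mult[OF assms(2,1)] 
  by (metis add.commute homog_minus signed_homog)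

text \<open>
  Each of the six products of the three elements occurs twice, with opposite signs; this is checked
  for all parities.
\<close>

lemma graded_commutator_jacobi:
  assumes "x \<in> carrier A" "y \<in> carrier A" "z \<in> carrier A"
  shows "signed A (p * r) (graded_commutator (p + q) r (graded_commutator p q x y) z)
          \<oplus>\<^bsub>A\<^esub> signed A (p * q) (graded_commutator (q + r) p (graded_commutator q r y z) x)
          \<oplus>\<^bsub>A\<^esub> signed A (q * r) (graded_commutator (r + p) q (graded_commutator r p z x) y) = \<zero>\<^bsub>A\<^esub>"
  apply (cases p; cases q; cases r)
  apply (simp_all add: graded_commutator_def signed_def)
  using assms
  apply algebra+
  done

theorem lie_superalgebra_lie_of: "lie_superalgebra K (lie_of A)"
proof -
  interpret L: graded_module K "lie_of A"
    by (rule graded_module_lie_of) unfold_locales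
  show ?thesis
  proof (unfold_locales, goal_cases)
    case (7 x p y q)
    then have "x \<in> homog A p" "y \<in> homog A q" by simp_all
    then show ?case using homog_closed[of x p] homog_closed[of y q]
      by (cases p; cases q; simp add: supercommutator_homog; simp add: graded_commutator_def signed_def; algebra)
  next
    case (8 x)
    then have "x \<in> homog A 0" by simp
    then show ?case using homog_closed[of x 0]
      by (simp add: supercommutator_homog[of x 0 x 0] graded_commutator_def signed_def M.minus_eq M.r_neg)
  next
    case (9 x p y q z r)
    then show ?case using graded_commutator_jacobi[of x y z p r q]
      by (simp add: supercommutator_homog[of _ p _ q] supercommutator_homog[of _ q _ r]
          supercommutator_homog[of _ r _ p] graded_commutator_in_homog
          supercommutator_homog[of _ "p + q" _ r] supercommutator_homog[of _ "q + r" _ p]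
          supercommutator_homog[of _ "r + p" _ q])
  qed (simp_all add: supercommutator_closed supercommutator_add supercommutator_smult
      supercommutator_homog graded_commutator_in_homog)
qed

end

context lie_superalgebra
begin

lemmas [simp] = bracket_closed

lemma bracket_zero [simp]:
  assumes "x \<in> carrier L"
  shows "bracket L x \<zero>\<^bsub>L\<^esub> = \<zero>\<^bsub>L\<^esub>" "bracket L \<zero>\<^bsub>L\<^esub> x = \<zero>\<^bsub>L\<^esub>"
  using bracket_smult_left[of "\<zero>\<^bsub>K\<^esub>" "\<zero>\<^bsub>L\<^esub>" x] bracket_smult_right[of "\<zero>\<^bsub>K\<^esub>" x "\<zero>\<^bsub>L\<^esub>"] assms
  by simp_all

lemma bracket_neg:
  assumes "x \<in> carrier L" "y \<in> carrier L"
  shows "bracket L x (\<ominus>\<^bsub>L\<^esub> y) = \<ominus>\<^bsub>L\<^esub> bracket L x y" "bracket L (\<ominus>\<^bsub>L\<^esub> x) y = \<ominus>\<^bsub>L\<^esub> bracket L x y"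
proof -
  have "bracket L x (\<ominus>\<^bsub>L\<^esub> y) \<oplus>\<^bsub>L\<^esub> bracket L x y = \<zero>\<^bsub>L\<^esub>"
    "bracket L (\<ominus>\<^bsub>L\<^esub> x) y \<oplus>\<^bsub>L\<^esub> bracket L x y = \<zero>\<^bsub>L\<^esub>"
    using assms by (simp_all add: M.l_neg flip: bracket_add_left bracket_add_right)
  then show "bracket L x (\<ominus>\<^bsub>L\<^esub> y) = \<ominus>\<^bsub>L\<^esub> bracket L x y" "bracket L (\<ominus>\<^bsub>L\<^esub> x) y = \<ominus>\<^bsub>L\<^esub> bracket L x y"
    using assms by (auto intro!: M.minus_equality[symmetric])
qed

lemma bracket_signed:
  assumes "x \<in> carrier L" "y \<in> carrier L"
  shows "bracket L x (signed L p y) = signed L p (bracket L x y)" "bracket L (signed L p x) y = signed L p (bracket L x y)"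
  using assms by (simp_all add: signed_def bracket_neg)

text \<open>
  The Jacobi identity in the form that right multiplications are superderivations. Its sign involves
  only the degrees of the second and the third element, so that the first one may be inhomogeneous.
  This is what makes inductions over iterated brackets possible without splitting into components.
\<close>

lemma leibniz_right:
  assumes "x \<in> carrier L" "y \<in> homog L q" "z \<in> homog L r"
  shows "bracket L x (bracket L y z) =
    bracket L (bracket L x y) z \<ominus>\<^bsub>L\<^esub> signed L (q * r) (bracket L (bracket L x z) y)"
  using assms(1)
proof (induction rule: homog_induct)
  case (homog p x)
  note c [simp] = homog_closed[OF homog] homog_closed[OF assms(2)] homog_closed[OF assms(3)]
  let ?a = "bracket L (bracket L x y) z"
  let ?b = "bracket L x (bracket L y z)"
  let ?c = "bracket L (bracket L x z) y"
  have 1: "bracket L (bracket L y z) x = \<ominus>\<^bsub>L\<^esub> signed L ((q + r) * p) ?b"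
    by (rule bracket_antisym) (use homog assms bracket_homog in auto)
  have "bracket L z x = \<ominus>\<^bsub>L\<^esub> signed L (r * p) (bracket L x z)"
    by (rule bracket_antisym) (use homog assms in auto)
  then have 2: "bracket L (bracket L z x) y = \<ominus>\<^bsub>L\<^esub> signed L (r * p) ?c"
    by (simp add: bracket_neg bracket_signed)
  have "signed L (p * r) ?a \<oplus>\<^bsub>L\<^esub> signed L (p * q) (\<ominus>\<^bsub>L\<^esub> signed L ((q + r) * p) ?b)
      \<oplus>\<^bsub>L\<^esub> signed L (q * r) (\<ominus>\<^bsub>L\<^esub> signed L (r * p) ?c) = \<zero>\<^bsub>L\<^esub>"
    using bracket_jacobi[OF homog assms(2,3)] unfolding 1 2 .
  then have "signed L (p * r) (signed L (p * r) ?a \<oplus>\<^bsub>L\<^esub> signed L (p * q) (\<ominus>\<^bsub>L\<^esub> signed L ((q + r) * p) ?b)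
      \<oplus>\<^bsub>L\<^esub> signed L (q * r) (\<ominus>\<^bsub>L\<^esub> signed L (r * p) ?c)) = \<zero>\<^bsub>L\<^esub>" by simp
  then have "?a \<oplus>\<^bsub>L\<^esub> \<ominus>\<^bsub>L\<^esub> ?b \<oplus>\<^bsub>L\<^esub> \<ominus>\<^bsub>L\<^esub> signed L (q * r) ?c = \<zero>\<^bsub>L\<^esub>"
    by (cases p; cases q; cases r) (simp_all add: signed_add signed_neg)
  then have "(?a \<ominus>\<^bsub>L\<^esub> signed L (q * r) ?c) \<ominus>\<^bsub>L\<^esub> ?b = \<zero>\<^bsub>L\<^esub>"
    by (simp add: M.minus_eq M.a_ac)
  then show ?case using M.minus_equality[of "?a \<ominus>\<^bsub>L\<^esub> signed L (q * r) ?c" "\<ominus>\<^bsub>L\<^esub> ?b"] by (simp add: M.minus_eq)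
next
  case (add u v)
  note c [simp] = homog_closed[OF assms(2)] homog_closed[OF assms(3)]
  from add show ?case
    by (simp add: bracket_add_left signed_add M.minus_eq M.minus_add M.a_ac)
qed

lemma leibniz_left:
  assumes "x \<in> carrier L" "y \<in> homog L q" "z \<in> homog L r"
  shows "bracket L (bracket L x y) z =
    bracket L x (bracket L y z) \<oplus>\<^bsub>L\<^esub> signed L (q * r) (bracket L (bracket L x z) y)"
  using leibniz_right[OF assms] assms(1) homog_closed[OF assms(2)] homog_closed[OF assms(3)]
  by (simp add: M.minus_eq M.a_assoc M.l_neg)

text \<open>
  An even element acts as a derivation without signs; torus elements are of this kind.
\<close>

lemma leibniz_even:
  assumes "h \<in> homog L 0" "x \<in> homog L p" "y \<in> homog L q"
  shows "bracket L h (bracket L x y) =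
    bracket L (bracket L h x) y \<oplus>\<^bsub>L\<^esub> bracket L x (bracket L h y)"
proof -
  note c [simp] = homog_closed[OF assms(1)] homog_closed[OF assms(2)] homog_closed[OF assms(3)]
  have "bracket L (bracket L h y) x = \<ominus>\<^bsub>L\<^esub> signed L (q * p) (bracket L x (bracket L h y))"
    by (rule bracket_antisym) (use assms bracket_homog[OF assms(1,3)] in auto)
  then show ?thesis using leibniz_right[OF _ assms(2,3), of h]
    by (simp add: signed_neg M.minus_eq mult.commute)
qed

text \<open>
  If $z = z_0 + z_1$ is central and $x$ is homogeneous, then $[z_0,x]$ and $[z_1,x]$ add up to zero and
  have different degrees, so both vanish.
\<close>

lemma lie_centre_homog_part:
  assumes "z \<in> lie_centre L" shows "homog_part L d z \<in> lie_centre L"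
proof -
  have z [simp]: "z \<in> carrier L" using assms by (simp add: lie_centre_def)
  have "bracket L (homog_part L d z) x = \<zero>\<^bsub>L\<^esub>" if "x \<in> carrier L" for x
    using that
  proof (induction rule: homog_induct)
    case (homog p x)
    note [simp] = homog_closed[OF homog]
    have *: "bracket L (homog_part L 0 z) x \<in> homog L p" "bracket L (homog_part L 1 z) x \<in> homog L (1 + p)"
      using bracket_homog[OF homog_part_in[OF z] homog, of 0] bracket_homog[OF homog_part_in[OF z] homog, of 1] by auto
    have 0: "bracket L (homog_part L 0 z) x \<oplus>\<^bsub>L\<^esub> bracket L (homog_part L 1 z) x = \<zero>\<^bsub>L\<^esub>"
      using assms homog_part_sum[OF z] bracket_add_left[of "homog_part L 0 z" "homog_part L 1 z" x]
      by (simp add: lie_centre_def)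
    have "bracket L (homog_part L 0 z) x = \<zero>\<^bsub>L\<^esub>"
      using homog_part_add_unique[OF *(1), of "bracket L (homog_part L 1 z) x"] *(2) 0
        homog_part_homog[OF homog_zero, of p]
      by (simp add: add.commute)
    moreover from this 0 have "bracket L (homog_part L 1 z) x = \<zero>\<^bsub>L\<^esub>" by simp
    ultimately show ?case by (cases d) simp_all
  qed (simp add: bracket_add_right)
  then show ?thesis by (simp add: lie_centre_def)
qed

text \<open>
  The centre is defined by left annihilation. Antisymmetry, which is available for homogeneous
  elements, transfers it to the right through the homogeneous components.
\<close>

lemma lie_centre_right:
  assumes "z \<in> lie_centre L" "x \<in> carrier L"
  shows "bracket L x z = \<zero>\<^bsub>L\<^esub>"
proof -
  have z [simp]: "z \<in> carrier L" using assms by (simp add: lie_centre_def)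
  have *: "bracket L x (homog_part L d z) = \<zero>\<^bsub>L\<^esub>" for d
    using assms(2)
  proof (induction rule: homog_induct)
    case (homog p x)
    have "bracket L (homog_part L d z) x = \<zero>\<^bsub>L\<^esub>"
      using lie_centre_homog_part[OF assms(1)] homog by (auto simp: lie_centre_def)
    then show ?case using bracket_antisym[OF homog homog_part_in[OF z]] by simp
  qed (simp add: bracket_add_left)
  have "bracket L x z = bracket L x (homog_part L 0 z \<oplus>\<^bsub>L\<^esub> homog_part L 1 z)"
    using homog_part_sum[OF z] by simp
  then show ?thesis using * assms by (simp add: bracket_add_right)
qed

end



section \<open>Graded subalgebras and the derived algebra\<close>

lemma graded_sub_simps [simp]:
  "carrier (graded_sub L H) = H" "zero (graded_sub L H) = zero L" "add (graded_sub L H) = add L"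
  "smult (graded_sub L H) = smult L" "homog (graded_sub L H) d = homog L d \<inter> H"
  "mult (graded_sub L H) = mult L"
  by (simp_all add: graded_sub_def)

text \<open>
  The grading does not occur in the axioms of a module.
\<close>

lemma module_graded_sub:
  assumes "module K L" "submodule H K L" shows "module K (graded_sub L H)"
  using submodule.submodule_is_module[OF assms(2,1)]
  by (simp add: module_def module_axioms_def abelian_group_def abelian_monoid_def abelian_group_axioms_def)

context graded_module
begin

lemma a_inv_graded_sub:
  assumes "submodule H K V" "x \<in> H"
  shows "a_inv (graded_sub V H) x = a_inv V x"
proof -
  interpret H: module K "graded_sub V H" by (rule module_graded_sub[OF module_axioms assms(1)])
  note E = submoduleE[OF assms(1)]
  show ?thesis
    using H.M.minus_equality[of "a_inv V x" x] E(1) E(3)[OF assms(2)] assms(2) M.l_neg[of x] by auto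
qed

lemma signed_graded_sub:
  assumes "submodule H K V" "x \<in> H"
  shows "signed (graded_sub V H) d x = signed V d x"
  using a_inv_graded_sub[OF assms] by (simp add: signed_def)

lemma signed_in_submodule:
  assumes "submodule H K V" "x \<in> H" shows "signed V d x \<in> H"
  using submoduleE(3)[OF assms(1)] assms(2) by (simp add: signed_def)

lemma graded_module_graded_sub:
  assumes H: "submodule H K V" and gr: "\<And>d x. x \<in> H \<Longrightarrow> homog_part V d x \<in> H"
  shows "graded_module K (graded_sub V H)"
proof -
  interpret H: module K "graded_sub V H" by (rule module_graded_sub[OF module_axioms H])
  note E = submoduleE[OF H] and D = submoduleE[OF homog_submodule]
  show ?thesis
  proof (intro graded_module.intro graded_module_axioms.intro)
    show "module K (graded_sub V H)" by (rule H.module_axioms)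
    fix d
    show "submodule (homog (graded_sub V H) d) K (graded_sub V H)"
      by (rule H.submoduleI) (use E D submoduleE(2)[OF H] in \<open>auto simp: a_inv_graded_sub[OF H]
          intro: H.M.zero_closed[simplified]\<close>)
    show "homog (graded_sub V H) 0 \<inter> homog (graded_sub V H) 1 = {\<zero>\<^bsub>graded_sub V H\<^esub>}"
      using homog_inter H.M.zero_closed by auto
  next
    fix x assume "x \<in> carrier (graded_sub V H)"
    then have x: "x \<in> H" by simp
    then show "\<exists>y\<in>homog (graded_sub V H) 0. \<exists>z\<in>homog (graded_sub V H) 1. x = y \<oplus>\<^bsub>graded_sub V H\<^esub> z"
      using homog_part_sum[of x] gr[OF x] E(1)
      by (intro bexI[of _ "homog_part V 0 x"] bexI[of _ "homog_part V 1 x"]) auto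
  qed
qed

end

context lie_superalgebra
begin

lemma lie_superalgebra_graded_sub:
  assumes H: "submodule H K L" and gr: "\<And>d x. x \<in> H \<Longrightarrow> homog_part L d x \<in> H"
    and br: "\<And>x y. x \<in> H \<Longrightarrow> y \<in> H \<Longrightarrow> bracket L x y \<in> H"
  shows "lie_superalgebra K (graded_sub L H)"
proof -
  interpret H: graded_module K "graded_sub L H" using graded_module_graded_sub[OF H gr] .
  have sub: "x \<in> carrier L" if "x \<in> H" for x using submoduleE(1)[OF H] that by blast
  note s = signed_graded_sub[OF H] a_inv_graded_sub[OF H] signed_in_submodule[OF H]
  show ?thesis
  proof (unfold_locales, goal_cases)
    case (7 x p y q) then show ?case using bracket_antisym[of x p y q] by (simp add: s br)
  next
    case (9 x p y q z r) then show ?case using bracket_jacobi[of x p y q z r] by (simp add: s br)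
  qed (auto simp: br sub bracket_add_left bracket_add_right bracket_smult_left bracket_smult_right
      bracket_homog bracket_even_self)
qed

lemma derived_submodule_submodule: "submodule (derived_submodule K L) K L"
proof (rule submoduleI)
  show "derived_submodule K L \<subseteq> carrier L"
    unfolding derived_submodule_def using carrier_is_submodule by auto
  show "\<zero>\<^bsub>L\<^esub> \<in> derived_submodule K L"
    unfolding derived_submodule_def using subgroup.one_closed submodule.axioms(1) by fastforce
qed (auto simp: derived_submodule_def dest: submoduleE)

lemma bracket_in_derived:
  "x \<in> carrier L \<Longrightarrow> y \<in> carrier L \<Longrightarrow> bracket L x y \<in> derived_submodule K L"
  by (auto simp: derived_submodule_def)

lemma derived_submodule_least:
  assumes "submodule H K L" "\<And>x y. x \<in> carrier L \<Longrightarrow> y \<in> carrier L \<Longrightarrow> bracket L x y \<in> H"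
  shows "derived_submodule K L \<subseteq> H"
  using assms by (auto simp: derived_submodule_def)

lemma homog_part_bracket_in_derived:
  assumes "x \<in> carrier L" "y \<in> carrier L"
  shows "homog_part L d (bracket L x y) \<in> derived_submodule K L"
  using assms(1)
proof (induction rule: homog_induct)
  case x: (homog p x)
  show ?case using assms(2)
  proof (induction rule: homog_induct)
    case (homog q y)
    then show ?case using x homog_part_homog[OF bracket_homog[OF x homog]] 
      subgroup.one_closed[OF submodule.axioms(1)[OF derived_submodule_submodule]]
      by (simp add: bracket_in_derived)
  next
    case (add u v)
    then show ?case using homog_closed[OF x] submoduleE(5)[OF derived_submodule_submodule]
      by (simp add: bracket_add_right homog_part_add)
  qed
next
  case (add u v)
  then show ?case using assms(2) submoduleE(5)[OF derived_submodule_submodule]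
    by (simp add: bracket_add_left homog_part_add)
qed

text \<open>
  The derived algebra is graded: its elements whose components belong to it form a submodule that
  contains all brackets.
\<close>

lemma homog_part_derived:
  assumes "x \<in> derived_submodule K L" shows "homog_part L d x \<in> derived_submodule K L"
proof -
  note E = submoduleE[OF derived_submodule_submodule]
  have z: "\<zero>\<^bsub>L\<^esub> \<in> derived_submodule K L"
    using subgroup.one_closed[OF submodule.axioms(1)[OF derived_submodule_submodule]] by simp
  have c: "x \<in> carrier L" if "x \<in> derived_submodule K L" for x using E(1) that by blast
  let ?T = "{x \<in> derived_submodule K L. homog_part L d x \<in> derived_submodule K L}"
  have "derived_submodule K L \<subseteq> ?T"
  proof (rule derived_submodule_least)
    show "submodule ?T K L"
    proof (rule submoduleI)
      fix a assume a: "a \<in> ?T"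
      have "homog_part L d (\<ominus>\<^bsub>L\<^esub> a) = \<ominus>\<^bsub>L\<^esub> homog_part L d a"
        using a c homog_part_smult[of "\<ominus>\<^bsub>K\<^esub> \<one>\<^bsub>K\<^esub>" a d] by (simp add: smult_l_minus)
      then show "\<ominus>\<^bsub>L\<^esub> a \<in> ?T" using a E(3) by auto
    qed (use c E z homog_part_homog[OF homog_zero, of d] in \<open>auto simp: homog_part_add homog_part_smult\<close>)
    show "bracket L x y \<in> ?T" if "x \<in> carrier L" "y \<in> carrier L" for x y
      using that by (simp add: bracket_in_derived homog_part_bracket_in_derived)
  qed
  then show ?thesis using assms by blast
qed

lemma lie_superalgebra_derived: "lie_superalgebra K (graded_sub L (derived_submodule K L))"
  by (rule lie_superalgebra_graded_sub)
    (use derived_submodule_submodule homog_part_derived bracket_in_derived submoduleE(1) in blast)+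

end

section \<open>The matrix superalgebra\<close>

lemma mat_simps [simp]:
  "x \<in> carrier (mat_superalgebra A) \<longleftrightarrow> (\<forall>i j. x i j \<in> carrier A)"
  "mult (mat_superalgebra A) = (\<lambda>x y i j. x i I1 \<otimes>\<^bsub>A\<^esub> y I1 j \<oplus>\<^bsub>A\<^esub> x i I2 \<otimes>\<^bsub>A\<^esub> y I2 j \<oplus>\<^bsub>A\<^esub> x i I3 \<otimes>\<^bsub>A\<^esub> y I3 j)"
  "one (mat_superalgebra A) = (\<lambda>i j. if i = j then \<one>\<^bsub>A\<^esub> else \<zero>\<^bsub>A\<^esub>)"
  "zero (mat_superalgebra A) = (\<lambda>i j. \<zero>\<^bsub>A\<^esub>)"
  "add (mat_superalgebra A) = (\<lambda>x y i j. x i j \<oplus>\<^bsub>A\<^esub> y i j)"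
  "smult (mat_superalgebra A) = (\<lambda>k x i j. k \<odot>\<^bsub>A\<^esub> x i j)"
  "x \<in> homog (mat_superalgebra A) d \<longleftrightarrow> (\<forall>i j. x i j \<in> homog A (d + idx_parity i + idx_parity j))"
  by (simp_all add: mat_superalgebra_def)

context assoc_superalgebra
begin

lemma module_mat: "module K (mat_superalgebra A)"
proof (rule moduleI)
  show "abelian_group (mat_superalgebra A)"
  proof (rule abelian_groupI)
    fix x assume "x \<in> carrier (mat_superalgebra A)"
    then show "\<exists>y\<in>carrier (mat_superalgebra A). y \<oplus>\<^bsub>mat_superalgebra A\<^esub> x = \<zero>\<^bsub>mat_superalgebra A\<^esub>"
      by (intro bexI[of _ "\<lambda>i j. \<ominus>\<^bsub>A\<^esub> x i j"]) (simp_all add: M.l_neg)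
  qed (auto simp: fun_eq_iff M.a_ac)
qed (simp_all add: R.is_cring fun_eq_iff smult_l_distr smult_r_distr smult_assoc1)

lemma a_inv_mat [simp]:
  assumes "x \<in> carrier (mat_superalgebra A)"
  shows "a_inv (mat_superalgebra A) x = (\<lambda>i j. \<ominus>\<^bsub>A\<^esub> x i j)"
proof -
  interpret V: module K "mat_superalgebra A" by (rule module_mat)
  show ?thesis by (rule V.M.minus_equality) (use assms in \<open>simp_all add: M.l_neg\<close>)
qed

lemma signed_mat:
  assumes "x \<in> carrier (mat_superalgebra A)"
  shows "signed (mat_superalgebra A) d x = (\<lambda>i j. signed A d (x i j))"
  using assms by (simp add: signed_def fun_eq_iff)

lemma ring_mat: "ring (mat_superalgebra A)"
proof -
  interpret V: module K "mat_superalgebra A" by (rule module_mat)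
  show ?thesis
  proof (rule ringI)
    show "abelian_group (mat_superalgebra A)" by unfold_locales
    show "monoid (mat_superalgebra A)"
    proof (rule monoidI, goal_cases)
      case (3 x y z)
      then show ?case by (simp add: fun_eq_iff A.l_distr A.r_distr A.m_assoc M.a_ac)
    next
      case (4 x)
      then show ?case by (intro ext, rename_tac i j, case_tac i) simp_all
    next
      case (5 x)
      then show ?case by (intro ext, rename_tac i j, case_tac j) simp_all
    qed simp_all
  qed (simp_all add: fun_eq_iff A.l_distr A.r_distr M.a_ac)
qed

lemma mat_homog_closed: "x \<in> homog (mat_superalgebra A) d \<Longrightarrow> x \<in> carrier (mat_superalgebra A)"
  by (metis homog_closed mat_simps(1,7))

text \<open>
  A matrix of degree $d$ has its entry $(i,j)$ in degree $d + |i| + |j|$, so matrices are split into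
  homogeneous components entry by entry.
\<close>

lemma graded_module_mat: "graded_module K (mat_superalgebra A)"
proof -
  interpret V: module K "mat_superalgebra A" by (rule module_mat)
  show ?thesis
  proof (intro graded_module.intro graded_module_axioms.intro)
    show "module K (mat_superalgebra A)" by (rule module_mat)
    fix d
    show "submodule (homog (mat_superalgebra A) d) K (mat_superalgebra A)"
    proof (rule V.submoduleI)
      fix a assume a: "a \<in> homog (mat_superalgebra A) d"
      then have "a \<in> carrier (mat_superalgebra A)" by (rule mat_homog_closed)
      then show "\<ominus>\<^bsub>mat_superalgebra A\<^esub> a \<in> homog (mat_superalgebra A) d" using a
        by (auto simp del: mat_simps(1) simp add: homog_neg)
    qed (use mat_homog_closed in \<open>auto simp: homog_add homog_smult simp del: mat_simps(1)\<close>)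
    have "x = (\<lambda>i j. \<zero>\<^bsub>A\<^esub>)" if "x \<in> homog (mat_superalgebra A) 0" "x \<in> homog (mat_superalgebra A) 1" for x
    proof (intro ext)
      fix i j
      have "x i j \<in> homog A (idx_parity i + idx_parity j)" "x i j \<in> homog A (1 + idx_parity i + idx_parity j)"
        using that(1,2) by simp_all
      then show "x i j = \<zero>\<^bsub>A\<^esub>" by (rule homog_disjoint) (cases i; cases j; simp)
    qed
    then show "homog (mat_superalgebra A) 0 \<inter> homog (mat_superalgebra A) 1 = {\<zero>\<^bsub>mat_superalgebra A\<^esub>}"
      by auto
  next
    fix x assume x: "x \<in> carrier (mat_superalgebra A)"
    let ?p = "\<lambda>d i j. homog_part A (d + idx_parity i + idx_parity j) (x i j)"
    have "x = ?p 0 \<oplus>\<^bsub>mat_superalgebra A\<^esub> ?p 1"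
    proof (simp, intro ext)
      fix i j
      have "x i j \<in> carrier A" using x by simp
      note homog_part_sum[OF this]
      moreover have "homog_part A 0 (x i j) \<oplus>\<^bsub>A\<^esub> homog_part A 1 (x i j) = homog_part A 1 (x i j) \<oplus>\<^bsub>A\<^esub> homog_part A 0 (x i j)"
        using x by (simp add: M.a_comm)
      ultimately show "x i j = homog_part A (idx_parity i + idx_parity j) (x i j) \<oplus>\<^bsub>A\<^esub>
        homog_part A (1 + idx_parity i + idx_parity j) (x i j)"
        by (cases i; cases j) simp_all
    qed
    moreover have "?p d \<in> homog (mat_superalgebra A) d" for d using x by simp
    ultimately show "\<exists>y\<in>homog (mat_superalgebra A) 0. \<exists>z\<in>homog (mat_superalgebra A) 1. x = y \<oplus>\<^bsub>mat_superalgebra A\<^esub> z"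
      by blast
  qed
qed

lemma assoc_superalgebra_mat: "assoc_superalgebra K (mat_superalgebra A)"
proof -
  interpret V: graded_module K "mat_superalgebra A" by (rule graded_module_mat)
  interpret V: ring "mat_superalgebra A" by (rule ring_mat)
  show ?thesis
  proof (unfold_locales, goal_cases)
    case (4 x p y q)
    have deg: "p + idx_parity i + idx_parity k + (q + idx_parity k + idx_parity j)
        = p + q + idx_parity i + idx_parity j" for i j k
      by (cases "idx_parity k"; cases p; cases q; cases "idx_parity i"; cases "idx_parity j") simp_all
    have "x i k \<otimes>\<^bsub>A\<^esub> y k j \<in> homog A (p + q + idx_parity i + idx_parity j)" for i j k
    proof -
      have "x i k \<in> homog A (p + idx_parity i + idx_parity k)" "y k j \<in> homog A (q + idx_parity k + idx_parity j)"
        using 4 by simp_all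
      from homog_mult[OF this] show ?thesis by (simp only: deg)
    qed
    then show ?case by (simp add: homog_add)
  qed (simp_all add: fun_eq_iff smult_mult_left smult_mult_right smult_r_distr homog_one)
qed

lemma lie_superalgebra_gl21: "lie_superalgebra K (gl21 A)"
  unfolding gl21_def
  by (rule assoc_superalgebra.lie_superalgebra_lie_of[OF assoc_superalgebra_mat])

lemma lie_superalgebra_sl21: "lie_superalgebra K (sl21 K A)"
  unfolding sl21_def
  by (rule lie_superalgebra.lie_superalgebra_derived[OF lie_superalgebra_gl21])

end



section \<open>Lie superalgebras given by generators and relations\<close>

lemma term_degree_lie_terms: "term_degree K G deg t p \<Longrightarrow> t \<in> lie_terms K G"
  by (induction rule: term_degree.induct) (auto intro: lie_terms.intros)

lemma signed_term_lie_terms: "t \<in> lie_terms K G \<Longrightarrow> signed_term d t \<in> lie_terms K G"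
  by (auto simp: signed_term_def intro: lie_terms.intros)

lemma signed_term_degree: "term_degree K G deg t p \<Longrightarrow> term_degree K G deg (signed_term d t) p"
  by (auto simp: signed_term_def intro: term_degree.intros)

text \<open>
  The homogeneous components of a formal expression. This is the tool for showing that a presented
  algebra is graded: congruent expressions have congruent components, so that an element which is both
  even and odd must vanish. All degrees are returned at once since the components of a bracket
  involve both components of its arguments.
\<close>

context
  fixes deg :: "'g \<Rightarrow> bit"
begin

primrec term_part :: "('k, 'g) lie_term \<Rightarrow> bit \<Rightarrow> ('k, 'g) lie_term" where
  "term_part Zero = (\<lambda>d. Zero)"
| "term_part (Gen g) = (\<lambda>d. if deg g = d then Gen g else Zero)"
| "term_part (Add t u) = (\<lambda>d. Add (term_part t d) (term_part u d))"
| "term_part (Neg t) = (\<lambda>d. Neg (term_part t d))"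
| "term_part (Smult k t) = (\<lambda>d. Smult k (term_part t d))"
| "term_part (Br t u) = (\<lambda>d. Add (Br (term_part t 0) (term_part u d)) (Br (term_part t 1) (term_part u (d + 1))))"

end

locale lie_presentation = cring K
  for K :: "'k ring" +
  fixes G :: "'g set" and deg :: "'g \<Rightarrow> bit" and R :: "(('k, 'g) lie_term \<times> ('k, 'g) lie_term) set"
  assumes homogeneous_relations: "(t, u) \<in> R \<Longrightarrow> t \<in> lie_terms K G \<Longrightarrow> u \<in> lie_terms K G \<Longrightarrow>
    \<exists>p. term_degree K G deg t p \<and> term_degree K G deg u p"
begin

abbreviation "terms \<equiv> lie_terms K G"
abbreviation "degree \<equiv> term_degree K G deg"
abbreviation "eqv \<equiv> lie_eq K G deg R"
abbreviation "cls \<equiv> lie_class K G deg R"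
abbreviation "P \<equiv> presented_lie K G deg R"

lemmas terms_intros [simp, intro] = lie_terms.intros

lemma eqv_terms: "eqv t u \<Longrightarrow> t \<in> terms \<and> u \<in> terms"
  by (induction rule: lie_eq.induct)
    (auto dest!: term_degree_lie_terms intro!: signed_term_lie_terms)

lemma cls_eqI: "eqv t u \<Longrightarrow> cls t = cls u"
  unfolding lie_class_def using eq_sym[of K G deg R] eq_trans[of K G deg R] by (intro Collect_cong) metis

lemma mem_cls: "u \<in> cls t \<longleftrightarrow> eqv t u"
  by (simp add: lie_class_def)

lemma cls_eq_iff: "t \<in> terms \<Longrightarrow> cls t = cls u \<longleftrightarrow> eqv t u"
  using cls_eqI mem_cls eq_refl by (metis eq_sym)

lemma cls_carrier [simp, intro]: "t \<in> terms \<Longrightarrow> cls t \<in> carrier P"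
  by (simp add: presented_lie_def)

lemma carrierE:
  assumes "x \<in> carrier P" obtains t where "t \<in> terms" "x = cls t"
  using assms by (auto simp: presented_lie_def)

text \<open>
  The unions over representatives collapse because the congruence respects the operations.
\<close>

lemma cls_ops:
  assumes "t \<in> terms"
  shows "u \<in> terms \<Longrightarrow> cls t \<oplus>\<^bsub>P\<^esub> cls u = cls (Add t u)"
    and "u \<in> terms \<Longrightarrow> bracket P (cls t) (cls u) = cls (Br t u)"
    and "k \<in> carrier K \<Longrightarrow> k \<odot>\<^bsub>P\<^esub> cls t = cls (Smult k t)"
proof -
  have refl: "t \<in> cls t" if "t \<in> terms" for t
    using that by (simp add: mem_cls eq_refl)
  have A: "cls (Add t' u') = cls (Add t u)" if "t' \<in> cls t" "u' \<in> cls u" for t' u'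
    using that by (intro cls_eqI eq_sym[OF cong_Add]) (simp_all add: mem_cls)
  have B: "cls (Br t' u') = cls (Br t u)" if "t' \<in> cls t" "u' \<in> cls u" for t' u'
    using that by (intro cls_eqI eq_sym[OF cong_Br]) (simp_all add: mem_cls)
  have C: "cls (Smult k t') = cls (Smult k t)" if "t' \<in> cls t" "k \<in> carrier K" for t' k
    using that by (intro cls_eqI eq_sym[OF cong_Smult]) (simp_all add: mem_cls)
  have t: "cls t \<noteq> {}" and u: "u \<in> terms \<Longrightarrow> cls u \<noteq> {}"
    using refl[OF assms] refl[of u] by blast+
  show "u \<in> terms \<Longrightarrow> cls t \<oplus>\<^bsub>P\<^esub> cls u = cls (Add t u)"
    using t u by (simp add: presented_lie_def A cong: SUP_cong)
  show "u \<in> terms \<Longrightarrow> bracket P (cls t) (cls u) = cls (Br t u)"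
    using t u by (simp add: presented_lie_def B cong: SUP_cong)
  show "k \<in> carrier K \<Longrightarrow> k \<odot>\<^bsub>P\<^esub> cls t = cls (Smult k t)"
    using t by (simp add: presented_lie_def C cong: SUP_cong)
qed

lemma cls_zero: "\<zero>\<^bsub>P\<^esub> = cls Zero"
  by (simp add: presented_lie_def)

lemma homog_P: "homog P d = cls ` {t. degree t d}"
  by (simp add: presented_lie_def)

lemma module_P: "module K P"
proof (rule moduleI)
  show "abelian_group P"
  proof (rule abelian_groupI)
    fix x assume "x \<in> carrier P"
    then obtain t where t: "t \<in> terms" "x = cls t" by (rule carrierE)
    then have "cls (Neg t) \<oplus>\<^bsub>P\<^esub> x = \<zero>\<^bsub>P\<^esub>"
      by (simp add: cls_ops cls_zero cls_eqI add_neg)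
    then show "\<exists>y\<in>carrier P. y \<oplus>\<^bsub>P\<^esub> x = \<zero>\<^bsub>P\<^esub>" using t by blast
  qed (auto elim!: carrierE simp: cls_ops cls_zero
      del: equalityI subsetI intro!: cls_eqI add_assoc add_comm add_zero)
qed (auto elim!: carrierE simp: cls_ops cls_zero is_cring del: equalityI subsetI intro!: cls_eqI smult_left smult_right smult_mult smult_unit)

sublocale P: module K P
  by (rule module_P)

lemma cls_neg:
  assumes "t \<in> terms" shows "\<ominus>\<^bsub>P\<^esub> cls t = cls (Neg t)"
  by (rule P.M.minus_equality) (use assms in \<open>auto simp: cls_ops cls_zero del: equalityI subsetI intro!: cls_eqI add_neg\<close>)

lemma cls_signed: "t \<in> terms \<Longrightarrow> signed P d (cls t) = cls (signed_term d t)"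
  by (simp add: signed_def signed_term_def cls_neg)

lemma P_bracket_closed [simp]: "x \<in> carrier P \<Longrightarrow> y \<in> carrier P \<Longrightarrow> bracket P x y \<in> carrier P"
  by (auto elim!: carrierE simp: cls_ops)

lemma P_bracket_add:
  assumes "x \<in> carrier P" "y \<in> carrier P" "z \<in> carrier P"
  shows "bracket P (x \<oplus>\<^bsub>P\<^esub> y) z = bracket P x z \<oplus>\<^bsub>P\<^esub> bracket P y z"
    and "bracket P x (y \<oplus>\<^bsub>P\<^esub> z) = bracket P x y \<oplus>\<^bsub>P\<^esub> bracket P x z"
  using assms by (auto elim!: carrierE simp: cls_ops del: equalityI subsetI intro!: cls_eqI br_add_left br_add_right)

lemma P_bracket_smult:
  assumes "k \<in> carrier K" "x \<in> carrier P" "y \<in> carrier P"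
  shows "bracket P (k \<odot>\<^bsub>P\<^esub> x) y = k \<odot>\<^bsub>P\<^esub> bracket P x y"
    and "bracket P x (k \<odot>\<^bsub>P\<^esub> y) = k \<odot>\<^bsub>P\<^esub> bracket P x y"
  using assms by (auto elim!: carrierE simp: cls_ops del: equalityI subsetI intro!: cls_eqI br_smult_left br_smult_right)

lemma P_bracket_zero:
  assumes "x \<in> carrier P"
  shows "bracket P x \<zero>\<^bsub>P\<^esub> = \<zero>\<^bsub>P\<^esub>" "bracket P \<zero>\<^bsub>P\<^esub> x = \<zero>\<^bsub>P\<^esub>"
  using P_bracket_smult[of "\<zero>\<^bsub>K\<^esub>" "\<zero>\<^bsub>P\<^esub>" x] P_bracket_smult[of "\<zero>\<^bsub>K\<^esub>" x "\<zero>\<^bsub>P\<^esub>"] assms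
  by simp_all

abbreviation "part \<equiv> term_part deg"

lemma part_terms [simp, intro]: "t \<in> terms \<Longrightarrow> part t d \<in> terms"
  by (induction arbitrary: d rule: lie_terms.induct) auto

lemma part_degree: "t \<in> terms \<Longrightarrow> degree (part t d) d"
proof (induction arbitrary: d rule: lie_terms.induct)
  case (6 t u)
  have "degree (Br (part t 0) (part u d)) (0 + d)" "degree (Br (part t 1) (part u (d + 1))) (1 + (d + 1))"
    by (rule term_degree.intros 6)+
  then show ?case by (auto intro: term_degree.intros simp: add.commute add.left_commute)
qed (auto intro: term_degree.intros)

lemma part_sum: "t \<in> terms \<Longrightarrow> cls t = cls (part t 0) \<oplus>\<^bsub>P\<^esub> cls (part t 1)"
proof (induction rule: lie_terms.induct)
  case 1
  then show ?case using P.M.l_zero[of "\<zero>\<^bsub>P\<^esub>"] by (simp add: cls_zero)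
next
  case (2 g)
  have "cls (Gen g) \<oplus>\<^bsub>P\<^esub> \<zero>\<^bsub>P\<^esub> = cls (Gen g)" "\<zero>\<^bsub>P\<^esub> \<oplus>\<^bsub>P\<^esub> cls (Gen g) = cls (Gen g)"
    using 2 by simp_all
  then show ?case by (simp add: cls_zero)
next
  case (3 t u)
  then have "cls (Add t u) = (cls (part t 0) \<oplus>\<^bsub>P\<^esub> cls (part t 1)) \<oplus>\<^bsub>P\<^esub> (cls (part u 0) \<oplus>\<^bsub>P\<^esub> cls (part u 1))"
    by (metis cls_ops(1))
  also have "\<dots> = cls (part (Add t u) 0) \<oplus>\<^bsub>P\<^esub> cls (part (Add t u) 1)"
    using 3 by (simp add: P.M.a_ac flip: cls_ops)
  finally show ?case .
next
  case (4 t)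
  then show ?case by (simp add: P.M.minus_add flip: cls_neg)
next
  case (5 k t)
  then show ?case by (simp add: P.smult_r_distr flip: cls_ops)
next
  case (6 t u)
  then have "cls (Br t u) = bracket P (cls (part t 0) \<oplus>\<^bsub>P\<^esub> cls (part t 1)) (cls (part u 0) \<oplus>\<^bsub>P\<^esub> cls (part u 1))"
    by (metis cls_ops(2))
  also have "\<dots> = cls (part (Br t u) 0) \<oplus>\<^bsub>P\<^esub> cls (part (Br t u) 1)"
    using 6 by (simp add: P_bracket_add P.M.a_ac flip: cls_ops)
  finally show ?case .
qed

lemma part_homogeneous:
  "degree t p \<Longrightarrow> cls (part t d) = (if d = p then cls t else \<zero>\<^bsub>P\<^esub>)"
proof (induction arbitrary: d rule: term_degree.induct)
  case (6 t p u q)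
  then have [simp]: "t \<in> terms" "u \<in> terms" by (auto dest: term_degree_lie_terms)
  have "cls (part (Br t u) d) = bracket P (cls (part t 0)) (cls (part u d)) \<oplus>\<^bsub>P\<^esub>
     bracket P (cls (part t 1)) (cls (part u (d + 1)))" by (simp add: cls_ops)
  also have "\<dots> = (if d = p + q then cls (Br t u) else \<zero>\<^bsub>P\<^esub>)"
    unfolding 6 by (cases p; cases q; cases d; simp add: P_bracket_zero cls_ops)
  finally show ?case .
qed (auto simp: cls_zero[symmetric] cls_ops[symmetric] cls_neg[symmetric] term_degree_lie_terms)

text \<open>
  The axioms that mention degrees, and the relations, have two homogeneous sides of equal degree, and
  then the components are the two sides themselves or zero. The other rules are respected because
  taking components is linear and expands brackets bilinearly.
\<close>

lemma part_cong:
  assumes "eqv t u" shows "cls (part t d) = cls (part u d)"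
proof -
  have homog: "cls (part t d) = cls (part u d)" if "degree t p" "degree u p" "eqv t u" for t u p d
    using that part_homogeneous cls_eqI by simp
  show ?thesis using assms
  proof (induction arbitrary: d rule: lie_eq.induct)
    case (eq_rel t u)
    then show ?case using homogeneous_relations homog lie_eq.eq_rel by metis
  next
    case (eq_trans t u v)
    then show ?case by simp
  next
    case (cong_Add t t' u u')
    then show ?case by (auto dest!: eqv_terms simp flip: cls_ops)
  next
    case (cong_Neg t t')
    then show ?case by (auto dest!: eqv_terms simp flip: cls_neg)
  next
    case (cong_Smult k t t')
    then show ?case by (auto dest!: eqv_terms simp flip: cls_ops)
  next
    case (cong_Br t t' u u')
    then show ?case by (auto dest!: eqv_terms simp flip: cls_ops)
  next
    case (br_antisym t p u q)
    show ?case by (rule homog[of _ "p + q"])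
      (use br_antisym term_degree.intros(6)[OF br_antisym(2,1)] in \<open>auto intro!: term_degree.intros(4,6) signed_term_degree lie_eq.br_antisym simp: add.commute\<close>)
  next
    case (br_even_self t)
    have "degree (Br t t) (0 + 0)" by (rule term_degree.intros(6)) (rule br_even_self)+
    then show ?case
      by (intro homog[of _ 0]) (use br_even_self in \<open>auto intro: term_degree.intros(1) lie_eq.br_even_self\<close>)
  next
    case (br_jacobi t p u q v r)
    have "degree (Br (Br t u) v) (p + q + r)" "degree (Br (Br u v) t) (q + r + p)" "degree (Br (Br v t) u) (r + p + q)"
      using br_jacobi by (auto intro!: term_degree.intros(6))
    then show ?case 
      by (intro homog[of _ "p + q + r"])
        (use br_jacobi in \<open>auto intro!: term_degree.intros(1,3) signed_term_degree lie_eq.br_jacobi simp: add_ac\<close>)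
  qed (auto simp: P_bracket_add P_bracket_smult P.M.a_ac P.M.l_neg P.M.r_neg P.smult_r_distr P.smult_l_distr P.smult_assoc1
      simp flip: cls_ops cls_neg cls_zero)
qed

lemma graded_module_P: "graded_module K P"
proof (intro graded_module.intro graded_module_axioms.intro)
  show "module K P" by (rule module_P)
  have deg0: "cls t \<in> homog P d" if "degree t d" for t d using that by (auto simp: homog_P)
  fix d
  show "submodule (homog P d) K P"
  proof (rule P.submoduleI)
    show "homog P d \<subseteq> carrier P" by (auto simp: homog_P dest: term_degree_lie_terms)
  qed (auto simp: homog_P cls_zero cls_neg cls_ops term_degree_lie_terms intro!: imageI term_degree.intros)
  have "x = \<zero>\<^bsub>P\<^esub>" if x: "x \<in> homog P 0" "x \<in> homog P 1" for x
  proof -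
    \<comment> \<open>The even component of an odd expression is zero, and that of an even one is the expression itself.\<close>
    obtain t u where t: "degree t 0" "x = cls t" and u: "degree u 1" "x = cls u"
      using x unfolding homog_P by blast
    then have "eqv t u" using cls_eq_iff term_degree_lie_terms by metis
    then have "cls (part t 0) = cls (part u 0)" by (rule part_cong)
    then show ?thesis using t u by (simp add: part_homogeneous)
  qed
  moreover have "\<zero>\<^bsub>P\<^esub> \<in> homog P d" for d using deg0 by (auto simp: cls_zero intro: term_degree.intros)
  ultimately show "homog P 0 \<inter> homog P 1 = {\<zero>\<^bsub>P\<^esub>}" by auto
next
  fix x assume "x \<in> carrier P"
  then obtain t where "t \<in> terms" "x = cls t" by (rule carrierE)
  then show "\<exists>y\<in>homog P 0. \<exists>z\<in>homog P 1. x = y \<oplus>\<^bsub>P\<^esub> z"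
    using part_sum part_degree unfolding homog_P by blast
qed

theorem lie_superalgebra_P: "lie_superalgebra K P"
proof -
  interpret graded_module K P by (rule graded_module_P)
  show ?thesis
  proof (unfold_locales, goal_cases)
    case (6 x p y q)
    then show ?case by (auto simp: homog_P cls_ops term_degree_lie_terms intro!: imageI term_degree.intros)
  next
    case (7 x p y q)
    then show ?case 
      by (auto simp: homog_P cls_ops cls_signed cls_neg term_degree_lie_terms signed_term_lie_terms
        del: equalityI subsetI intro!: cls_eqI lie_eq.br_antisym)
  next
    case (8 x)
    then show ?case 
      by (auto simp: homog_P cls_ops cls_zero term_degree_lie_terms del: equalityI subsetI intro!: cls_eqI lie_eq.br_even_self)
  next
    case (9 x p y q z r)
    then show ?case 
      by (auto simp: homog_P cls_ops cls_zero cls_signed term_degree_lie_terms signed_term_lie_terms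
        del: equalityI subsetI intro!: cls_eqI lie_eq.br_jacobi)
  qed (simp_all add: P_bracket_add P_bracket_smult)
qed

sublocale P: lie_superalgebra K P
  by (rule lie_superalgebra_P)

lemma homog_P_E:
  assumes "x \<in> homog P d" obtains t where "degree t d" "x = cls t"
  using assms by (auto simp: homog_P)

end

primrec lie_eval :: "('k, 'v) superalgebra \<Rightarrow> ('g \<Rightarrow> 'v) \<Rightarrow> ('k, 'g) lie_term \<Rightarrow> 'v" where
  "lie_eval M f Zero = \<zero>\<^bsub>M\<^esub>"
| "lie_eval M f (Gen g) = f g"
| "lie_eval M f (Add t u) = lie_eval M f t \<oplus>\<^bsub>M\<^esub> lie_eval M f u"
| "lie_eval M f (Neg t) = \<ominus>\<^bsub>M\<^esub> lie_eval M f t"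
| "lie_eval M f (Smult k t) = k \<odot>\<^bsub>M\<^esub> lie_eval M f t"
| "lie_eval M f (Br t u) = bracket M (lie_eval M f t) (lie_eval M f u)"

context lie_presentation
begin

text \<open>
  Every rule that generates the congruence is one of the relations, an axiom of the target or a
  compatibility with the operations, so evaluation is constant on classes.
\<close>

theorem presented_lie_universal:
  assumes M: "lie_superalgebra K M"
    and deg: "\<And>g. g \<in> G \<Longrightarrow> f g \<in> homog M (deg g)"
    and rel: "\<And>t u. (t, u) \<in> R \<Longrightarrow> t \<in> terms \<Longrightarrow> u \<in> terms \<Longrightarrow> lie_eval M f t = lie_eval M f u"
  obtains \<rho> where "\<rho> \<in> lie_hom K P M" "\<And>g. g \<in> G \<Longrightarrow> \<rho> (cls (Gen g)) = f g"
proof -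
  interpret M: lie_superalgebra K M by (rule M)
  let ?e = "lie_eval M f"
  have e_degree: "?e t \<in> homog M p" if "degree t p" for t p
    using that by induction (auto intro: deg M.bracket_homog)
  have e_closed [simp]: "?e t \<in> carrier M" if "t \<in> terms" for t
    using that by induction (auto intro: deg M.homog_closed)
  have e_signed: "?e (signed_term d t) = signed M d (?e t)" for d t
    by (simp add: signed_term_def signed_def)
  have e_eqv: "?e t = ?e u" if "eqv t u" for t u
    using that
  proof (induction rule: lie_eq.induct)
    case (br_antisym t p u q)
    then show ?case using M.bracket_antisym[of "?e t" p "?e u" q] by (simp add: e_degree e_signed)
  next
    case (br_even_self t)
    then show ?case using M.bracket_even_self[of "?e t"] by (simp add: e_degree)
  next
    case (br_jacobi t p u q v r)
    then show ?case using M.bracket_jacobi[of "?e t" p "?e u" q "?e v" r] by (simp add: e_degree e_signed)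
  qed (simp_all add: rel M.M.a_ac M.M.l_neg M.M.r_neg M.smult_r_distr M.smult_l_distr M.smult_assoc1
      M.bracket_add_left M.bracket_add_right M.bracket_smult_left M.bracket_smult_right)
  define \<rho> where "\<rho> X = ?e (SOME t. t \<in> X)" for X
  have \<rho>: "\<rho> (cls t) = ?e t" if "t \<in> terms" for t
  proof -
    have "t \<in> cls t" using that by (simp add: mem_cls eq_refl)
    then have "(SOME u. u \<in> cls t) \<in> cls t" by (rule someI)
    then show ?thesis using e_eqv by (simp add: \<rho>_def mem_cls)
  qed
  have "\<rho> \<in> lie_hom K P M"
    unfolding lie_hom_def
    by (auto elim!: carrierE homog_P_E simp: \<rho> cls_ops term_degree_lie_terms e_degree)
  moreover have "\<rho> (cls (Gen g)) = f g" if "g \<in> G" for g using that by (simp add: \<rho>)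
  ultimately show ?thesis by (rule that)
qed

end



section \<open>Steinberg systems\<close>

text \<open>
  The relations of the Steinberg Lie superalgebra for elements of an arbitrary Lie superalgebra. The
  same family is considered in the Steinberg algebra, among matrices and in central extensions.
\<close>

locale steinberg_system = A: assoc_superalgebra K A + L: lie_superalgebra K L
  for K :: "'k ring" and A :: "('k, 'a) superalgebra" and L :: "('k, 'v) superalgebra" +
  fixes e :: "idx \<Rightarrow> idx \<Rightarrow> bit \<Rightarrow> 'a \<Rightarrow> 'v"
  assumes e_homog: "\<lbrakk>i \<noteq> j; a \<in> homog A p\<rbrakk> \<Longrightarrow> e i j p a \<in> homog L (idx_parity i + idx_parity j + p)"
    and e_add: "\<lbrakk>i \<noteq> j; a \<in> homog A p; b \<in> homog A p\<rbrakk> \<Longrightarrow>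
      e i j p (a \<oplus>\<^bsub>A\<^esub> b) = e i j p a \<oplus>\<^bsub>L\<^esub> e i j p b"
    and e_smult: "\<lbrakk>i \<noteq> j; c \<in> carrier K; a \<in> homog A p\<rbrakk> \<Longrightarrow>
      e i j p (c \<odot>\<^bsub>A\<^esub> a) = c \<odot>\<^bsub>L\<^esub> e i j p a"
    and e_bracket: "\<lbrakk>i \<noteq> j; j \<noteq> k; i \<noteq> k; a \<in> homog A p; b \<in> homog A q\<rbrakk> \<Longrightarrow>
      bracket L (e i j p a) (e j k q b) = e i k (p + q) (a \<otimes>\<^bsub>A\<^esub> b)"
    and e_bracket_zero: "\<lbrakk>i \<noteq> j; k \<noteq> l; j \<noteq> k; i \<noteq> l; a \<in> homog A p; b \<in> homog A q\<rbrakk> \<Longrightarrow>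
      bracket L (e i j p a) (e k l q b) = \<zero>\<^bsub>L\<^esub>"
begin

lemma e_closed [simp]: "i \<noteq> j \<Longrightarrow> a \<in> homog A p \<Longrightarrow> e i j p a \<in> carrier L"
  using e_homog L.homog_closed by blast

lemma e_zero: "i \<noteq> j \<Longrightarrow> e i j p \<zero>\<^bsub>A\<^esub> = \<zero>\<^bsub>L\<^esub>"
  using e_smult[of i j "\<zero>\<^bsub>K\<^esub>" "\<zero>\<^bsub>A\<^esub>" p] by simp

lemma e_bracket_swap:
  assumes "i \<noteq> j" "j \<noteq> k" "i \<noteq> k" "a \<in> homog A p" "b \<in> homog A q"
  shows "bracket L (e j k q b) (e i j p a) = \<ominus>\<^bsub>L\<^esub> signed L
    ((idx_parity j + idx_parity k + q) * (idx_parity i + idx_parity j + p)) (e i k (p + q) (a \<otimes>\<^bsub>A\<^esub> b))"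
  using L.bracket_antisym[OF e_homog e_homog, of j k b q i j a p] assms by (simp add: e_bracket)

text \<open>
  For matrices this is the diagonal matrix with entries $1$ at $i$ and $-(-1)^{|i|+|j|}$ at $j$.
\<close>

definition torus :: "idx \<Rightarrow> idx \<Rightarrow> 'v" where
  "torus i j = bracket L (e i j 0 \<one>\<^bsub>A\<^esub>) (e j i 0 \<one>\<^bsub>A\<^esub>)"

lemma torus_homog: assumes "i \<noteq> j" shows "torus i j \<in> homog L 0"
  using L.bracket_homog[OF e_homog e_homog, OF assms A.homog_one assms[symmetric] A.homog_one]
  by (simp add: torus_def add_ac)

lemmas [simp] = A.homog_one

lemma torus_leibniz:
  assumes "i \<noteq> j" "z \<in> homog L r"
  shows "bracket L (torus i j) z = bracket L (e i j 0 \<one>\<^bsub>A\<^esub>) (bracket L (e j i 0 \<one>\<^bsub>A\<^esub>) z)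
    \<oplus>\<^bsub>L\<^esub> signed L ((idx_parity i + idx_parity j) * r) (bracket L (bracket L (e i j 0 \<one>\<^bsub>A\<^esub>) z) (e j i 0 \<one>\<^bsub>A\<^esub>))"
  unfolding torus_def using L.leibniz_left[OF e_closed e_homog assms(2), of i j "\<one>\<^bsub>A\<^esub>" 0 j i "\<one>\<^bsub>A\<^esub>" 0] assms(1)
  by (simp add: add.commute)

text \<open>
  The integer by which $h_{ij}$ acts is the difference of the diagonal entries in the row and the column
  concerned. For the roots that involve the third index it is read off from the defining relations.
\<close>

lemma weights:
  assumes "i \<noteq> j" "j \<noteq> m" "i \<noteq> m" and c: "c \<in> homog A p"
  shows "bracket L (torus i j) (e i m p c) = e i m p c"
    and "bracket L (torus i j) (e m i p c) = \<ominus>\<^bsub>L\<^esub> e m i p c"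
    and "bracket L (torus i j) (e j m p c) = \<ominus>\<^bsub>L\<^esub> signed L (idx_parity i + idx_parity j) (e j m p c)"
    and "bracket L (torus i j) (e m j p c) = signed L (idx_parity i + idx_parity j) (e m j p c)"
proof -
  note [simp] = assms assms(1-3)[symmetric] A.homog_closed[OF c]
  note rules = e_bracket e_bracket_zero e_bracket_swap L.bracket_neg L.bracket_signed
  show "bracket L (torus i j) (e i m p c) = e i m p c"
    by (simp add: torus_leibniz[OF _ e_homog] rules)
  show "bracket L (torus i j) (e m i p c) = \<ominus>\<^bsub>L\<^esub> e m i p c"
    by (simp add: torus_leibniz[OF _ e_homog] rules L.signed_neg)
  show "bracket L (torus i j) (e j m p c) = \<ominus>\<^bsub>L\<^esub> signed L (idx_parity i + idx_parity j) (e j m p c)"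
    by (simp add: torus_leibniz[OF _ e_homog] rules L.signed_neg)
      (cases "idx_parity i"; cases "idx_parity j"; cases "idx_parity m"; cases p; simp)
  show "bracket L (torus i j) (e m j p c) = signed L (idx_parity i + idx_parity j) (e m j p c)"
    by (simp add: torus_leibniz[OF _ e_homog] rules L.signed_neg)
      (cases "idx_parity i"; cases "idx_parity j"; cases "idx_parity m"; cases p; simp)
qed

text \<open>
  For the roots $ij$ and $ji$ the relations do not give the bracket with $h_{ij}$ directly. These root
  elements are written as brackets through the third index, whose weights add up. If $i$ and $j$ have
  opposite parity, both weights are zero.
\<close>

lemma weights':
  assumes "i \<noteq> j" "j \<noteq> m" "i \<noteq> m" and c: "c \<in> homog A p"
  shows "bracket L (torus i j) (e i j p c) = e i j p c \<oplus>\<^bsub>L\<^esub> signed L (idx_parity i + idx_parity j) (e i j p c)"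
    and "bracket L (torus i j) (e j i p c) = \<ominus>\<^bsub>L\<^esub> (e j i p c \<oplus>\<^bsub>L\<^esub> signed L (idx_parity i + idx_parity j) (e j i p c))"
proof -
  note [simp] = assms assms(1-3)[symmetric] A.homog_closed[OF c]
  have 1: "e i j p c = bracket L (e i m p c) (e m j 0 \<one>\<^bsub>A\<^esub>)" by (simp add: e_bracket)
  have 2: "e j i p c = bracket L (e j m p c) (e m i 0 \<one>\<^bsub>A\<^esub>)" by (simp add: e_bracket)
  have "bracket L (torus i j) (bracket L (e i m p c) (e m j 0 \<one>\<^bsub>A\<^esub>)) =
    bracket L (bracket L (torus i j) (e i m p c)) (e m j 0 \<one>\<^bsub>A\<^esub>) \<oplus>\<^bsub>L\<^esub> bracket L (e i m p c) (bracket L (torus i j) (e m j 0 \<one>\<^bsub>A\<^esub>))"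
    by (rule L.leibniz_even[OF torus_homog e_homog e_homog]) simp_all
  then show "bracket L (torus i j) (e i j p c) = e i j p c \<oplus>\<^bsub>L\<^esub> signed L (idx_parity i + idx_parity j) (e i j p c)"
    by (simp add: weights L.bracket_signed e_bracket)
  have "bracket L (torus i j) (bracket L (e j m p c) (e m i 0 \<one>\<^bsub>A\<^esub>)) =
    bracket L (bracket L (torus i j) (e j m p c)) (e m i 0 \<one>\<^bsub>A\<^esub>) \<oplus>\<^bsub>L\<^esub> bracket L (e j m p c) (bracket L (torus i j) (e m i 0 \<one>\<^bsub>A\<^esub>))"
    by (rule L.leibniz_even[OF torus_homog e_homog e_homog]) simp_all
  then show "bracket L (torus i j) (e j i p c) = \<ominus>\<^bsub>L\<^esub> (e j i p c \<oplus>\<^bsub>L\<^esub> signed L (idx_parity i + idx_parity j) (e j i p c))"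
    using weights(2-3)[of i j m] by (simp add: L.bracket_neg L.bracket_signed e_bracket L.M.minus_add L.M.a_comm)
qed

end

lemma lie_homD:
  assumes "f \<in> lie_hom K L M"
  shows "x \<in> carrier L \<Longrightarrow> f x \<in> carrier M"
    and "x \<in> carrier L \<Longrightarrow> y \<in> carrier L \<Longrightarrow> f (x \<oplus>\<^bsub>L\<^esub> y) = f x \<oplus>\<^bsub>M\<^esub> f y"
    and "k \<in> carrier K \<Longrightarrow> x \<in> carrier L \<Longrightarrow> f (k \<odot>\<^bsub>L\<^esub> x) = k \<odot>\<^bsub>M\<^esub> f x"
    and "x \<in> carrier L \<Longrightarrow> y \<in> carrier L \<Longrightarrow> f (bracket L x y) = bracket M (f x) (f y)"
    and "x \<in> homog L d \<Longrightarrow> f x \<in> homog M d"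
  using assms unfolding lie_hom_def by auto

lemma lie_hom_zero:
  assumes "f \<in> lie_hom K L M" "graded_module K L" "graded_module K M"
  shows "f \<zero>\<^bsub>L\<^esub> = \<zero>\<^bsub>M\<^esub>"
proof -
  interpret L: graded_module K L by fact
  interpret M: graded_module K M by fact
  show ?thesis using lie_homD(3)[OF assms(1), of "\<zero>\<^bsub>K\<^esub>" "\<zero>\<^bsub>L\<^esub>"] lie_homD(1)[OF assms(1), of "\<zero>\<^bsub>L\<^esub>"] by simp
qed

lemma lie_hom_neg:
  assumes "f \<in> lie_hom K L M" "graded_module K L" "graded_module K M" "x \<in> carrier L"
  shows "f (\<ominus>\<^bsub>L\<^esub> x) = \<ominus>\<^bsub>M\<^esub> f x"
proof -
  interpret L: graded_module K L by fact
  interpret M: graded_module K M by fact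
  show ?thesis using lie_homD(3)[OF assms(1), of "\<ominus>\<^bsub>K\<^esub> \<one>\<^bsub>K\<^esub>" x] lie_homD(1)[OF assms(1,4)] assms(4)
    by (simp add: L.smult_l_minus M.smult_l_minus)
qed

lemma lie_hom_signed:
  assumes "f \<in> lie_hom K L M" "graded_module K L" "graded_module K M" "x \<in> carrier L"
  shows "f (signed L d x) = signed M d (f x)"
  using lie_hom_neg[OF assms] by (simp add: signed_def)

context steinberg_system
begin

lemma steinberg_system_image:
  assumes "lie_superalgebra K M" "\<psi> \<in> lie_hom K L M"
  shows "steinberg_system K A M (\<lambda>i j p a. \<psi> (e i j p a))"
proof -
  interpret M: lie_superalgebra K M by fact
  note \<psi> = lie_homD[OF assms(2)]
  have z: "\<psi> \<zero>\<^bsub>L\<^esub> = \<zero>\<^bsub>M\<^esub>" by (rule lie_hom_zero[OF assms(2)]) unfold_locales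
  show ?thesis
    by unfold_locales (simp_all add: e_homog \<psi>(5) e_add \<psi>(2) e_smult \<psi>(3) e_bracket e_bracket_zero z flip: \<psi>(4))
qed

end

lemma lie_presentation_st:
  assumes "assoc_superalgebra K A"
  shows "lie_presentation K (st_gens A) st_degree (st_relations K A)"
proof -
  interpret A: assoc_superalgebra K A by fact
  have gen: "term_degree K (st_gens A) st_degree (Gen (i, j, p, a)) (idx_parity i + idx_parity j + p)"
    if "i \<noteq> j" "a \<in> homog A p" for i j p a
    using term_degree.intros(2)[of "(i, j, p, a)" "st_gens A" K st_degree] that
    by (simp add: st_gens_def st_degree_def)
  show ?thesis
  proof
    fix t u assume "(t, u) \<in> st_relations K A"
    then show "\<exists>p. term_degree K (st_gens A) st_degree t p \<and> term_degree K (st_gens A) st_degree u p"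
    proof cases
      case (st_bracket i j k a p b q)
      have "idx_parity i + idx_parity j + p + (idx_parity j + idx_parity k + q) = idx_parity i + idx_parity k + (p + q)"
        by (cases "idx_parity j") (simp_all add: add_ac)
      then have "term_degree K (st_gens A) st_degree t (idx_parity i + idx_parity k + (p + q))"
        using term_degree.intros(6)[OF gen gen, of i j a p j k b q] st_bracket by (simp add: add_ac)
      then show ?thesis using gen[of i k "a \<otimes>\<^bsub>A\<^esub> b" "p + q"] st_bracket A.homog_mult by auto
    next
      case (st_zero i j k l a p b q)
      then show ?thesis using term_degree.intros(6)[OF gen gen, of i j a p k l b q] term_degree.intros(1) by blast
    next
      case (st_add i j a p b)
      then show ?thesis using gen A.homog_add by (intro exI[of _ "idx_parity i + idx_parity j + p"]) (simp add: term_degree.intros(3))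
    next
      case (st_smult i j k a p)
      then show ?thesis using gen A.homog_smult by (intro exI[of _ "idx_parity i + idx_parity j + p"]) (simp add: term_degree.intros(5))
    qed
  qed
qed

lemma lie_superalgebra_st21: "assoc_superalgebra K A \<Longrightarrow> lie_superalgebra K (st21 K A)"
  unfolding st21_def by (rule lie_presentation.lie_superalgebra_P[OF lie_presentation_st])

lemma steinberg_system_F:
  assumes "assoc_superalgebra K A"
  shows "steinberg_system K A (st21 K A) (F K A)"
proof -
  interpret A: assoc_superalgebra K A by fact
  interpret P: lie_presentation K "st_gens A" st_degree "st_relations K A"
    by (rule lie_presentation_st[OF assms])
  interpret L: lie_superalgebra K "st21 K A" by (rule lie_superalgebra_st21[OF assms])
  note st = st21_def F_def
  have [simp]: "Gen (i, j, p, a) \<in> P.terms" if "i \<noteq> j" "a \<in> homog A p" for i j p a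
    using that by (auto simp: st_gens_def)
  note rel = P.cls_eqI[OF lie_eq.eq_rel]
  show ?thesis
  proof (unfold_locales, goal_cases)
    case (1 i j a p)
    then have "P.degree (Gen (i, j, p, a)) (st_degree (i, j, p, a))"
      by (intro term_degree.intros) (auto simp: st_gens_def)
    then show ?case unfolding st P.homog_P by (auto simp: st_degree_def)
  next
    case (2 i j a p b)
    then show ?case unfolding st by (simp add: P.cls_ops rel[OF st_add] A.homog_add)
  next
    case (3 i j k a p)
    then show ?case unfolding st by (simp add: P.cls_ops rel[OF st_smult] A.homog_smult)
  next
    case (4 i j k a p b q)
    then show ?case unfolding st by (simp add: P.cls_ops rel[OF st_bracket] A.homog_mult)
  next
    case (5 i j k l a p b q)
    then show ?case unfolding st by (simp add: P.cls_ops rel[OF st_zero] P.cls_zero)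
  qed
qed

lemma (in steinberg_system) st21_universal:
  obtains \<rho> where "\<rho> \<in> lie_hom K (st21 K A) L" "\<And>i j p a. i \<noteq> j \<Longrightarrow> a \<in> homog A p \<Longrightarrow> \<rho> (F K A i j p a) = e i j p a"
proof -
  interpret P: lie_presentation K "st_gens A" st_degree "st_relations K A"
    by (rule lie_presentation_st) unfold_locales
  let ?f = "\<lambda>(i, j, p, a). e i j p a"
  obtain \<rho> where \<rho>: "\<rho> \<in> lie_hom K P.P L" "\<And>g. g \<in> st_gens A \<Longrightarrow> \<rho> (P.cls (Gen g)) = ?f g"
  proof (rule P.presented_lie_universal)
    show "lie_superalgebra K L" by unfold_locales
    show "?f g \<in> homog L (st_degree g)" if "g \<in> st_gens A" for g
      using that by (auto simp: st_gens_def st_degree_def e_homog)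
    show "lie_eval L ?f t = lie_eval L ?f u" if "(t, u) \<in> st_relations K A" for t u
      using that by cases (simp_all add: e_add e_smult e_bracket e_bracket_zero)
  qed blast
  show ?thesis
    by (rule that[of \<rho>]) (use \<rho> in \<open>auto simp: st21_def F_def st_gens_def\<close>)
qed



section \<open>Lifting along a central extension\<close>

locale central_ext = M: lie_superalgebra K M + L: lie_superalgebra K L
  for K :: "'k ring" and M :: "('k, 'm) superalgebra" and L :: "('k, 'v) superalgebra" +
  fixes \<tau> :: "'m \<Rightarrow> 'v"
  assumes hom: "\<tau> \<in> lie_hom K M L"
    and surj: "\<tau> ` carrier M = carrier L"
    and kernel_central: "a_kernel M L \<tau> \<subseteq> lie_centre M"
begin

lemmas \<tau> = lie_homD[OF hom]

lemma \<tau>_zero [simp]: "\<tau> \<zero>\<^bsub>M\<^esub> = \<zero>\<^bsub>L\<^esub>"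
  by (rule lie_hom_zero[OF hom]) unfold_locales

lemma \<tau>_neg: "x \<in> carrier M \<Longrightarrow> \<tau> (\<ominus>\<^bsub>M\<^esub> x) = \<ominus>\<^bsub>L\<^esub> \<tau> x"
  by (rule lie_hom_neg[OF hom]) unfold_locales

lemma \<tau>_signed: "x \<in> carrier M \<Longrightarrow> \<tau> (signed M d x) = signed L d (\<tau> x)"
  by (rule lie_hom_signed[OF hom]) unfold_locales

lemma bracket_kernel:
  assumes "x \<in> carrier M" "\<tau> x = \<zero>\<^bsub>L\<^esub>" "y \<in> carrier M"
  shows "bracket M x y = \<zero>\<^bsub>M\<^esub>" "bracket M y x = \<zero>\<^bsub>M\<^esub>"
proof -
  have "x \<in> lie_centre M" using assms kernel_central by (auto simp: a_kernel_def')
  then show "bracket M x y = \<zero>\<^bsub>M\<^esub>" "bracket M y x = \<zero>\<^bsub>M\<^esub>"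
    using M.lie_centre_right[of x y] assms by (auto simp: lie_centre_def)
qed

text \<open>
  Two lifts of the same element differ by an element of the kernel, which is central.
\<close>

lemma bracket_cong:
  assumes "x \<in> carrier M" "x' \<in> carrier M" "y \<in> carrier M" "y' \<in> carrier M" "\<tau> x = \<tau> x'" "\<tau> y = \<tau> y'"
  shows "bracket M x y = bracket M x' y'"
proof -
  have "\<tau> (x \<ominus>\<^bsub>M\<^esub> x') = \<zero>\<^bsub>L\<^esub>" "\<tau> (y \<ominus>\<^bsub>M\<^esub> y') = \<zero>\<^bsub>L\<^esub>"
    using assms by (simp_all add: M.M.minus_eq \<tau> \<tau>_neg L.M.r_neg)
  then have "bracket M (x \<ominus>\<^bsub>M\<^esub> x') y = \<zero>\<^bsub>M\<^esub>" "bracket M x' (y \<ominus>\<^bsub>M\<^esub> y') = \<zero>\<^bsub>M\<^esub>"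
    using assms bracket_kernel by simp_all
  then have "bracket M x y \<oplus>\<^bsub>M\<^esub> \<ominus>\<^bsub>M\<^esub> bracket M x' y = \<zero>\<^bsub>M\<^esub>" "bracket M x' y \<oplus>\<^bsub>M\<^esub> \<ominus>\<^bsub>M\<^esub> bracket M x' y' = \<zero>\<^bsub>M\<^esub>"
    using assms by (simp_all add: M.M.minus_eq M.bracket_add_left M.bracket_add_right M.bracket_neg)
  then have "bracket M x y = bracket M x' y" "bracket M x' y = bracket M x' y'"
    using assms M.M.minus_equality[of "bracket M x y" "\<ominus>\<^bsub>M\<^esub> bracket M x' y"]
      M.M.minus_equality[of "bracket M x' y" "\<ominus>\<^bsub>M\<^esub> bracket M x' y'"] by simp_all
  then show ?thesis by simp
qed

text \<open>
  The component of degree $d$ of any preimage is again a preimage, since components in a graded module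
  are unique.
\<close>

lemma homog_lift:
  assumes "y \<in> homog L d" shows "\<exists>x\<in>homog M d. \<tau> x = y"
proof -
  have "y \<in> \<tau> ` carrier M" using assms surj by simp
  then obtain x where x: "x \<in> carrier M" "\<tau> x = y" by blast
  obtain u v where uv: "u \<in> homog M d" "v \<in> homog M (d + 1)" "x = u \<oplus>\<^bsub>M\<^esub> v"
    using M.decomposition_exists[OF x(1)] by blast
  have "y = \<tau> u \<oplus>\<^bsub>L\<^esub> \<tau> v" using x uv \<tau>(2) M.homog_closed by blast
  then have "\<tau> u = homog_part L d y" using L.homog_part_add_unique \<tau>(5) uv by metis
  then show ?thesis using uv assms L.homog_part_homog by auto
qed

end

definition third :: "idx \<Rightarrow> idx \<Rightarrow> idx" where
  "third i j = (if i \<noteq> I1 \<and> j \<noteq> I1 then I1 else if i \<noteq> I2 \<and> j \<noteq> I2 then I2 else I3)"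

lemma third_neq: "i \<noteq> j \<Longrightarrow> third i j \<noteq> i \<and> third i j \<noteq> j \<and> i \<noteq> third i j \<and> j \<noteq> third i j"
  by (cases i; cases j) (simp_all add: third_def)

lemma third_unique: "i \<noteq> j \<Longrightarrow> m \<noteq> i \<Longrightarrow> m \<noteq> j \<Longrightarrow> m = third i j"
  by (cases i; cases j; cases m) (simp_all add: third_def)

locale steinberg_central = central_ext K M L \<tau> + S: steinberg_system K A L e
  for K :: "'k ring" and A :: "('k, 'a) superalgebra" and M :: "('k, 'm) superalgebra"
    and L :: "('k, 'v) superalgebra" and \<tau> and e
begin

text \<open>
  An arbitrary homogeneous preimage. No linearity in \<^term>\<open>a\<close> can be expected of this choice; it
  comes back after taking brackets.
\<close>

definition elem_lift :: "idx \<Rightarrow> idx \<Rightarrow> bit \<Rightarrow> 'a \<Rightarrow> 'm" where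
  "elem_lift i j p a = (SOME x. x \<in> homog M (idx_parity i + idx_parity j + p) \<and> \<tau> x = e i j p a)"

lemma
  assumes "i \<noteq> j" "a \<in> homog A p"
  shows elem_lift_homog: "elem_lift i j p a \<in> homog M (idx_parity i + idx_parity j + p)" and \<tau>_elem_lift: "\<tau> (elem_lift i j p a) = e i j p a"
  unfolding elem_lift_def using someI_ex[of "\<lambda>x. x \<in> homog M (idx_parity i + idx_parity j + p) \<and> \<tau> x = e i j p a"]
    homog_lift[OF S.e_homog[OF assms]] by auto

lemma elem_lift_closed [simp]: "i \<noteq> j \<Longrightarrow> a \<in> homog A p \<Longrightarrow> elem_lift i j p a \<in> carrier M"
  using elem_lift_homog M.homog_closed by blast

definition torus_lift :: "idx \<Rightarrow> idx \<Rightarrow> 'm" where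
  "torus_lift i j = bracket M (elem_lift i j 0 \<one>\<^bsub>A\<^esub>) (elem_lift j i 0 \<one>\<^bsub>A\<^esub>)"

lemma
  assumes "i \<noteq> j"
  shows torus_lift_homog: "torus_lift i j \<in> homog M 0" and \<tau>_torus_lift: "\<tau> (torus_lift i j) = S.torus i j"
proof -
  show "torus_lift i j \<in> homog M 0"
    using M.bracket_homog[OF elem_lift_homog elem_lift_homog, of i j "\<one>\<^bsub>A\<^esub>" 0 j i "\<one>\<^bsub>A\<^esub>" 0] assms
    by (simp add: torus_lift_def add_ac)
  show "\<tau> (torus_lift i j) = S.torus i j" using assms by (simp add: torus_lift_def S.torus_def \<tau> \<tau>_elem_lift)
qed

lemma torus_lift_closed [simp]: "i \<noteq> j \<Longrightarrow> torus_lift i j \<in> carrier M"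
  using torus_lift_homog M.homog_closed by blast

text \<open>
  The action of a lifted torus element on a bracket of lifts is computed from the weights in the base:
  by \<open>bracket_cong\<close> the inner brackets may be replaced by any elements with the same image.
\<close>

lemma torus_lift_leibniz:
  assumes "i \<noteq> j" "k \<noteq> l" "k' \<noteq> l'" "a \<in> homog A p" "b \<in> homog A q"
    and "x \<in> carrier M" "\<tau> x = bracket L (S.torus i j) (e k l p a)"
    and "y \<in> carrier M" "\<tau> y = bracket L (S.torus i j) (e k' l' q b)"
  shows "bracket M (torus_lift i j) (bracket M (elem_lift k l p a) (elem_lift k' l' q b))
    = bracket M x (elem_lift k' l' q b) \<oplus>\<^bsub>M\<^esub> bracket M (elem_lift k l p a) y"
proof -
  have "bracket M (bracket M (torus_lift i j) (elem_lift k l p a)) (elem_lift k' l' q b) = bracket M x (elem_lift k' l' q b)"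
    by (rule bracket_cong) (use assms in \<open>simp_all add: \<tau> \<tau>_torus_lift \<tau>_elem_lift\<close>)
  moreover have "bracket M (elem_lift k l p a) (bracket M (torus_lift i j) (elem_lift k' l' q b)) = bracket M (elem_lift k l p a) y"
    by (rule bracket_cong) (use assms in \<open>simp_all add: \<tau> \<tau>_torus_lift \<tau>_elem_lift\<close>)
  ultimately show ?thesis using M.leibniz_even[OF torus_lift_homog elem_lift_homog elem_lift_homog] assms by simp
qed

text \<open>
  The bracket is fixed by the lifted torus element, whose action depends only on the image of the
  bracket, that is, on the product $ab$.
\<close>

lemma elem_lift_bracket:
  assumes "i \<noteq> j" "j \<noteq> k" "i \<noteq> k" "a \<in> homog A p" "b \<in> homog A q"
  shows "bracket M (elem_lift i j p a) (elem_lift j k q b) = bracket M (elem_lift i j (p + q) (a \<otimes>\<^bsub>A\<^esub> b)) (elem_lift j k 0 \<one>\<^bsub>A\<^esub>)"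
proof -
  let ?s = "signed M (idx_parity i + idx_parity j)"
  have eigen: "bracket M (torus_lift i j) (bracket M (elem_lift i j p a) (elem_lift j k q b)) = bracket M (elem_lift i j p a) (elem_lift j k q b)"
    if [simp]: "a \<in> homog A p" "b \<in> homog A q" for a b p q
  proof -
    note [simp] = assms(1-3) assms(1-3)[symmetric]
    let ?x = "elem_lift i j p a" and ?y = "elem_lift j k q b"
    \<comment> \<open>The weights of the two factors are $1 + (-1)^{|i|+|j|}$ and $-(-1)^{|i|+|j|}$, with sum 1.\<close>
    have "bracket M (torus_lift i j) (bracket M ?x ?y) = bracket M (?x \<oplus>\<^bsub>M\<^esub> ?s ?x) ?y \<oplus>\<^bsub>M\<^esub> bracket M ?x (\<ominus>\<^bsub>M\<^esub> ?s ?y)"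
      by (rule torus_lift_leibniz) (simp_all add: \<tau> \<tau>_elem_lift \<tau>_neg \<tau>_signed S.weights S.weights'[where m = k])
    then show ?thesis
      by (simp add: M.bracket_add_left M.bracket_signed M.bracket_neg M.M.a_assoc M.M.r_neg)
  qed
  note [simp] = assms S.A.homog_mult[OF assms(4,5)] S.A.homog_closed[OF assms(4)]
    S.A.homog_closed[OF assms(5)]
  let ?z = "bracket M (elem_lift i j p a) (elem_lift j k q b)"
  let ?z' = "bracket M (elem_lift i j (p + q) (a \<otimes>\<^bsub>A\<^esub> b)) (elem_lift j k 0 \<one>\<^bsub>A\<^esub>)"
  \<comment> \<open>Both brackets lift $e_{ik}(ab)$, so the torus lift acts on them alike.\<close>
  have "\<tau> ?z = \<tau> ?z'" by (simp add: \<tau> \<tau>_elem_lift S.e_bracket)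
  then have "bracket M (torus_lift i j) ?z = bracket M (torus_lift i j) ?z'"
    by (intro bracket_cong) simp_all
  then show ?thesis using eigen[of a p b q] eigen[of "a \<otimes>\<^bsub>A\<^esub> b" "p + q" "\<one>\<^bsub>A\<^esub>" 0] by simp
qed

text \<open>
  Neither constituent of $e_{ij}(a) = [e_{im}(a), e_{mj}(1)]$ interacts with $e_{ij}(b)$, so the Leibniz rule
  leaves only brackets with elements of the kernel.
\<close>

lemma elem_lift_bracket_same:
  assumes "i \<noteq> j" "a \<in> homog A p" "b \<in> homog A q"
  shows "bracket M (elem_lift i j p a) (elem_lift i j q b) = \<zero>\<^bsub>M\<^esub>"
proof -
  let ?m = "third i j"
  note [simp] = assms assms(1)[symmetric] third_neq[OF assms(1)] S.A.homog_closed[OF assms(2)]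
  have "bracket M (elem_lift i j p a) (elem_lift i j q b) = bracket M (bracket M (elem_lift i ?m p a) (elem_lift ?m j 0 \<one>\<^bsub>A\<^esub>)) (elem_lift i j q b)"
    by (rule bracket_cong) (simp_all add: \<tau> \<tau>_elem_lift S.e_bracket)
  also have "\<dots> = bracket M (elem_lift i ?m p a) (bracket M (elem_lift ?m j 0 \<one>\<^bsub>A\<^esub>) (elem_lift i j q b)) \<oplus>\<^bsub>M\<^esub>
      signed M ((idx_parity ?m + idx_parity j + 0) * (idx_parity i + idx_parity j + q))
        (bracket M (bracket M (elem_lift i ?m p a) (elem_lift i j q b)) (elem_lift ?m j 0 \<one>\<^bsub>A\<^esub>))"
    by (rule M.leibniz_left[OF _ elem_lift_homog elem_lift_homog]) simp_all
  also have "\<dots> = \<zero>\<^bsub>M\<^esub>"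
    by (simp add: bracket_kernel \<tau> \<tau>_elem_lift S.e_bracket_zero)
  finally show ?thesis .
qed

text \<open>
  For $i$ and $j$ of opposite parity the weights of $h_{ij}$ on the two arguments are $0$ and $1$, so the
  bracket equals its own image under a torus lift. As an element of the kernel it is annihilated.
\<close>

lemma elem_lift_bracket_same_row_odd:
  assumes "i \<noteq> j" "j \<noteq> m" "i \<noteq> m" "a \<in> homog A p" "b \<in> homog A q" "idx_parity i + idx_parity j = 1"
  shows "bracket M (elem_lift i j p a) (elem_lift i m q b) = \<zero>\<^bsub>M\<^esub>"
    and "bracket M (elem_lift i m q b) (elem_lift i j p a) = \<zero>\<^bsub>M\<^esub>"
proof -
  note [simp] = assms assms(1-3)[symmetric]
  let ?z = "bracket M (elem_lift i j p a) (elem_lift i m q b)"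
  have "bracket M (torus_lift i j) ?z = bracket M \<zero>\<^bsub>M\<^esub> (elem_lift i m q b) \<oplus>\<^bsub>M\<^esub> bracket M (elem_lift i j p a) (elem_lift i m q b)"
    by (rule torus_lift_leibniz) (simp_all add: \<tau> \<tau>_elem_lift S.weights S.weights'[where m = m] L.signed_1 L.M.r_neg)
  moreover have "bracket M (torus_lift i j) ?z = \<zero>\<^bsub>M\<^esub>"
    by (simp add: bracket_kernel \<tau> \<tau>_elem_lift S.e_bracket_zero)
  ultimately show "?z = \<zero>\<^bsub>M\<^esub>" by simp
  then show "bracket M (elem_lift i m q b) (elem_lift i j p a) = \<zero>\<^bsub>M\<^esub>"
    using M.bracket_antisym[OF elem_lift_homog elem_lift_homog, of i m b q i j a p] by simp
qed

text \<open>
  The same argument with the opposite roots: the weights are now $0$ and $-1$.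
\<close>

lemma elem_lift_bracket_same_column_odd:
  assumes "i \<noteq> j" "j \<noteq> m" "i \<noteq> m" "a \<in> homog A p" "b \<in> homog A q" "idx_parity i + idx_parity j = 1"
  shows "bracket M (elem_lift j i p a) (elem_lift m i q b) = \<zero>\<^bsub>M\<^esub>"
    and "bracket M (elem_lift m i q b) (elem_lift j i p a) = \<zero>\<^bsub>M\<^esub>"
proof -
  note [simp] = assms assms(1-3)[symmetric]
  let ?z = "bracket M (elem_lift j i p a) (elem_lift m i q b)"
  have "bracket M (torus_lift i j) ?z = bracket M \<zero>\<^bsub>M\<^esub> (elem_lift m i q b) \<oplus>\<^bsub>M\<^esub> bracket M (elem_lift j i p a) (\<ominus>\<^bsub>M\<^esub> elem_lift m i q b)"
    by (rule torus_lift_leibniz) (simp_all add: \<tau> \<tau>_elem_lift \<tau>_neg S.weights S.weights'[where m = m] L.signed_1 L.M.r_neg)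
  moreover have "bracket M (torus_lift i j) ?z = \<zero>\<^bsub>M\<^esub>"
    by (simp add: bracket_kernel \<tau> \<tau>_elem_lift S.e_bracket_zero)
  ultimately have "\<ominus>\<^bsub>M\<^esub> ?z = \<zero>\<^bsub>M\<^esub>" by (simp add: M.bracket_neg)
  then have "\<ominus>\<^bsub>M\<^esub> (\<ominus>\<^bsub>M\<^esub> ?z) = \<zero>\<^bsub>M\<^esub>" by simp
  then show "?z = \<zero>\<^bsub>M\<^esub>" by simp
  then show "bracket M (elem_lift m i q b) (elem_lift j i p a) = \<zero>\<^bsub>M\<^esub>"
    using M.bracket_antisym[OF elem_lift_homog elem_lift_homog, of m i b q j i a p] by simp
qed

text \<open>
  Of the three indices two are even and one is odd, so no index has the same parity as both others. This
  is the property of the shape $2|1$ on which the vanishing of the second homology rests.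
\<close>

lemma odd_partner:
  assumes "i \<noteq> j" "j \<noteq> m" "i \<noteq> m"
  shows "idx_parity i + idx_parity j = 1 \<or> idx_parity i + idx_parity m = 1"
  using assms by (cases i; cases j; cases m) simp_all

lemma elem_lift_bracket_zero:
  assumes "i \<noteq> j" "k \<noteq> l" "j \<noteq> k" "i \<noteq> l" and a: "a \<in> homog A p" and b: "b \<in> homog A q"
  shows "bracket M (elem_lift i j p a) (elem_lift k l q b) = \<zero>\<^bsub>M\<^esub>"
proof (cases "i = k")
  case True
  show ?thesis
  proof (cases "j = l")
    case False
    then show ?thesis using \<open>i = k\<close> assms odd_partner[of i j l]
      elem_lift_bracket_same_row_odd(1)[of i j l a p b q] elem_lift_bracket_same_row_odd(2)[of i l j b q a p] by auto
  qed (use True assms elem_lift_bracket_same in simp)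
next
  case False
  then have "j = l" using assms by (cases i; cases j; cases k; cases l) simp_all
  then show ?thesis using False assms odd_partner[of j i k]
      elem_lift_bracket_same_column_odd(1)[of j i k a p b q] elem_lift_bracket_same_column_odd(2)[of j k i b q a p] by auto
qed

text \<open>
  Unlike \<^const>\<open>elem_lift\<close>, this does not depend on choices, being a bracket; hence it is linear.
\<close>

definition steinberg_lift :: "idx \<Rightarrow> idx \<Rightarrow> bit \<Rightarrow> 'a \<Rightarrow> 'm" where
  "steinberg_lift i j p a = bracket M (elem_lift i (third i j) p a) (elem_lift (third i j) j 0 \<one>\<^bsub>A\<^esub>)"

lemma steinberg_lift_closed [simp]: "i \<noteq> j \<Longrightarrow> a \<in> homog A p \<Longrightarrow> steinberg_lift i j p a \<in> carrier M"
  using third_neq[of i j] by (simp add: steinberg_lift_def)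

lemma \<tau>_steinberg_lift: "i \<noteq> j \<Longrightarrow> a \<in> homog A p \<Longrightarrow> \<tau> (steinberg_lift i j p a) = e i j p a"
  using third_neq[of i j] S.A.homog_closed by (simp add: steinberg_lift_def \<tau> \<tau>_elem_lift S.e_bracket)

lemma steinberg_lift_bracket:
  assumes "i \<noteq> j" "k \<noteq> l" "a \<in> homog A p" "b \<in> homog A q"
  shows "bracket M (steinberg_lift i j p a) (steinberg_lift k l q b) = bracket M (elem_lift i j p a) (elem_lift k l q b)"
  by (rule bracket_cong) (use assms in \<open>simp_all add: \<tau>_steinberg_lift \<tau>_elem_lift\<close>)

theorem steinberg_system_lift: "steinberg_system K A M steinberg_lift"
proof (unfold_locales, goal_cases)
  case (1 i j a p)
  let ?m = "third i j"
  have "idx_parity i + idx_parity ?m + p + (idx_parity ?m + idx_parity j + 0) = idx_parity i + idx_parity j + p"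
    by (cases "idx_parity ?m") (simp_all add: add_ac)
  then show ?case
    using M.bracket_homog[OF elem_lift_homog elem_lift_homog, of i ?m a p ?m j "\<one>\<^bsub>A\<^esub>" 0] third_neq[OF 1(1)] 1(2)
    by (simp only: steinberg_lift_def S.A.homog_one simp_thms)
next
  case (2 i j a p b)
  let ?m = "third i j"
  have *: "a \<oplus>\<^bsub>A\<^esub> b \<in> homog A p" using 2 by (simp add: S.A.homog_add)
  have "steinberg_lift i j p (a \<oplus>\<^bsub>A\<^esub> b) = bracket M (elem_lift i ?m p a \<oplus>\<^bsub>M\<^esub> elem_lift i ?m p b) (elem_lift ?m j 0 \<one>\<^bsub>A\<^esub>)"
    unfolding steinberg_lift_def by (rule bracket_cong) (use 2 * third_neq[OF 2(1)] in \<open>simp_all add: \<tau> \<tau>_elem_lift S.e_add\<close>)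
  then show ?case using 2 third_neq[OF 2(1)] by (simp add: steinberg_lift_def M.bracket_add_left)
next
  case (3 i j c a p)
  let ?m = "third i j"
  have *: "c \<odot>\<^bsub>A\<^esub> a \<in> homog A p" using 3 by (simp add: S.A.homog_smult)
  have "steinberg_lift i j p (c \<odot>\<^bsub>A\<^esub> a) = bracket M (c \<odot>\<^bsub>M\<^esub> elem_lift i ?m p a) (elem_lift ?m j 0 \<one>\<^bsub>A\<^esub>)"
    unfolding steinberg_lift_def by (rule bracket_cong) (use 3 * third_neq[OF 3(1)] in \<open>simp_all add: \<tau> \<tau>_elem_lift S.e_smult\<close>)
  then show ?case using 3 third_neq[OF 3(1)] by (simp add: steinberg_lift_def M.bracket_smult_left)
next
  case (4 i j k a p b q)
  then have "third i k = j" using third_unique[of i k j] by auto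
  with 4 show ?case by (simp add: steinberg_lift_bracket elem_lift_bracket steinberg_lift_def[of i k])
next
  case (5 i j k l a p b q)
  then show ?case by (simp add: steinberg_lift_bracket elem_lift_bracket_zero)
qed

end



section \<open>Generation and root spaces\<close>

context lie_presentation
begin

text \<open>
  The statement is strong enough for an induction over homogeneous expressions: for a bracket $[t,u]$ the
  rule \<open>leibniz_right\<close> expresses $[w,[t,u]]$ by multiplications with $t$ and with $u$ only.
\<close>

lemma generator_closure:
  assumes W: "submodule W K P"
    and gen: "\<And>g. g \<in> G \<Longrightarrow> cls (Gen g) \<in> W"
    and br: "\<And>w g. w \<in> W \<Longrightarrow> g \<in> G \<Longrightarrow> bracket P w (cls (Gen g)) \<in> W"
    and "degree t p"
  shows "cls t \<in> W \<and> (\<forall>w\<in>W. bracket P w (cls t) \<in> W)"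
proof -
  note E = P.submoduleE[OF W]
  have W_closed [simp]: "w \<in> carrier P" if "w \<in> W" for w using that E(1) by blast
  have zero: "\<zero>\<^bsub>P\<^esub> \<in> W" using subgroup.one_closed[OF submodule.axioms(1)[OF W]] by simp
  note [dest] = term_degree_lie_terms
  show ?thesis using assms(4)
  proof induction
    case (1 p)
    show ?case using zero by (simp flip: cls_zero)
  next
    case (2 g)
    then show ?case using gen br by simp
  next
    case (3 t p u)
    then have "t \<in> terms" "u \<in> terms" by auto
    then show ?case using 3 E(5) by (simp add: P.bracket_add_right flip: cls_ops)
  next
    case (4 t p)
    then have "t \<in> terms" by auto
    then show ?case using 4 E(3) by (simp add: P.bracket_neg flip: cls_neg)
  next
    case (5 k t p)
    then have "t \<in> terms" by auto
    then show ?case using 5 E(4) by (simp add: P.bracket_smult_right flip: cls_ops)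
  next
    case (6 t p u q)
    then have tu [simp]: "t \<in> terms" "u \<in> terms" by auto
    have h: "cls t \<in> homog P p" "cls u \<in> homog P q" using 6 by (auto simp: homog_P)
    have "bracket P w (bracket P (cls t) (cls u)) \<in> W" if "w \<in> W" for w
      using 6 E(5,3) that P.signed_in_submodule[OF W]
      by (simp add: P.leibniz_right[OF _ h] P.M.minus_eq)
    then show ?case using 6 by (simp flip: cls_ops)
  qed
qed

text \<open>
  A presented algebra is spanned by left-normed brackets of generators: a submodule that contains the
  generators and is stable under right multiplication by them is everything.
\<close>

lemma generated:
  assumes W: "submodule W K P"
    and gen: "\<And>g. g \<in> G \<Longrightarrow> cls (Gen g) \<in> W"
    and br: "\<And>w g. w \<in> W \<Longrightarrow> g \<in> G \<Longrightarrow> bracket P w (cls (Gen g)) \<in> W"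
  shows "W = carrier P"
proof
  show "carrier P \<subseteq> W"
  proof
    fix x assume "x \<in> carrier P"
    then obtain t where t: "t \<in> terms" "x = cls t" by (rule carrierE)
    have "cls (part t d) \<in> W" for d
      using generator_closure[OF assms part_degree[OF t(1)]] by blast
    then show "x \<in> W" using P.submoduleE(5)[OF W] part_sum[OF t(1)] t by simp
  qed
qed (rule P.submoduleE(1)[OF W])

text \<open>
  The elements annihilated by $z$ are closed under brackets, again by \<open>leibniz_right\<close>.
\<close>

lemma centre_generators:
  assumes z: "z \<in> carrier P" and br: "\<And>g. g \<in> G \<Longrightarrow> bracket P z (cls (Gen g)) = \<zero>\<^bsub>P\<^esub>"
  shows "z \<in> lie_centre P"
proof -
  note [dest] = term_degree_lie_terms
  have *: "bracket P z (cls t) = \<zero>\<^bsub>P\<^esub>" if "degree t p" for t p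
    using that
  proof induction
    case (1 p)
    show ?case using z by (simp flip: cls_zero)
  next
    case (2 g)
    then show ?case using br by simp
  next
    case (3 t p u)
    then have "t \<in> terms" "u \<in> terms" by auto
    then show ?case using 3 z by (simp add: P.bracket_add_right flip: cls_ops)
  next
    case (4 t p)
    then have "t \<in> terms" by auto
    then show ?case using 4 z by (simp add: P.bracket_neg flip: cls_neg)
  next
    case (5 k t p)
    then have "t \<in> terms" by auto
    then show ?case using 5 z by (simp add: P.bracket_smult_right flip: cls_ops)
  next
    case (6 t p u q)
    then have tu [simp]: "t \<in> terms" "u \<in> terms" by auto
    have h: "cls t \<in> homog P p" "cls u \<in> homog P q" using 6 by (auto simp: homog_P)
    then have "bracket P z (bracket P (cls t) (cls u)) = \<zero>\<^bsub>P\<^esub>"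
      using 6 z by (simp add: P.leibniz_right[OF _ h] P.M.minus_eq)
    then show ?case by (simp flip: cls_ops)
  qed
  have "bracket P z x = \<zero>\<^bsub>P\<^esub>" if x: "x \<in> carrier P" for x
  proof -
    obtain t where t: "t \<in> terms" "x = cls t" using x by (rule carrierE)
    then show ?thesis using *[OF part_degree[OF t(1)]] z part_sum[OF t(1)] 
      by (simp add: P.bracket_add_right)
  qed
  then show ?thesis using z by (simp add: lie_centre_def)
qed

end

context steinberg_system
begin

text \<open>
  The extension of the root elements to inhomogeneous \<^term>\<open>a\<close> by linearity.
\<close>

definition elem :: "idx \<Rightarrow> idx \<Rightarrow> 'a \<Rightarrow> 'v" where
  "elem i j a = e i j 0 (homog_part A 0 a) \<oplus>\<^bsub>L\<^esub> e i j 1 (homog_part A 1 a)"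

lemma elem_closed [simp]: "i \<noteq> j \<Longrightarrow> a \<in> carrier A \<Longrightarrow> elem i j a \<in> carrier L"
  by (simp add: elem_def)

lemma elem_homog: "i \<noteq> j \<Longrightarrow> a \<in> homog A p \<Longrightarrow> elem i j a = e i j p a"
  by (cases p) (simp_all add: elem_def A.homog_part_homog e_zero)

lemma elem_add: "i \<noteq> j \<Longrightarrow> a \<in> carrier A \<Longrightarrow> b \<in> carrier A \<Longrightarrow> elem i j (a \<oplus>\<^bsub>A\<^esub> b) = elem i j a \<oplus>\<^bsub>L\<^esub> elem i j b"
  by (simp add: elem_def A.homog_part_add e_add L.M.a_ac)

lemma elem_smult: "i \<noteq> j \<Longrightarrow> a \<in> carrier A \<Longrightarrow> c \<in> carrier K \<Longrightarrow> elem i j (c \<odot>\<^bsub>A\<^esub> a) = c \<odot>\<^bsub>L\<^esub> elem i j a"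
  by (simp add: elem_def A.homog_part_smult e_smult L.smult_r_distr)

lemma elem_zero [simp]: "i \<noteq> j \<Longrightarrow> elem i j \<zero>\<^bsub>A\<^esub> = \<zero>\<^bsub>L\<^esub>"
  using elem_homog[OF _ A.homog_zero] e_zero by simp

definition root_space :: "idx \<Rightarrow> idx \<Rightarrow> 'v set" where
  "root_space i j = elem i j ` carrier A"

lemma root_space_submodule: assumes ij: "i \<noteq> j" shows "submodule (root_space i j) K L"
proof (rule L.submoduleI)
  show "\<zero>\<^bsub>L\<^esub> \<in> root_space i j" unfolding root_space_def using elem_zero[OF ij] by (metis A.M.zero_closed imageI)
  have sm: "c \<odot>\<^bsub>L\<^esub> x \<in> root_space i j" if "c \<in> carrier K" "x \<in> root_space i j" for c x
    using that ij unfolding root_space_def by (auto simp flip: elem_smult)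
  then show "c \<odot>\<^bsub>L\<^esub> x \<in> root_space i j" if "c \<in> carrier K" "x \<in> root_space i j" for c x using that .
  show "root_space i j \<subseteq> carrier L" using ij by (auto simp: root_space_def)
  then show "\<ominus>\<^bsub>L\<^esub> x \<in> root_space i j" if "x \<in> root_space i j" for x
    using sm[of "\<ominus>\<^bsub>K\<^esub> \<one>\<^bsub>K\<^esub>" x] that by (auto simp: L.smult_l_minus)
  show "x \<oplus>\<^bsub>L\<^esub> y \<in> root_space i j" if "x \<in> root_space i j" "y \<in> root_space i j" for x y
    using that ij by (auto simp: root_space_def simp flip: elem_add)
qed

lemmas root_spaceE = L.submoduleE[OF root_space_submodule]

lemma root_space_zero [simp]: "i \<noteq> j \<Longrightarrow> \<zero>\<^bsub>L\<^esub> \<in> root_space i j"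
  using subgroup.one_closed[OF submodule.axioms(1)[OF root_space_submodule]] by simp

lemma root_space_signed: "i \<noteq> j \<Longrightarrow> x \<in> root_space i j \<Longrightarrow> signed L d x \<in> root_space i j"
  by (rule L.signed_in_submodule[OF root_space_submodule])

lemma e_root_space: "i \<noteq> j \<Longrightarrow> a \<in> homog A p \<Longrightarrow> e i j p a \<in> root_space i j"
  unfolding root_space_def using elem_homog A.homog_closed by (metis imageI)

lemma root_space_bracket:
  assumes "i \<noteq> j" "j \<noteq> m" "i \<noteq> m" and b: "b \<in> homog A q"
  shows "w \<in> root_space i m \<Longrightarrow> bracket L w (e m j q b) \<in> root_space i j"
    and "w \<in> root_space m j \<Longrightarrow> bracket L w (e i m q b) \<in> root_space i j"
proof -
  note [simp] = assms assms(1-3)[symmetric]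
  note rules = L.bracket_add_left e_bracket e_bracket_swap e_root_space root_spaceE(3,5) root_space_signed A.homog_mult
  show "bracket L w (e m j q b) \<in> root_space i j" if w: "w \<in> root_space i m"
  proof -
    obtain a where a: "a \<in> carrier A" "w = elem i m a" using w by (auto simp: root_space_def)
    then show ?thesis
      using A.homog_mult[OF A.homog_part_in[OF a(1), of 0] b] A.homog_mult[OF b A.homog_part_in[OF a(1), of 0]]
      by (simp add: elem_def rules)
  qed
  show "bracket L w (e i m q b) \<in> root_space i j" if w: "w \<in> root_space m j"
  proof -
    obtain a where a: "a \<in> carrier A" "w = elem m j a" using w by (auto simp: root_space_def)
    then show ?thesis
      using A.homog_mult[OF A.homog_part_in[OF a(1), of 0] b] A.homog_mult[OF b A.homog_part_in[OF a(1), of 0]]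
      by (simp add: elem_def rules)
  qed
qed

text \<open>
  Elements $[e_{ij}(a), e_{ji}(b)]$ normalise every root space. For the four roots through the third index
  $m$ this follows from the Leibniz rule and the relations. The roots $ij$ and $ji$ are brackets of two of
  those.
\<close>

lemma diagonal_bracket_root_space:
  assumes ij: "i \<noteq> j" and a: "a \<in> homog A p" and b: "b \<in> homog A q" and kl: "k \<noteq> l" and c: "c \<in> homog A r"
  shows "bracket L (bracket L (e i j p a) (e j i q b)) (e k l r c) \<in> root_space k l"
proof -
  define m where "m = third i j"
  let ?d = "bracket L (e i j p a) (e j i q b)"
  have m: "i \<noteq> m" "j \<noteq> m" "m \<noteq> i" "m \<noteq> j" using third_neq[OF ij] by (simp_all add: m_def)
  note [simp] = m ij ij[symmetric] a b
  note rules = L.leibniz_left[OF e_closed e_homog e_homog] e_bracket e_bracket_swap e_bracket_zero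
    L.bracket_neg L.bracket_signed A.homog_mult e_root_space root_spaceE(3) root_space_signed L.signed_neg L.signed_zero
  have *: "bracket L ?d (e i m r c) \<in> root_space i m" "bracket L ?d (e m i r c) \<in> root_space m i"
      "bracket L ?d (e j m r c) \<in> root_space j m" "bracket L ?d (e m j r c) \<in> root_space m j"
    if [simp]: "c \<in> homog A r" for c r
    by (simp_all add: rules)
  have **: "bracket L ?d (e k l r c) \<in> root_space k l"
    if kl: "k \<noteq> l" "l \<noteq> m" "k \<noteq> m"
      and k: "\<And>c r. c \<in> homog A r \<Longrightarrow> bracket L ?d (e k m r c) \<in> root_space k m"
      and l: "\<And>c r. c \<in> homog A r \<Longrightarrow> bracket L ?d (e m l r c) \<in> root_space m l" for k l
  proof -
    note [simp] = kl kl[symmetric] c A.homog_closed[OF c]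
    have "e k l r c = bracket L (e k m r c) (e m l 0 \<one>\<^bsub>A\<^esub>)" by (simp add: e_bracket)
    moreover have "bracket L ?d (bracket L (e k m r c) (e m l 0 \<one>\<^bsub>A\<^esub>)) \<in> root_space k l"
      using root_space_bracket[OF kl, of _ _] k[OF c] l[OF A.homog_one]
      by (simp add: L.leibniz_right[OF _ e_homog e_homog] L.M.minus_eq root_spaceE(3,5) root_space_signed)
    ultimately show ?thesis by simp
  qed
  consider "k = i" "l = j" | "k = j" "l = i" | "k = i" "l = m" | "k = m" "l = i" | "k = j" "l = m" | "k = m" "l = j"
    using kl m ij by (cases i; cases j; cases m; cases k; cases l) simp_all
  then show ?thesis
    by cases (use * ** c in simp_all)
qed

text \<open>
  A linear section of the canonical map off the diagonal: the image of the value at a matrix has the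
  same off-diagonal entries as the matrix.
\<close>

definition off_diagonal :: "'a mat \<Rightarrow> 'v" where
  "off_diagonal a = elem I1 I2 (a I1 I2) \<oplus>\<^bsub>L\<^esub> (elem I1 I3 (a I1 I3) \<oplus>\<^bsub>L\<^esub> (elem I2 I1 (a I2 I1) \<oplus>\<^bsub>L\<^esub>
    (elem I2 I3 (a I2 I3) \<oplus>\<^bsub>L\<^esub> (elem I3 I1 (a I3 I1) \<oplus>\<^bsub>L\<^esub> elem I3 I2 (a I3 I2)))))"

end

section \<open>Elementary matrices\<close>

context assoc_superalgebra
begin

lemma E_mult:
  assumes "a \<in> carrier A" "b \<in> carrier A"
  shows "mult (mat_superalgebra A) (E A i j a) (E A k l b) =
    (if j = k then E A i l (a \<otimes>\<^bsub>A\<^esub> b) else (\<lambda>i j. \<zero>\<^bsub>A\<^esub>))"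
  using assms by (cases j; cases k) (auto simp: E_def fun_eq_iff)

lemma E_homog:
  assumes "a \<in> homog A p"
  shows "E A i j a \<in> homog (mat_superalgebra A) (idx_parity i + idx_parity j + p)"
proof -
  have "idx_parity i + idx_parity j + p + idx_parity i + idx_parity j = p"
    by (cases "idx_parity i"; cases "idx_parity j"; simp)
  then show ?thesis using assms by (simp add: E_def)
qed

lemma E_closed: "a \<in> carrier A \<Longrightarrow> E A i j a \<in> carrier (mat_superalgebra A)"
  by (simp add: E_def)

lemma E_add: "a \<in> carrier A \<Longrightarrow> b \<in> carrier A \<Longrightarrow> 
  E A i j (a \<oplus>\<^bsub>A\<^esub> b) = add (mat_superalgebra A) (E A i j a) (E A i j b)"
  by (auto simp: E_def fun_eq_iff)

lemma E_smult: "c \<in> carrier K \<Longrightarrow> a \<in> carrier A \<Longrightarrow>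
  E A i j (c \<odot>\<^bsub>A\<^esub> a) = smult (mat_superalgebra A) c (E A i j a)"
  by (auto simp: E_def fun_eq_iff)

lemma E_supercommutator:
  assumes "a \<in> homog A p" "b \<in> homog A q"
  shows "bracket (gl21 A) (E A i j a) (E A k l b) = (\<lambda>u v.
     (if j = k then E A i l (a \<otimes>\<^bsub>A\<^esub> b) u v else \<zero>\<^bsub>A\<^esub>) \<ominus>\<^bsub>A\<^esub>
     signed A ((idx_parity i + idx_parity j + p) * (idx_parity k + idx_parity l + q))
       (if l = i then E A k j (b \<otimes>\<^bsub>A\<^esub> a) u v else \<zero>\<^bsub>A\<^esub>))"
proof -
  interpret S: assoc_superalgebra K "mat_superalgebra A" by (rule assoc_superalgebra_mat)
  have ab: "a \<in> carrier A" "b \<in> carrier A" using assms homog_closed by auto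
  let ?d = "(idx_parity i + idx_parity j + p) * (idx_parity k + idx_parity l + q)"
  let ?X = "if j = k then E A i l (a \<otimes>\<^bsub>A\<^esub> b) else (\<lambda>i j. \<zero>\<^bsub>A\<^esub>)"
  let ?Y = "if l = i then E A k j (b \<otimes>\<^bsub>A\<^esub> a) else (\<lambda>i j. \<zero>\<^bsub>A\<^esub>)"
  have Y: "?Y \<in> carrier (mat_superalgebra A)" using ab by (simp add: E_def)
  have sY: "signed (mat_superalgebra A) ?d ?Y \<in> carrier (mat_superalgebra A)" by (rule S.signed_closed[OF Y])
  have "bracket (gl21 A) (E A i j a) (E A k l b) =
      ?X \<ominus>\<^bsub>mat_superalgebra A\<^esub> signed (mat_superalgebra A) ?d ?Y"
    unfolding gl21_def lie_of_simps
    by (subst S.supercommutator_homog[OF E_homog E_homog, OF assms]) (simp only: S.graded_commutator_def E_mult ab)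
  also have "\<dots> = (\<lambda>u v. ?X u v \<ominus>\<^bsub>A\<^esub> signed A ?d (?Y u v))"
    unfolding a_minus_def a_inv_mat[OF sY] by (simp only: signed_mat[OF Y] mat_simps)
  finally show ?thesis by (simp add: if_distrib[of "\<lambda>f. f _ _"] cong: if_cong)
qed

lemma gl21_simps [simp]:
  "carrier (gl21 A) = carrier (mat_superalgebra A)" "zero (gl21 A) = (\<lambda>i j. \<zero>\<^bsub>A\<^esub>)"
  "add (gl21 A) = add (mat_superalgebra A)" "smult (gl21 A) = smult (mat_superalgebra A)"
  "homog (gl21 A) = homog (mat_superalgebra A)"
  by (simp_all add: gl21_def)

lemma steinberg_system_gl21: "steinberg_system K A (gl21 A) (\<lambda>i j p a. E A i j a)"
proof -
  interpret L: lie_superalgebra K "gl21 A" by (rule lie_superalgebra_gl21)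
  show ?thesis
  proof (unfold_locales, goal_cases)
    case (4 i j k a p b q)
    then have "a \<otimes>\<^bsub>A\<^esub> b \<in> carrier A" by (simp add: homog_mult)
    with 4 show ?case
      by (simp add: E_supercommutator) (auto simp: fun_eq_iff E_def M.minus_eq)
  next
    case (5 i j k l a p b q)
    then show ?case by (auto simp: E_supercommutator fun_eq_iff M.minus_eq)
  qed (simp_all add: E_homog E_add E_smult del: mat_simps)
qed

text \<open>
  Every matrix is the sum of nine matrix units with coefficients.
\<close>

lemma mat_induct:
  assumes x: "x \<in> carrier (mat_superalgebra A)"
    and E: "\<And>i j p a. a \<in> homog A p \<Longrightarrow> Q (E A i j a)"
    and add: "\<And>x y. x \<in> carrier (mat_superalgebra A) \<Longrightarrow> y \<in> carrier (mat_superalgebra A) \<Longrightarrow>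
      Q x \<Longrightarrow> Q y \<Longrightarrow> Q (add (mat_superalgebra A) x y)"
  shows "Q x"
proof -
  have E': "Q (E A i j a)" if "a \<in> carrier A" for i j a
    using that by (induction rule: homog_induct) (simp_all add: E add E_add E_closed del: mat_simps)
  have c: "x i j \<in> carrier A" for i j using x by simp
  let ?add = "add (mat_superalgebra A)"
  let ?e = "\<lambda>i j. E A i j (x i j)"
  have "x = ?add (?add (?add (?e I1 I1) (?e I1 I2)) (?add (?e I1 I3) (?e I2 I1)))
     (?add (?add (?e I2 I2) (?e I2 I3)) (?add (?e I3 I1) (?add (?e I3 I2) (?e I3 I3))))"
    (is "x = ?s")
  proof (intro ext)
    fix u v show "x u v = ?s u v" by (cases u; cases v) (simp_all add: E_def c)
  qed
  moreover have "Q ?s"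
    by (intro add E' c) (use c in \<open>simp_all add: E_def\<close>)
  ultimately show ?thesis by simp
qed

end

text \<open>
  Root elements are brackets of root elements, so they belong to the derived algebra.
\<close>

lemma (in steinberg_system) steinberg_system_derived:
  "steinberg_system K A (graded_sub L (derived_submodule K L)) e"
proof -
  interpret D: lie_superalgebra K "graded_sub L (derived_submodule K L)" by (rule L.lie_superalgebra_derived)
  have "e i j p a \<in> derived_submodule K L" if "i \<noteq> j" "a \<in> homog A p" for i j p a
    using L.bracket_in_derived[of "e i (third i j) p a" "e (third i j) j 0 \<one>\<^bsub>A\<^esub>"] that third_neq[OF that(1)]
      A.homog_closed[OF that(2)]
    by (simp add: e_bracket)
  then show ?thesis
    by unfold_locales (simp_all add: e_homog e_add e_smult e_bracket e_bracket_zero)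
qed

lemma (in assoc_superalgebra) steinberg_system_sl21: "steinberg_system K A (sl21 K A) (\<lambda>i j p a. E A i j a)"
  unfolding sl21_def by (rule steinberg_system.steinberg_system_derived[OF steinberg_system_gl21])

lemma (in assoc_superalgebra) canonical_hom_exists: "\<exists>\<phi>. is_canonical_hom K A \<phi>"
  using steinberg_system.st21_universal[OF steinberg_system_sl21] unfolding is_canonical_hom_def by metis



section \<open>The canonical epimorphism\<close>

context assoc_superalgebra
begin

abbreviation "st \<equiv> st21 K A"
abbreviation "sl \<equiv> sl21 K A"

lemma st21_generated:
  assumes "submodule W K st"
    and "\<And>i j p a. i \<noteq> j \<Longrightarrow> a \<in> homog A p \<Longrightarrow> F K A i j p a \<in> W"
    and "\<And>w i j p a. w \<in> W \<Longrightarrow> i \<noteq> j \<Longrightarrow> a \<in> homog A p \<Longrightarrow> bracket st w (F K A i j p a) \<in> W"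
  shows "W = carrier st"
proof -
  interpret P: lie_presentation K "st_gens A" st_degree "st_relations K A"
    by (rule lie_presentation_st) unfold_locales
  show ?thesis unfolding st21_def
    by (rule P.generated) (use assms in \<open>auto simp: st21_def F_def st_gens_def\<close>)
qed

lemma st21_centre:
  assumes "z \<in> carrier st"
    and "\<And>i j p a. i \<noteq> j \<Longrightarrow> a \<in> homog A p \<Longrightarrow> bracket st z (F K A i j p a) = \<zero>\<^bsub>st\<^esub>"
  shows "z \<in> lie_centre st"
proof -
  interpret P: lie_presentation K "st_gens A" st_degree "st_relations K A"
    by (rule lie_presentation_st) unfold_locales
  show ?thesis unfolding st21_def
    by (rule P.centre_generators) (use assms in \<open>auto simp: st21_def F_def st_gens_def\<close>)
qed

text \<open>
  Every generator is a bracket of two generators through the third index.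
\<close>

lemma perfect_st21: "perfect K st"
proof -
  interpret S: steinberg_system K A st "F K A" by (rule steinberg_system_F) unfold_locales
  show ?thesis unfolding perfect_def
  proof (rule st21_generated)
    show "submodule (derived_submodule K st) K st" by (rule S.L.derived_submodule_submodule)
    show "F K A i j p a \<in> derived_submodule K st" if "i \<noteq> j" "a \<in> homog A p" for i j p a
      using S.L.bracket_in_derived[of "F K A i (third i j) p a" "F K A (third i j) j 0 \<one>\<^bsub>A\<^esub>"] that third_neq[OF that(1)]
      by (simp add: S.e_bracket)
    show "bracket st w (F K A i j p a) \<in> derived_submodule K st"
      if "w \<in> derived_submodule K st" "i \<noteq> j" "a \<in> homog A p" for w i j p a
      using that S.L.submoduleE(1)[OF S.L.derived_submodule_submodule] by (intro S.L.bracket_in_derived) auto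
  qed
qed

end

context steinberg_system
begin

lemma off_diagonal_closed [simp]: "a \<in> carrier (mat_superalgebra A) \<Longrightarrow> off_diagonal a \<in> carrier L"
  by (simp add: off_diagonal_def)

lemma off_diagonal_add:
  "a \<in> carrier (mat_superalgebra A) \<Longrightarrow> b \<in> carrier (mat_superalgebra A) \<Longrightarrow>
    off_diagonal (add (mat_superalgebra A) a b) = off_diagonal a \<oplus>\<^bsub>L\<^esub> off_diagonal b"
  by (simp add: off_diagonal_def elem_add L.M.a_ac)

lemma off_diagonal_smult:
  "c \<in> carrier K \<Longrightarrow> a \<in> carrier (mat_superalgebra A) \<Longrightarrow>
    off_diagonal (smult (mat_superalgebra A) c a) = c \<odot>\<^bsub>L\<^esub> off_diagonal a"
  by (simp add: off_diagonal_def elem_smult L.smult_r_distr)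

lemma off_diagonal_E: "k \<noteq> l \<Longrightarrow> c \<in> carrier A \<Longrightarrow> off_diagonal (E A k l c) = elem k l c"
  by (cases k; cases l) (simp_all add: off_diagonal_def E_def)

lemma off_diagonal_off_zero: "(\<And>i j. i \<noteq> j \<Longrightarrow> a i j = \<zero>\<^bsub>A\<^esub>) \<Longrightarrow> off_diagonal a = \<zero>\<^bsub>L\<^esub>"
  by (simp add: off_diagonal_def)

end

locale canonical = assoc_superalgebra K A
  for K :: "'k ring" and A :: "('k, 'a) superalgebra" +
  fixes \<phi> :: "('k, 'a st_gen) lie_term set \<Rightarrow> 'a mat"
  assumes canonical: "is_canonical_hom K A \<phi>"
begin

sublocale S: steinberg_system K A st "F K A"
  by (rule steinberg_system_F) unfold_locales

sublocale GL: lie_superalgebra K "gl21 A"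
  by (rule lie_superalgebra_gl21)

sublocale SL: lie_superalgebra K sl
  by (rule lie_superalgebra_sl21)

lemma \<phi>_hom: "\<phi> \<in> lie_hom K st sl"
  using canonical by (simp add: is_canonical_hom_def)

lemmas \<phi> = lie_homD[OF \<phi>_hom]

lemma \<phi>_F: "i \<noteq> j \<Longrightarrow> a \<in> homog A p \<Longrightarrow> \<phi> (F K A i j p a) = E A i j a"
  using canonical by (simp add: is_canonical_hom_def)

lemma \<phi>_neg: "x \<in> carrier st \<Longrightarrow> \<phi> (\<ominus>\<^bsub>st\<^esub> x) = \<ominus>\<^bsub>sl\<^esub> \<phi> x"
  by (rule lie_hom_neg[OF \<phi>_hom]) unfold_locales

lemma sl_simps [simp]:
  "carrier sl = derived_submodule K (gl21 A)" "zero sl = (\<lambda>i j. \<zero>\<^bsub>A\<^esub>)"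
  "add sl = add (mat_superalgebra A)" "smult sl = smult (mat_superalgebra A)" "mult sl = mult (gl21 A)"
  by (simp_all add: sl21_def)

lemma \<phi>_zero: "\<phi> \<zero>\<^bsub>st\<^esub> = (\<lambda>i j. \<zero>\<^bsub>A\<^esub>)"
  using lie_hom_zero[OF \<phi>_hom] S.L.graded_module_axioms SL.graded_module_axioms by simp

lemma \<phi>_elem: "i \<noteq> j \<Longrightarrow> a \<in> carrier A \<Longrightarrow> \<phi> (S.elem i j a) = E A i j a"
  using homog_part_sum[of a] by (simp add: S.elem_def \<phi> \<phi>_F del: mat_simps flip: E_add)

lemma \<phi>_off_diagonal:
  assumes "a \<in> carrier (mat_superalgebra A)" "i \<noteq> j"
  shows "\<phi> (S.off_diagonal a) i j = a i j"
  using assms by (cases i; cases j) (simp_all add: S.off_diagonal_def \<phi> \<phi>_elem E_def)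

subsection \<open>Surjectivity\<close>

text \<open>
  Seen in the whole of $\mathfrak{gl}(2,1,A)$, in order to compare the image with the derived submodule.
\<close>

lemma \<phi>_image_submodule: "submodule (\<phi> ` carrier st) K (gl21 A)"
proof (rule GL.submoduleI)
  have D: "\<phi> x \<in> derived_submodule K (gl21 A)" if "x \<in> carrier st" for x using \<phi>(1)[OF that] by simp
  show "\<phi> ` carrier st \<subseteq> carrier (gl21 A)"
    using D GL.submoduleE(1)[OF GL.derived_submodule_submodule] by blast
  show "\<zero>\<^bsub>gl21 A\<^esub> \<in> \<phi> ` carrier st"
    by (rule image_eqI[of _ _ "\<zero>\<^bsub>st\<^esub>"]) (simp_all add: \<phi>_zero)
  show "\<ominus>\<^bsub>gl21 A\<^esub> a \<in> \<phi> ` carrier st" if a: "a \<in> \<phi> ` carrier st" for a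
  proof -
    obtain x where x: "x \<in> carrier st" "a = \<phi> x" using a by blast
    have "\<phi> (\<ominus>\<^bsub>st\<^esub> x) = \<ominus>\<^bsub>gl21 A\<^esub> \<phi> x"
      using \<phi>_neg[OF x(1)] GL.a_inv_graded_sub[OF GL.derived_submodule_submodule D[OF x(1)]]
      by (simp only: sl21_def)
    then show ?thesis using x by (intro image_eqI[of _ _ "\<ominus>\<^bsub>st\<^esub> x"]) simp_all
  qed
  show "a \<oplus>\<^bsub>gl21 A\<^esub> b \<in> \<phi> ` carrier st" if a: "a \<in> \<phi> ` carrier st" and b: "b \<in> \<phi> ` carrier st" for a b
  proof -
    obtain x y where x: "x \<in> carrier st" "a = \<phi> x" and y: "y \<in> carrier st" "b = \<phi> y" using a b by blast
    then have "\<phi> (x \<oplus>\<^bsub>st\<^esub> y) = a \<oplus>\<^bsub>gl21 A\<^esub> b" by (simp only: \<phi>(2) sl_simps gl21_simps)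
    then show ?thesis using x y by (intro image_eqI[of _ _ "x \<oplus>\<^bsub>st\<^esub> y"]) simp_all
  qed
  show "c \<odot>\<^bsub>gl21 A\<^esub> a \<in> \<phi> ` carrier st" if c: "c \<in> carrier K" and a: "a \<in> \<phi> ` carrier st" for c a
  proof -
    obtain x where x: "x \<in> carrier st" "a = \<phi> x" using a by blast
    then have "\<phi> (c \<odot>\<^bsub>st\<^esub> x) = c \<odot>\<^bsub>gl21 A\<^esub> a" using c by (simp only: \<phi>(3) sl_simps gl21_simps)
    then show ?thesis using x c by (intro image_eqI[of _ _ "c \<odot>\<^bsub>st\<^esub> x"]) simp_all
  qed
qed

lemma E_in_image: "i \<noteq> j \<Longrightarrow> a \<in> carrier A \<Longrightarrow> E A i j a \<in> \<phi> ` carrier st"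
  using \<phi>_elem[of i j a] S.elem_closed[of i j a] by (intro image_eqI[of _ _ "S.elem i j a"]) simp_all

text \<open>
  A bracket involving an off-diagonal unit lies in the image because its value is again off-diagonal or
  a bracket of off-diagonal units. For two diagonal units at the same place $i$ the identity
  $$[E_{ii}(a), E_{ii}(b)] = [E_{im}(a), E_{mi}(b)] - (-1)^{|a||b|} [E_{im}(1), E_{mi}(ba)]$$
  is used, in which the contributions at the place $m$ cancel.
\<close>

lemma bracket_E_in_image:
  assumes a: "a \<in> homog A p" and b: "b \<in> homog A q"
  shows "bracket (gl21 A) (E A i j a) (E A k l b) \<in> \<phi> ` carrier st"
proof -
  let ?I = "\<phi> ` carrier st"
  note I = GL.submoduleE[OF \<phi>_image_submodule]
  have I0: "(\<lambda>i j. \<zero>\<^bsub>A\<^esub>) \<in> ?I" using \<phi>_zero by (intro image_eqI[of _ _ "\<zero>\<^bsub>st\<^esub>"]) simp_all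
  note [simp] = homog_closed[OF a] homog_closed[OF b]
  have off: "bracket (gl21 A) (E A i j a) (E A k l b) \<in> ?I" if ijkl: "i \<noteq> j" "k \<noteq> l"
    and a: "a \<in> homog A p" and b: "b \<in> homog A q" for i j k l a b p q
  proof -
    have "bracket (gl21 A) (E A i j a) (E A k l b) = \<phi> (bracket st (F K A i j p a) (F K A k l q b))"
      using ijkl a b by (simp add: \<phi> \<phi>_F)
    then show ?thesis using ijkl a b by simp
  qed
  consider "i \<noteq> j" "k \<noteq> l" | "i = j" "k \<noteq> l" | "i \<noteq> j" "k = l" | "i = j" "k = l" "i \<noteq> k" | "i = j" "k = l" "i = k"
    by blast
  then show ?thesis
  proof cases
    case 1
    then show ?thesis using off a b by blast
  next
    case 2
    have "bracket (gl21 A) (E A i j a) (E A k l b) =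
      E A k l ((if i = k then a \<otimes>\<^bsub>A\<^esub> b else \<zero>\<^bsub>A\<^esub>) \<ominus>\<^bsub>A\<^esub>
       signed A (p * (idx_parity k + idx_parity l + q)) (if l = i then b \<otimes>\<^bsub>A\<^esub> a else \<zero>\<^bsub>A\<^esub>))"
      unfolding E_supercommutator[OF a b] using 2 by (auto simp: E_def fun_eq_iff M.minus_eq)
    then show ?thesis using 2 E_in_image[of k l] by simp
  next
    case 3
    have "bracket (gl21 A) (E A i j a) (E A k l b) =
      E A i j ((if j = k then a \<otimes>\<^bsub>A\<^esub> b else \<zero>\<^bsub>A\<^esub>) \<ominus>\<^bsub>A\<^esub>
       signed A ((idx_parity i + idx_parity j + p) * q) (if k = i then b \<otimes>\<^bsub>A\<^esub> a else \<zero>\<^bsub>A\<^esub>))"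
      unfolding E_supercommutator[OF a b] using 3 by (auto simp: E_def fun_eq_iff M.minus_eq)
    then show ?thesis using 3 E_in_image[of i j] by simp
  next
    case 4
    then show ?thesis using I0 by (auto simp: E_supercommutator[OF a b] M.minus_eq)
  next
    case 5
    obtain m where m: "m \<noteq> i" by (cases i) auto
    have ba: "b \<otimes>\<^bsub>A\<^esub> a \<in> homog A (q + p)" by (rule homog_mult[OF b a])
    let ?u = "bracket (gl21 A) (E A i m a) (E A m i b)"
    let ?v = "bracket (gl21 A) (E A i m \<one>\<^bsub>A\<^esub>) (E A m i (b \<otimes>\<^bsub>A\<^esub> a))"
    have uv: "?u \<in> ?I" "?v \<in> ?I"
      by (rule off[OF m[symmetric] m a b]) (rule off[OF m[symmetric] m homog_one ba])
    have sv: "signed (gl21 A) (p * q) ?v \<in> ?I" "\<ominus>\<^bsub>gl21 A\<^esub> signed (gl21 A) (p * q) ?v \<in> ?I"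
      using GL.signed_in_submodule[OF \<phi>_image_submodule uv(2)] I(3) by blast+
    have v: "?v \<in> carrier (mat_superalgebra A)" "signed (mat_superalgebra A) (p * q) ?v \<in> carrier (mat_superalgebra A)"
      using uv sv I(1) by (auto simp: gl21_def)
    have "bracket (gl21 A) (E A i j a) (E A k l b) = ?u \<oplus>\<^bsub>gl21 A\<^esub> (\<ominus>\<^bsub>gl21 A\<^esub> signed (gl21 A) (p * q) ?v)"
    proof -
      have "\<ominus>\<^bsub>gl21 A\<^esub> signed (gl21 A) (p * q) ?v = (\<lambda>u w. \<ominus>\<^bsub>A\<^esub> signed A (p * q) (?v u w))"
        using a_inv_mat[OF v(2)] signed_mat[OF v(1), of "p * q"] by (simp add: gl21_def)
      moreover have "bracket (gl21 A) (E A i j a) (E A k l b) u w = 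
        ?u u w \<oplus>\<^bsub>A\<^esub> (\<ominus>\<^bsub>A\<^esub> signed A (p * q) (?v u w))" for u w
        unfolding E_supercommutator[OF a b] E_supercommutator[OF homog_one ba] using 5 m
        by (cases "idx_parity i"; cases "idx_parity m"; cases p; cases q)
          (auto simp: E_def signed_def M.minus_eq M.minus_add M.r_neg M.l_neg M.a_ac)
      ultimately show ?thesis by (simp add: fun_eq_iff)
    qed
    then show ?thesis using I(5)[OF uv(1) sv(2)] by simp
  qed
qed


lemma \<phi>_surj: "\<phi> ` carrier st = carrier sl"
proof
  show "\<phi> ` carrier st \<subseteq> carrier sl" using \<phi>(1) by blast
  let ?I = "\<phi> ` carrier st"
  note I = GL.submoduleE[OF \<phi>_image_submodule]
  have "bracket (gl21 A) x y \<in> ?I" if x: "x \<in> carrier (gl21 A)" and y: "y \<in> carrier (gl21 A)" for x y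
  proof (rule mat_induct[of x])
    fix i j p a assume a: "a \<in> homog A p"
    then have Ea: "E A i j a \<in> carrier (gl21 A)" using E_closed homog_closed by (simp del: mat_simps)
    show "bracket (gl21 A) (E A i j a) y \<in> ?I"
    proof (rule mat_induct[of y])
      show "bracket (gl21 A) (E A i j a) (E A k l b) \<in> ?I" if "b \<in> homog A q" for k l q b
        by (rule bracket_E_in_image[OF a that])
    qed (use y GL.bracket_add_right[OF Ea] I(5) in \<open>simp_all del: mat_simps\<close>)
  qed (use x y GL.bracket_add_left I(5) in \<open>simp_all del: mat_simps\<close>)
  then have "derived_submodule K (gl21 A) \<subseteq> ?I"
    by (intro GL.derived_submodule_least \<phi>_image_submodule)
  then show "carrier sl \<subseteq> ?I" by simp
qed

subsection \<open>The kernel is central\<close>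

text \<open>
  The elements that behave like diagonal matrices. Instead of the span of the brackets
  $[F_{ij}(a), F_{ji}(b)]$, these are all elements with the two properties that a kernel element is
  tested for; being a submodule is then immediate.
\<close>

definition diag :: "('k, 'a st_gen) lie_term set set" where
  "diag = {d \<in> carrier st. (\<forall>k l p c. k \<noteq> l \<longrightarrow> c \<in> homog A p \<longrightarrow> bracket st d (F K A k l p c) \<in> S.root_space k l) \<and>
     (\<forall>i j. i \<noteq> j \<longrightarrow> \<phi> d i j = \<zero>\<^bsub>A\<^esub>)}"

lemma diag_zero: "\<zero>\<^bsub>st\<^esub> \<in> diag"
  by (simp add: diag_def \<phi>_zero)

lemma diag_add: "x \<in> diag \<Longrightarrow> y \<in> diag \<Longrightarrow> x \<oplus>\<^bsub>st\<^esub> y \<in> diag"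
  by (simp add: diag_def S.L.bracket_add_left \<phi> S.root_spaceE(5))

lemma diag_smult: "c \<in> carrier K \<Longrightarrow> x \<in> diag \<Longrightarrow> c \<odot>\<^bsub>st\<^esub> x \<in> diag"
  by (simp add: diag_def S.L.bracket_smult_left \<phi> S.root_spaceE(4))

lemma diag_closed [simp]: "x \<in> diag \<Longrightarrow> x \<in> carrier st"
  by (simp add: diag_def)

lemma diag_root_space: "d \<in> diag \<Longrightarrow> k \<noteq> l \<Longrightarrow> c \<in> homog A p \<Longrightarrow> bracket st d (F K A k l p c) \<in> S.root_space k l"
  unfolding diag_def by blast

lemma diag_diagonal: "d \<in> diag \<Longrightarrow> i \<noteq> j \<Longrightarrow> \<phi> d i j = \<zero>\<^bsub>A\<^esub>"
  unfolding diag_def by blast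

lemma diag_bracket:
  assumes "i \<noteq> j" "a \<in> homog A p" "b \<in> homog A q"
  shows "bracket st (F K A i j p a) (F K A j i q b) \<in> diag"
proof -
  have diagonal: "\<phi> (bracket st (F K A i j p a) (F K A j i q b)) u v = \<zero>\<^bsub>A\<^esub>" if uv: "u \<noteq> v" for u v
  proof -
    have diag: "E A k k c u v = \<zero>\<^bsub>A\<^esub>" for k c using uv by (auto simp: E_def)
    have "\<phi> (bracket st (F K A i j p a) (F K A j i q b)) = bracket (gl21 A) (E A i j a) (E A j i b)"
      using assms by (simp add: \<phi> \<phi>_F)
    then show ?thesis by (simp only: E_supercommutator[OF assms(2,3)] diag) (simp add: M.minus_eq)
  qed
  show ?thesis
    unfolding diag_def
  proof (intro CollectI conjI allI impI)
    show "bracket st (F K A i j p a) (F K A j i q b) \<in> carrier st" using assms by simp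
    show "bracket st (bracket st (F K A i j p a) (F K A j i q b)) (F K A k l r c) \<in> S.root_space k l"
      if "k \<noteq> l" "c \<in> homog A r" for k l r c
      by (rule S.diagonal_bracket_root_space[OF assms that])
  qed (rule diagonal)
qed

definition decomposable :: "('k, 'a st_gen) lie_term set set" where
  "decomposable = {d \<oplus>\<^bsub>st\<^esub> S.off_diagonal a |d a. d \<in> diag \<and> a \<in> carrier (mat_superalgebra A)}"

lemma decomposableI: "d \<in> diag \<Longrightarrow> a \<in> carrier (mat_superalgebra A) \<Longrightarrow> d \<oplus>\<^bsub>st\<^esub> S.off_diagonal a \<in> decomposable"
  unfolding decomposable_def by blast

lemma decomposable_submodule: "submodule decomposable K st"
proof (rule S.L.submoduleI)
  have z: "(\<lambda>i j. \<zero>\<^bsub>A\<^esub>) \<in> carrier (mat_superalgebra A)" by simp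
  have "S.off_diagonal (\<lambda>i j. \<zero>\<^bsub>A\<^esub>) = \<zero>\<^bsub>st\<^esub>" by (rule S.off_diagonal_off_zero) simp
  then show "\<zero>\<^bsub>st\<^esub> \<in> decomposable" using decomposableI[OF diag_zero z] by simp
  show sub: "decomposable \<subseteq> carrier st" unfolding decomposable_def using diag_closed S.off_diagonal_closed by blast
  show sm: "c \<odot>\<^bsub>st\<^esub> x \<in> decomposable" if "c \<in> carrier K" "x \<in> decomposable" for c x
  proof -
    obtain d a where x: "x = d \<oplus>\<^bsub>st\<^esub> S.off_diagonal a" "d \<in> diag" "a \<in> carrier (mat_superalgebra A)"
      using \<open>x \<in> decomposable\<close> unfolding decomposable_def by blast
    have "smult (mat_superalgebra A) c a \<in> carrier (mat_superalgebra A)" using x that by simp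
    with decomposableI[OF diag_smult[OF that(1) x(2)] this] show ?thesis
      using x that by (simp add: S.off_diagonal_smult S.L.smult_r_distr del: mat_simps)
  qed
  show "\<ominus>\<^bsub>st\<^esub> x \<in> decomposable" if "x \<in> decomposable" for x
    using sm[of "\<ominus>\<^bsub>K\<^esub> \<one>\<^bsub>K\<^esub>" x] that sub by (auto simp: S.L.smult_l_minus)
  show "x \<oplus>\<^bsub>st\<^esub> y \<in> decomposable" if "x \<in> decomposable" "y \<in> decomposable" for x y
  proof -
    obtain d a where x: "x = d \<oplus>\<^bsub>st\<^esub> S.off_diagonal a" "d \<in> diag" "a \<in> carrier (mat_superalgebra A)"
      using \<open>x \<in> decomposable\<close> unfolding decomposable_def by blast
    obtain d' a' where y: "y = d' \<oplus>\<^bsub>st\<^esub> S.off_diagonal a'" "d' \<in> diag" "a' \<in> carrier (mat_superalgebra A)"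
      using \<open>y \<in> decomposable\<close> unfolding decomposable_def by blast
    have "add (mat_superalgebra A) a a' \<in> carrier (mat_superalgebra A)" using x y by simp
    with decomposableI[OF diag_add[OF x(2) y(2)] this] show ?thesis
      using x y by (simp add: S.off_diagonal_add S.L.M.a_ac del: mat_simps)
  qed
qed

lemmas decomposableE = S.L.submoduleE[OF decomposable_submodule]

lemma diag_subset_decomposable: "d \<in> diag \<Longrightarrow> d \<in> decomposable"
proof -
  assume d: "d \<in> diag"
  have z: "(\<lambda>i j. \<zero>\<^bsub>A\<^esub>) \<in> carrier (mat_superalgebra A)" by simp
  have "S.off_diagonal (\<lambda>i j. \<zero>\<^bsub>A\<^esub>) = \<zero>\<^bsub>st\<^esub>" by (rule S.off_diagonal_off_zero) simp
  then show "d \<in> decomposable" using decomposableI[OF d z] d by simp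
qed

lemma root_space_subset_decomposable: "i \<noteq> j \<Longrightarrow> x \<in> S.root_space i j \<Longrightarrow> x \<in> decomposable"
  using decomposableI[OF diag_zero E_closed, of _ i j] by (auto simp: S.root_space_def S.off_diagonal_E)

lemma decomposable_zero: "\<zero>\<^bsub>st\<^esub> \<in> decomposable"
  using diag_subset_decomposable diag_zero by blast

text \<open>
  Two generators bracket to a root element, to zero, or, for opposite roots, to a diagonal element.
\<close>

lemma bracket_F_F_in_decomposable:
  assumes "i \<noteq> j" "k \<noteq> l" and a: "a \<in> homog A p" and c: "c \<in> homog A q"
  shows "bracket st (F K A i j p a) (F K A k l q c) \<in> decomposable"
proof -
  note [simp] = assms
  consider "j = k" "i = l" | "j = k" "i \<noteq> l" | "j \<noteq> k" "i = l" | "j \<noteq> k" "i \<noteq> l" by blast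
  then show ?thesis
  proof cases
    case 1
    then show ?thesis using diag_subset_decomposable[OF diag_bracket[OF assms(1) a c]] by simp
  next
    case 2
    then have "bracket st (F K A i j p a) (F K A k l q c) = F K A i l (p + q) (a \<otimes>\<^bsub>A\<^esub> c)"
      using S.e_bracket[of i j l a p c q] assms by simp
    then show ?thesis using root_space_subset_decomposable[OF 2(2) S.e_root_space[OF 2(2) homog_mult[OF a c]]] by simp
  next
    case 3
    note kj = 3(1)[symmetric]
    have "bracket st (F K A i j p a) (F K A k l q c) = \<ominus>\<^bsub>st\<^esub> signed st
        ((idx_parity i + idx_parity j + p) * (idx_parity k + idx_parity i + q)) (F K A k j (q + p) (c \<otimes>\<^bsub>A\<^esub> a))"
      using S.e_bracket_swap[of k i j c q a p] assms 3 by simp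
    also have "\<dots> \<in> decomposable"
      by (intro root_space_subset_decomposable[OF kj] S.root_spaceE(3)[OF kj] S.root_space_signed[OF kj] S.e_root_space[OF kj] homog_mult[OF c a])
    finally show ?thesis .
  next
    case 4
    then show ?thesis using decomposable_zero by (simp add: S.e_bracket_zero)
  qed
qed

lemma bracket_add_in_decomposable:
  assumes "x \<in> carrier st" "y \<in> carrier st" "z \<in> carrier st" "bracket st x z \<in> decomposable" "bracket st y z \<in> decomposable"
  shows "bracket st (x \<oplus>\<^bsub>st\<^esub> y) z \<in> decomposable"
  unfolding S.L.bracket_add_left[OF assms(1-3)] by (rule decomposableE(5)[OF assms(4,5)])

lemma bracket_decomposable_F:
  assumes w: "w \<in> decomposable" and kl: "k \<noteq> l" and c: "c \<in> homog A q"
  shows "bracket st w (F K A k l q c) \<in> decomposable"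
proof -
  obtain d a where x: "w = d \<oplus>\<^bsub>st\<^esub> S.off_diagonal a" "d \<in> diag" "a \<in> carrier (mat_superalgebra A)"
    using w unfolding decomposable_def by blast
  have F: "F K A k l q c \<in> carrier st" by (rule S.e_closed[OF kl c])
  have elem_in: "bracket st (S.elem i j b) (F K A k l q c) \<in> decomposable" if ij: "i \<noteq> j" and b: "b \<in> carrier A" for i j b
    unfolding S.elem_def
    by (intro bracket_add_in_decomposable F bracket_F_F_in_decomposable[OF ij kl _ c] S.e_closed[OF ij] homog_part_in b)
  have a: "a i j \<in> carrier A" for i j using x(3) by simp
  have "bracket st (S.off_diagonal a) (F K A k l q c) \<in> decomposable"
    unfolding S.off_diagonal_def by (intro bracket_add_in_decomposable F elem_in S.L.M.a_closed S.elem_closed a) simp_all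
  moreover have "bracket st d (F K A k l q c) \<in> decomposable"
    by (rule root_space_subset_decomposable[OF kl diag_root_space[OF x(2) kl c]])
  ultimately show ?thesis
    unfolding x(1) by (intro bracket_add_in_decomposable F diag_closed x S.off_diagonal_closed)
qed

lemma decomposable_eq_carrier: "decomposable = carrier st"
proof (rule st21_generated[OF decomposable_submodule])
  show "F K A i j p a \<in> decomposable" if "i \<noteq> j" "a \<in> homog A p" for i j p a
    by (rule root_space_subset_decomposable[OF that(1) S.e_root_space[OF that]])
qed (rule bracket_decomposable_F)

text \<open>
  The off-diagonal part of an element of the kernel is read off from its image, hence zero. The remaining
  diagonal part multiplies every generator into its own root space, on which the canonical map is
  injective. So it annihilates all generators.
\<close>

lemma kernel_central: "a_kernel st sl \<phi> \<subseteq> lie_centre st"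
proof
  fix x assume "x \<in> a_kernel st sl \<phi>"
  then have x: "x \<in> carrier st" "\<phi> x = (\<lambda>i j. \<zero>\<^bsub>A\<^esub>)" by (simp_all add: a_kernel_def')
  then obtain d a where d: "x = d \<oplus>\<^bsub>st\<^esub> S.off_diagonal a" "d \<in> diag" "a \<in> carrier (mat_superalgebra A)"
    using decomposable_eq_carrier unfolding decomposable_def by blast
  have "a i j = \<zero>\<^bsub>A\<^esub>" if "i \<noteq> j" for i j
  proof -
    have "\<phi> x i j = \<phi> d i j \<oplus>\<^bsub>A\<^esub> \<phi> (S.off_diagonal a) i j"
      using d by (simp add: \<phi> del: mat_simps(1)) 
    also have "\<dots> = \<zero>\<^bsub>A\<^esub> \<oplus>\<^bsub>A\<^esub> a i j" by (simp only: diag_diagonal[OF d(2) that] \<phi>_off_diagonal[OF d(3) that])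
    also have "\<dots> = a i j" using d(3) by simp
    finally show ?thesis using x(2) by simp
  qed
  then have "S.off_diagonal a = \<zero>\<^bsub>st\<^esub>" by (rule S.off_diagonal_off_zero)
  then have xdiag: "x \<in> diag" using d by simp
  show "x \<in> lie_centre st"
  proof (rule st21_centre[OF x(1)])
    fix k l :: idx and p c assume kl: "k \<noteq> l" and c: "c \<in> homog A p"
    \<comment> \<open>This bracket is a root element, and its image is a bracket with zero.\<close>
    let ?y = "bracket st x (F K A k l p c)"
    have "?y \<in> S.root_space k l" by (rule diag_root_space[OF xdiag kl c])
    then obtain b where b: "b \<in> carrier A" "?y = S.elem k l b" by (auto simp: S.root_space_def)
    have Ec: "E A k l c \<in> carrier (gl21 A)" using c homog_closed E_closed by (simp del: mat_simps)
    have "E A k l b = \<phi> ?y" using b kl by (simp add: \<phi>_elem)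
    also have "\<dots> = bracket (gl21 A) (\<zero>\<^bsub>gl21 A\<^esub>) (E A k l c)" using x kl c by (simp add: \<phi> \<phi>_F)
    also have "\<dots> = (\<lambda>i j. \<zero>\<^bsub>A\<^esub>)" using GL.bracket_zero(2)[OF Ec] by simp
    finally have "E A k l b k l = \<zero>\<^bsub>A\<^esub>" by simp
    then have "b = \<zero>\<^bsub>A\<^esub>" by (simp add: E_def)
    then show "?y = \<zero>\<^bsub>st\<^esub>" using b kl by simp
  qed
qed

lemma central_extension_\<phi>: "central_extension K st sl \<phi>"
  unfolding central_extension_def
  using \<phi>_hom \<phi>_surj kernel_central S.L.lie_superalgebra_axioms SL.lie_superalgebra_axioms by blast

end


section \<open>Universality\<close>

context assoc_superalgebra
begin

text \<open>
  Two lifts of the same map agree on brackets by \<open>bracket_cong\<close>, and brackets span a perfect algebra.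
\<close>

lemma lift_unique:
  assumes M: "central_ext K M L \<tau>" and \<rho>: "\<rho> \<in> lie_hom K st M" "\<rho>' \<in> lie_hom K st M"
    and eq: "\<And>x. x \<in> carrier st \<Longrightarrow> \<tau> (\<rho> x) = \<tau> (\<rho>' x)" and x: "x \<in> carrier st"
  shows "\<rho> x = \<rho>' x"
proof -
  interpret central_ext K M L \<tau> by (rule M)
  interpret st: lie_superalgebra K st by (rule lie_superalgebra_st21) unfold_locales
  let ?H = "{x \<in> carrier st. \<rho> x = \<rho>' x}"
  have "derived_submodule K st \<subseteq> ?H"
  proof (rule st.derived_submodule_least)
    show "submodule ?H K st"
      by (rule st.submoduleI)
        (use \<rho> in \<open>auto simp: lie_homD lie_hom_neg lie_hom_zero st.graded_module_axioms M.graded_module_axioms\<close>)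
    fix x y assume xy: "x \<in> carrier st" "y \<in> carrier st"
    then have "bracket M (\<rho> x) (\<rho> y) = bracket M (\<rho>' x) (\<rho>' y)"
      using \<rho> eq by (intro bracket_cong) (simp_all add: lie_homD)
    then show "bracket st x y \<in> ?H" using xy \<rho> by (simp add: lie_homD)
  qed
  then show ?thesis using perfect_st21 x by (auto simp: perfect_def)
qed

text \<open>
  The images of the generators form a Steinberg system in the base. Its lift defines the required
  homomorphism, which covers \<^term>\<open>\<pi>\<close> since it does so on generators.
\<close>

lemma universal_st21:
  fixes L :: "('k, 'v) superalgebra"
  assumes \<pi>: "central_extension K st L \<pi>"
  shows "universal_central_extension TYPE('t) K st L \<pi>"
  unfolding universal_central_extension_def
proof (intro conjI allI impI \<pi>)
  fix M :: "('k, 't) superalgebra" and \<tau>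
  assume "central_extension K M L \<tau>"
  then have M: "central_ext K M L \<tau>"
    by (auto simp: central_extension_def central_ext_def central_ext_axioms_def)
  interpret S: steinberg_system K A st "F K A" by (rule steinberg_system_F) unfold_locales
  have hom: "\<pi> \<in> lie_hom K st L" "lie_superalgebra K L" using \<pi> by (auto simp: central_extension_def)
  interpret C: steinberg_central K A M L \<tau> "\<lambda>i j p a. \<pi> (F K A i j p a)"
    unfolding steinberg_central_def using M S.steinberg_system_image[OF hom(2,1)] by simp
  interpret T: steinberg_system K A M C.steinberg_lift by (rule C.steinberg_system_lift)
  obtain \<rho> where \<rho>: "\<rho> \<in> lie_hom K st M" "\<And>i j p a. i \<noteq> j \<Longrightarrow> a \<in> homog A p \<Longrightarrow> \<rho> (F K A i j p a) = C.steinberg_lift i j p a"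
    using T.st21_universal by blast
  have "{x \<in> carrier st. \<tau> (\<rho> x) = \<pi> x} = carrier st" (is "?H = _")
  proof (rule st21_generated)
    note r = lie_homD[OF \<rho>(1)] and p = lie_homD[OF hom(1)] and t = C.\<tau>
    show "submodule ?H K st"
      by (rule S.L.submoduleI)
        (use \<rho>(1) hom(1) in \<open>auto simp: r p t C.\<tau>_neg lie_hom_neg lie_hom_zero
          S.L.graded_module_axioms C.M.graded_module_axioms C.L.graded_module_axioms\<close>)
    show "F K A i j p a \<in> ?H" if "i \<noteq> j" "a \<in> homog A p" for i j p a
      using that by (simp add: \<rho>(2) C.\<tau>_steinberg_lift)
    show "bracket st w (F K A i j p a) \<in> ?H" if "w \<in> ?H" "i \<noteq> j" "a \<in> homog A p" for w i j p a
      using that by (simp add: r p t) (simp add: \<rho>(2) C.\<tau>_steinberg_lift)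
  qed
  then have \<tau>\<rho>: "\<tau> (\<rho> x) = \<pi> x" if "x \<in> carrier st" for x using that by blast
  show "\<exists>\<rho>\<in>lie_hom K st M. (\<forall>x\<in>carrier st. \<tau> (\<rho> x) = \<pi> x) \<and>
     (\<forall>\<rho>'\<in>lie_hom K st M. (\<forall>x\<in>carrier st. \<tau> (\<rho>' x) = \<pi> x) \<longrightarrow> (\<forall>x\<in>carrier st. \<rho>' x = \<rho> x))"
    using \<rho>(1) \<tau>\<rho> lift_unique[OF M] by (intro bexI[of _ \<rho>]) auto
qed

lemma central_extension_id: "central_extension K st st id"
proof -
  interpret st: lie_superalgebra K st by (rule lie_superalgebra_st21) unfold_locales
  have "a_kernel st st id \<subseteq> lie_centre st" by (auto simp: a_kernel_def' lie_centre_def)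
  moreover have "id \<in> lie_hom K st st" by (auto simp: lie_hom_def)
  ultimately show ?thesis by (simp add: central_extension_def st.lie_superalgebra_axioms)
qed

text \<open>
  A section \<open>\<sigma>\<close> of $\pi$ comes from the universality of the Steinberg algebra over itself. Then
  $\sigma\pi$ and the identity are two endomorphisms of the universal extension over the base, so they
  coincide.
\<close>

lemma second_homology_trivial:
  fixes H :: "('k, 't) superalgebra"
  assumes "is_second_homology TYPE('t) K st H"
  shows "carrier H = {\<zero>\<^bsub>H\<^esub>}"
proof -
  obtain M :: "('k, 't) superalgebra" and \<pi> where M: "universal_central_extension TYPE('t) K M st \<pi>"
    and H: "H = graded_sub M (a_kernel M st \<pi>)"
    using assms unfolding is_second_homology_def by blast
  have ce: "central_extension K M st \<pi>" using M by (simp add: universal_central_extension_def)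
  then interpret C: central_ext K M st \<pi>
    by (auto simp: central_extension_def central_ext_def central_ext_axioms_def)
  note U = universal_st21[OF central_extension_id, where ?'t = 't, unfolded universal_central_extension_def,
    THEN conjunct2, rule_format, OF ce]
  obtain \<sigma> where \<sigma>1: "\<sigma> \<in> lie_hom K st M" and "\<forall>x\<in>carrier st. \<pi> (\<sigma> x) = id x"
    using U by blast
  then have \<sigma>: "\<sigma> \<in> lie_hom K st M" "\<And>x. x \<in> carrier st \<Longrightarrow> \<pi> (\<sigma> x) = x" by simp_all
  have s\<pi>: "(\<lambda>x. \<sigma> (\<pi> x)) \<in> lie_hom K M M"
    using lie_homD[OF \<sigma>(1)] C.\<tau> by (auto simp: lie_hom_def)
  have i: "(\<lambda>x. x) \<in> lie_hom K M M" by (auto simp: lie_hom_def)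
  note U' = M[unfolded universal_central_extension_def, THEN conjunct2, rule_format, OF ce]
  obtain \<rho> where "\<forall>\<rho>'\<in>lie_hom K M M. (\<forall>x\<in>carrier M. \<pi> (\<rho>' x) = \<pi> x) \<longrightarrow> (\<forall>x\<in>carrier M. \<rho>' x = \<rho> x)"
    using U' by blast
  then have \<rho>: "\<rho>' x = \<rho> x"
    if "\<rho>' \<in> lie_hom K M M" "\<forall>x\<in>carrier M. \<pi> (\<rho>' x) = \<pi> x" "x \<in> carrier M" for \<rho>' x
    using that by blast
  have inv: "\<sigma> (\<pi> x) = x" if "x \<in> carrier M" for x
    using \<rho>[OF s\<pi> _ that] \<rho>[OF i _ that] \<sigma>(2) C.\<tau>(1) by simp
  have "\<sigma> \<zero>\<^bsub>st\<^esub> = \<zero>\<^bsub>M\<^esub>"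
    using lie_hom_zero[OF \<sigma>(1)] C.L.graded_module_axioms C.M.graded_module_axioms by simp
  moreover have "x = \<sigma> \<zero>\<^bsub>st\<^esub>" if "x \<in> a_kernel M st \<pi>" for x
    using inv[of x] that by (simp add: a_kernel_def')
  moreover have "\<zero>\<^bsub>M\<^esub> \<in> a_kernel M st \<pi>" by (simp add: a_kernel_def')
  ultimately have "a_kernel M st \<pi> = {\<zero>\<^bsub>M\<^esub>}" by blast
  then show ?thesis by (simp add: H)
qed

end

theorem corollary4p2:
  fixes K :: "'k ring" and A :: "('k, 'a) superalgebra"
  assumes "cring K"
    and "assoc_superalgebra K A"
    and "\<exists>B. module_basis K A B \<and> \<one>\<^bsub>A\<^esub> \<in> B"
  shows "(\<exists>\<phi>. is_canonical_hom K A \<phi>) \<and>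
    (\<forall>\<phi>. is_canonical_hom K A \<phi> \<longrightarrow>
      universal_central_extension TYPE('t) K (st21 K A) (sl21 K A) \<phi>) \<and>
    universal_central_extension TYPE('t) K (st21 K A) (st21 K A) id \<and>
    (\<exists>H :: ('k, ('k, 'a st_gen) lie_term set) superalgebra.
      is_second_homology TYPE('t) K (st21 K A) H) \<and>
    (\<forall>H :: ('k, 't) superalgebra.
      is_second_homology TYPE('t) K (st21 K A) H \<longrightarrow> carrier H = {\<zero>\<^bsub>H\<^esub>})"
proof -
  interpret A: assoc_superalgebra K A by fact
  have "universal_central_extension TYPE('t) K (st21 K A) (sl21 K A) \<phi>" if "is_canonical_hom K A \<phi>" for \<phi>
    using that by (intro A.universal_st21 canonical.central_extension_\<phi>)
      (simp add: canonical_def canonical_axioms_def A.assoc_superalgebra_axioms)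
  moreover have u: "universal_central_extension TYPE('t) K (st21 K A) (st21 K A) id"
    by (intro A.universal_st21 A.central_extension_id)
  moreover have "\<exists>H :: ('k, ('k, 'a st_gen) lie_term set) superalgebra. is_second_homology TYPE('t) K (st21 K A) H"
    unfolding is_second_homology_def using A.perfect_st21 u by blast
  ultimately show ?thesis using A.canonical_hom_exists A.second_homology_trivial by blast
qed


end
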